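(* Let $\Omega\subset\mathbb{R}^d$ be a bounded domain with polygonal (polyhedral) boundary, let $\alpha>0$, $y_d:=-1$ and $k\ge 1$. For $n\in\mathbb{N}$, let $\mathcal{T}_n$ be simplicial decompositions of $\Omega$ with mesh sizes bounded by $h_n\searrow 0$, let $U_n$ be the (continuous or discontinuous) Lagrange finite element space of degree $k$ on $\mathcal{T}_n$ with its Lagrange basis $\{\phi_n^1,\dots,\phi_n^{N_n}\}$, and let $J_n$ be the discrete reduced cost functional defined in the context. Let $\hat\psi_1,\dots,\hat\psi_m$ be the Lagrange basis of order $k$ on the reference simplex $\hat T\subset\mathbb{R}^d$. Assume that $$\int_{\hat T}\hat\psi_j<0\quad\text{for some } j\in\{1,\dots,m\}.$$ Denote by $\bar u_n$ the unique solution of the discretized problem $$\min J_n(u_n)\quad\text{subject to } u_n=\sum_{i=1}^{N_n}\lambda_i\,\phi_n^i,\quad \lambda_i\ge 0\ \text{ for all } i=1,\dots,N_n.$$ Then there exist a subsequence of $\{\bar u_n\}_{n\in\mathbb{N}}$ and a function $u\in L^2(\Omega)$ such that $\bar u_n\rightharpoonup u$ weakly in $L^2(\Omega)$ along this subsequence, and $u$ does not satisfy $u\ge 0$ a.e. in $\Omega$.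
   Context: The continuous problem being discretized is $$\min_{(y,u)\in H^1(\Omega)\times L^2(\Omega)}\|y-y_d\|_{L^2(\Omega)}^2+\alpha\,\|u\|_{L^2(\Omega)}^2$$ subject to $u\ge 0$ and $$\int_\Omega\nabla y\cdot\nabla v+y\,v=\int_\Omega u\,v\qquad\text{for all } v\in H^1(\Omega),$$ with $y_d=-1$ constant. Meshes: $\mathcal{T}_n$ is a finite set of open, pairwise disjoint, nondegenerate simplices $T\subset\Omega$ with $\overline\Omega=\bigcup_{T\in\mathcal{T}_n}\overline T$ and $\operatorname{diam}(T)\le h_n$, where $h_n\searrow 0$. The decompositions are conforming in the usual finite element sense (the intersection of the closures of two distinct elements is empty or a common lower-dimensional face). Lagrange elements: on the reference simplex $\hat T$, the Lagrange basis $(\hat\psi_1,\dots,\hat\psi_m)$ of order $k$ is the basis of the space of polynomials of total degree at most $k$ that is nodal with respect to the standard equispaced Lagrange points, i.e. the points whose barycentric coordinates are integer multiples of $1/k$; each $\hat\psi_j$ equals $1$ at the $j$-th node and $0$ at all the others. The space $U_n$ consists either of all functions whose restriction to each $T\in\mathcal{T}_n$ is a polynomial of degree at most $k$ (discontinuous case, basis: the affine images of the $\hat\psi_j$ on each $T$, extended by zero), or of all such functions that are continuous on $\overline\Omega$ (continuous case, basis: the global nodal basis associated with the Lagrange points of the mesh). Discrete cost functional: for $u_n\in U_n$, $$J_n(u_n):=\|y_n(u_n)-y_d\|_{L^2(\Omega)}^2+\alpha\,\|u_n\|_{L^2(\Omega)}^2,$$ where $y_n(u_n)$ is the solution of a suitable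 conforming Galerkin discretization of the state equation: $y_n(u_n)\in V_n$ and $$\int_\Omega\nabla y_n(u_n)\cdot\nabla v_n+y_n(u_n)\,v_n=\int_\Omega u_n\,v_n\qquad\text{for all } v_n\in V_n.$$ Here $V_n\subset H^1(\Omega)$ are finite-dimensional (finite element) subspaces that contain the constant functions and satisfy $\inf_{v_n\in V_n}\|v-v_n\|_{H^1(\Omega)}\to 0$ as $n\to\infty$ for every $v\in H^1(\Omega)$. *)

theory Defs
  imports "HOL-Analysis.Analysis"
begin

section \<open>Lebesgue and Sobolev spaces on a domain\<close>

text \<open>
  Elements of L2 and H1 are represented by total functions; only their values almost
  everywhere on \<open>\<Omega>\<close> matter.
\<close>

definition L2 :: "'a::euclidean_space set \<Rightarrow> ('a \<Rightarrow> real) set" where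
  "L2 \<Omega> = {f. f \<in> borel_measurable (lebesgue_on \<Omega>) \<and> integrable (lebesgue_on \<Omega>) (\<lambda>x. (f x)\<^sup>2)}"

definition L2_norm :: "'a::euclidean_space set \<Rightarrow> ('a \<Rightarrow> real) \<Rightarrow> real" where
  "L2_norm \<Omega> f = sqrt (\<integral>x. (f x)\<^sup>2 \<partial>lebesgue_on \<Omega>)"

text \<open>Weak convergence, with the dual space of L2 identified with L2 itself (Riesz).\<close>

definition weakly_converges_L2 ::
    "'a::euclidean_space set \<Rightarrow> (nat \<Rightarrow> 'a \<Rightarrow> real) \<Rightarrow> ('a \<Rightarrow> real) \<Rightarrow> bool" where
  "weakly_converges_L2 \<Omega> f u \<longleftrightarrow>
     (\<forall>n. f n \<in> L2 \<Omega>) \<and> u \<in> L2 \<Omega> \<and>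
     (\<forall>g\<in>L2 \<Omega>. (\<lambda>n. \<integral>x. f n x * g x \<partial>lebesgue_on \<Omega>) \<longlonglongrightarrow> (\<integral>x. u x * g x \<partial>lebesgue_on \<Omega>))"

fun continuously_differentiable :: "nat \<Rightarrow> ('a::euclidean_space \<Rightarrow> real) \<Rightarrow> bool" where
  "continuously_differentiable 0 f \<longleftrightarrow> continuous_on UNIV f"
| "continuously_differentiable (Suc r) f \<longleftrightarrow>
     (\<forall>x. f differentiable (at x)) \<and>
     (\<forall>b\<in>Basis. continuously_differentiable r (\<lambda>x. frechet_derivative f (at x) b))"

definition test_function :: "'a::euclidean_space set \<Rightarrow> ('a \<Rightarrow> real) \<Rightarrow> bool" where
  "test_function \<Omega> \<phi> \<longleftrightarrow>
     (\<forall>r. continuously_differentiable r \<phi>) \<and>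
     compact (closure {x. \<phi> x \<noteq> 0}) \<and> closure {x. \<phi> x \<noteq> 0} \<subseteq> \<Omega>"

definition has_weak_gradient ::
    "'a::euclidean_space set \<Rightarrow> ('a \<Rightarrow> real) \<Rightarrow> ('a \<Rightarrow> 'a) \<Rightarrow> bool" where
  "has_weak_gradient \<Omega> f G \<longleftrightarrow>
     (\<forall>b\<in>Basis. (\<lambda>x. G x \<bullet> b) \<in> L2 \<Omega> \<and>
        (\<forall>\<phi>. test_function \<Omega> \<phi> \<longrightarrow>
           (\<integral>x. f x * frechet_derivative \<phi> (at x) b \<partial>lebesgue_on \<Omega>) =
           - (\<integral>x. (G x \<bullet> b) * \<phi> x \<partial>lebesgue_on \<Omega>)))"

definition H1 :: "'a::euclidean_space set \<Rightarrow> ('a \<Rightarrow> real) set" where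
  "H1 \<Omega> = {f \<in> L2 \<Omega>. \<exists>G. has_weak_gradient \<Omega> f G}"

text \<open>For \<open>f\<close> in H1 the choice is unique up to null sets.\<close>

definition weak_gradient :: "'a::euclidean_space set \<Rightarrow> ('a \<Rightarrow> real) \<Rightarrow> 'a \<Rightarrow> 'a" where
  "weak_gradient \<Omega> f = (SOME G. has_weak_gradient \<Omega> f G)"

definition H1_norm :: "'a::euclidean_space set \<Rightarrow> ('a \<Rightarrow> real) \<Rightarrow> real" where
  "H1_norm \<Omega> f =
     sqrt (\<integral>x. weak_gradient \<Omega> f x \<bullet> weak_gradient \<Omega> f x + (f x)\<^sup>2 \<partial>lebesgue_on \<Omega>)"

section \<open>Domains and simplicial decompositions\<close>

definition polyhedral_domain :: "'a::euclidean_space set \<Rightarrow> bool" where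
  "polyhedral_domain \<Omega> \<longleftrightarrow>
     open \<Omega> \<and> connected \<Omega> \<and> \<Omega> \<noteq> {} \<and> bounded \<Omega> \<and>
     (\<exists>F. finite F \<and> (\<forall>P\<in>F. polytope P) \<and> frontier \<Omega> = \<Union>F)"

definition open_simplex :: "'a::euclidean_space set \<Rightarrow> bool" where
  "open_simplex T \<longleftrightarrow> (\<exists>S. int DIM('a) simplex S \<and> T = interior S)"

text \<open>
  Conformity is the library's \<^const>\<open>triangulation\<close>: the closures of any two elements meet
  in a common face, where the empty set counts as a face.
\<close>

definition simplicial_decomposition ::
    "'a::euclidean_space set \<Rightarrow> real \<Rightarrow> 'a set set \<Rightarrow> bool" where
  "simplicial_decomposition \<Omega> h \<T> \<longleftrightarrow>
     finite \<T> \<and>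
     (\<forall>T\<in>\<T>. open_simplex T \<and> T \<subseteq> \<Omega> \<and> diameter T \<le> h) \<and>
     pairwise disjnt \<T> \<and>
     closure \<Omega> = (\<Union>T\<in>\<T>. closure T) \<and>
     triangulation (closure ` \<T>)"

section \<open>Lagrange elements\<close>

definition polynomial_of_degree_le :: "nat \<Rightarrow> ('a::euclidean_space \<Rightarrow> real) \<Rightarrow> bool" where
  "polynomial_of_degree_le k p \<longleftrightarrow>
     (\<exists>c. \<forall>x. p x =
        (\<Sum>m\<in>{m \<in> Basis \<rightarrow>\<^sub>E UNIV. (\<Sum>b\<in>Basis. m b) \<le> k}. c m * (\<Prod>b\<in>Basis. (x \<bullet> b) ^ m b)))"

definition vertices :: "'a::euclidean_space set \<Rightarrow> 'a set" where
  "vertices T = {v. v extreme_point_of closure T}"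

definition lagrange_points :: "nat \<Rightarrow> 'a::euclidean_space set \<Rightarrow> 'a set" where
  "lagrange_points k T =
     {\<Sum>v\<in>vertices T. (real (m v) / real k) *\<^sub>R v | m :: 'a \<Rightarrow> nat. (\<Sum>v\<in>vertices T. m v) = k}"

definition reference_simplex :: "'a::euclidean_space set" where
  "reference_simplex = interior (convex hull (insert 0 Basis))"

definition reference_basis :: "nat \<Rightarrow> ('a::euclidean_space \<Rightarrow> real) set" where
  "reference_basis k =
     {\<psi>. polynomial_of_degree_le k \<psi> \<and>
        (\<exists>a\<in>lagrange_points k reference_simplex.
           \<psi> a = 1 \<and> (\<forall>b\<in>lagrange_points k reference_simplex - {a}. \<psi> b = 0))}"

datatype element_kind = Discontinuous | Continuous

text \<open>
  Finite element functions are extended by zero. In the discontinuous case they are also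
  set to zero on the mesh skeleton, which is a null set.
\<close>

fun fe_space ::
    "element_kind \<Rightarrow> nat \<Rightarrow> 'a::euclidean_space set \<Rightarrow> 'a set set \<Rightarrow> ('a \<Rightarrow> real) set" where
  "fe_space Discontinuous k \<Omega> \<T> =
     {u. (\<forall>T\<in>\<T>. \<exists>p. polynomial_of_degree_le k p \<and> (\<forall>x\<in>T. u x = p x)) \<and>
         (\<forall>x. x \<notin> \<Union>\<T> \<longrightarrow> u x = 0)}"
| "fe_space Continuous k \<Omega> \<T> =
     {u. (\<forall>T\<in>\<T>. \<exists>p. polynomial_of_degree_le k p \<and> (\<forall>x\<in>T. u x = p x)) \<and>
         continuous_on (closure \<Omega>) u \<and> (\<forall>x. x \<notin> closure \<Omega> \<longrightarrow> u x = 0)}"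

text \<open>
  In the discontinuous case, \<open>G\<close> ranges over all affine maps of \<open>T\<close> onto the reference
  simplex. They differ by permutations of the vertices, which permute the reference basis,
  so the resulting set of functions is the one obtained from any single choice of \<open>G\<close>.
\<close>

fun fe_basis ::
    "element_kind \<Rightarrow> nat \<Rightarrow> 'a::euclidean_space set \<Rightarrow> 'a set set \<Rightarrow> ('a \<Rightarrow> real) set" where
  "fe_basis Discontinuous k \<Omega> \<T> =
     {\<lambda>x. if x \<in> T then \<psi> (G x) else 0 | T \<psi> (G :: 'a \<Rightarrow> 'a).
        T \<in> \<T> \<and> \<psi> \<in> reference_basis k \<and>
        (\<exists>A c. linear A \<and> (\<forall>x. G x = A x + c)) \<and> G ` T = reference_simplex}"
| "fe_basis Continuous k \<Omega> \<T> =
     {\<phi> \<in> fe_space Continuous k \<Omega> \<T>.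
        \<exists>a\<in>(\<Union>T\<in>\<T>. lagrange_points k T).
           \<phi> a = 1 \<and> (\<forall>b\<in>(\<Union>T\<in>\<T>. lagrange_points k T) - {a}. \<phi> b = 0)}"

section \<open>The discretized control problem\<close>

definition finite_dimensional_subspace :: "('a \<Rightarrow> real) set \<Rightarrow> bool" where
  "finite_dimensional_subspace V \<longleftrightarrow>
     (\<exists>B. finite B \<and> V = {\<lambda>x. \<Sum>f\<in>B. c f * f x | c :: ('a \<Rightarrow> real) \<Rightarrow> real. True})"

definition galerkin_spaces ::
    "'a::euclidean_space set \<Rightarrow> (nat \<Rightarrow> ('a \<Rightarrow> real) set) \<Rightarrow> bool" where
  "galerkin_spaces \<Omega> V \<longleftrightarrow>
     (\<forall>n. V n \<subseteq> H1 \<Omega> \<and> finite_dimensional_subspace (V n) \<and>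
          (\<forall>c. \<exists>v\<in>V n. \<forall>x\<in>\<Omega>. v x = c)) \<and>
     (\<forall>v\<in>H1 \<Omega>. (\<lambda>n. INF w\<in>V n. H1_norm \<Omega> (\<lambda>x. v x - w x)) \<longlonglongrightarrow> 0)"

text \<open>The Galerkin solution is unique up to null sets.\<close>

definition discrete_state ::
    "'a::euclidean_space set \<Rightarrow> ('a \<Rightarrow> real) set \<Rightarrow> ('a \<Rightarrow> real) \<Rightarrow> ('a \<Rightarrow> real)" where
  "discrete_state \<Omega> V u =
     (SOME y. y \<in> V \<and>
        (\<forall>v\<in>V. (\<integral>x. weak_gradient \<Omega> y x \<bullet> weak_gradient \<Omega> v x + y x * v x \<partial>lebesgue_on \<Omega>) =
                (\<integral>x. u x * v x \<partial>lebesgue_on \<Omega>)))"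

definition discrete_cost ::
    "'a::euclidean_space set \<Rightarrow> ('a \<Rightarrow> real) \<Rightarrow> real \<Rightarrow> ('a \<Rightarrow> real) set \<Rightarrow> ('a \<Rightarrow> real) \<Rightarrow> real" where
  "discrete_cost \<Omega> y\<^sub>d \<alpha> V u =
     (L2_norm \<Omega> (\<lambda>x. discrete_state \<Omega> V u x - y\<^sub>d x))\<^sup>2 + \<alpha> * (L2_norm \<Omega> u)\<^sup>2"

definition nonneg_combinations :: "('a \<Rightarrow> real) set \<Rightarrow> ('a \<Rightarrow> real) set" where
  "nonneg_combinations B =
     {\<lambda>x. \<Sum>\<phi>\<in>B. l \<phi> * \<phi> x | l :: ('a \<Rightarrow> real) \<Rightarrow> real. \<forall>\<phi>\<in>B. 0 \<le> l \<phi>}"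

definition solves_discretized_problem ::
    "element_kind \<Rightarrow> nat \<Rightarrow> 'a::euclidean_space set \<Rightarrow> ('a \<Rightarrow> real) \<Rightarrow> real \<Rightarrow> 'a set set \<Rightarrow>
     ('a \<Rightarrow> real) set \<Rightarrow> ('a \<Rightarrow> real) \<Rightarrow> bool" where
  "solves_discretized_problem K k \<Omega> y\<^sub>d \<alpha> \<T> V =
     is_arg_min (discrete_cost \<Omega> y\<^sub>d \<alpha> V)
       (\<lambda>u. u \<in> fe_space K k \<Omega> \<T> \<and> u \<in> nonneg_combinations (fe_basis K k \<Omega> \<T>))"

end

theory Submission
  imports Defs "HOL-Library.Diagonal_Subsequence"
begin

text \<open>
  Testing the discrete state equation with the constant function 1 gives that the state and the
  control have the same integral, so that \<open>J\<^sub>n u = |\<Omega>| + 2 \<integral> u + \<parallel>y\<parallel>\<^sup>2 + \<alpha> \<parallel>u\<parallel>\<^sup>2\<close>. Symmetrising a reference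
  basis function of negative integral over the vertex permutations of the simplex yields feasible
  controls that are uniformly bounded and have integral at most \<open>-\<kappa> |\<Omega>|\<close>. A small multiple of these
  shows that the minimal costs stay below \<open>|\<Omega>|\<close> by a fixed amount. Hence the integrals of the
  minimisers stay below 0 by a fixed amount, and this passes to the weak limit.
\<close>

section \<open>Polynomials and unisolvence\<close>

text \<open>The constraint acts on coefficients, that is, on nodal values, so a feasible function
  may still have a negative mean. The pieces on all elements are affine pullbacks of one function,
  so their bounds and mean values do not vary with the mesh; hence \<open>\<kappa>\<close>,
  \<open>M\<close> and \<open>step\<close> depend on \<open>\<psi>\<close>, its bound
  \<open>m\<close> and \<alpha>, but not on \<open>n\<close>. The gain from a multiple of such a
  control is linear in the multiple, its penalty quadratic; this fixes the size of
  \<open>step\<close>. The obstacle is that elements of L2 and H1 are total functions: the bilinear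
  forms are only semidefinite, weak gradients and discrete states are choices determined up to null
  sets, and their linearity must be recovered from uniqueness almost everywhere. Uniqueness of weak
  gradients rests on the fundamental lemma of the calculus of variations; that constants have
  gradient 0 rests on derivatives of test functions having integral 0.\<close>

inductive polydeg :: "nat \<Rightarrow> ('a::euclidean_space \<Rightarrow> real) \<Rightarrow> bool" where
  polydeg_const: "polydeg k (\<lambda>x. c)"
| polydeg_add: "polydeg k p \<Longrightarrow> polydeg k q \<Longrightarrow> polydeg k (\<lambda>x. p x + q x)"
| polydeg_affine_mult: "polydeg k p \<Longrightarrow> polydeg (Suc k) (\<lambda>x. (x \<bullet> w + c) * p x)"

lemma polydeg_Suc: "polydeg k p \<Longrightarrow> polydeg (Suc k) p"
  using polydeg_affine_mult[of k p 0 1] by simp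

lemma polydeg_mono: "polydeg i p \<Longrightarrow> i \<le> j \<Longrightarrow> polydeg j p"
  by (rotate_tac 1, induction rule: dec_induct) (auto intro: polydeg_Suc)

lemma polydeg_cmult: "polydeg k p \<Longrightarrow> polydeg k (\<lambda>x. c * p x)"
proof (induction rule: polydeg.induct)
  case (polydeg_const k d)
  then show ?case by (rule polydeg.polydeg_const)
next
  case (polydeg_add k p q)
  then show ?case using polydeg.polydeg_add[OF polydeg_add.IH] by (simp add: algebra_simps)
next
  case (polydeg_affine_mult k p w d)
  then show ?case using polydeg.polydeg_affine_mult[OF polydeg_affine_mult.IH, of w d]
    by (simp add: mult.left_commute)
qed

lemma polydeg_mult: "polydeg i p \<Longrightarrow> polydeg j q \<Longrightarrow> polydeg (i + j) (\<lambda>x. p x * q x)"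
proof (induction rule: polydeg.induct)
  case (polydeg_const k d)
  then show ?case using polydeg_mono[OF polydeg_cmult, of j q "k + j" d] by simp
next
  case (polydeg_add k p q)
  then show ?case using polydeg.polydeg_add by (simp add: algebra_simps)
next
  case (polydeg_affine_mult k p w d)
  then show ?case using polydeg.polydeg_affine_mult[of "k+j"] by (simp add: mult.assoc)
qed

lemma polydeg_sum: "(\<And>i. i \<in> I \<Longrightarrow> polydeg k (p i)) \<Longrightarrow> polydeg k (\<lambda>x. \<Sum>i\<in>I. p i x)"
  by (induction I rule: infinite_finite_induct) (auto intro: polydeg.intros)

lemma polydeg_diff: "polydeg k p \<Longrightarrow> polydeg k q \<Longrightarrow> polydeg k (\<lambda>x. p x - q x)"
  using polydeg_add[OF _ polydeg_cmult[of k q "-1"]] by simp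

lemma polydeg_prod:
  "finite I \<Longrightarrow> (\<And>i. i \<in> I \<Longrightarrow> polydeg (k i) (p i)) \<Longrightarrow> polydeg (\<Sum>i\<in>I. k i) (\<lambda>x. \<Prod>i\<in>I. p i x)"
  by (induction I rule: finite_induct) (auto intro: polydeg_const polydeg_mult)

lemma polydeg_affine: "polydeg 1 (\<lambda>x. x \<bullet> w + c)"
  using polydeg_affine_mult[OF polydeg_const[of 0 1]] by simp

lemma polydeg_power: "polydeg k p \<Longrightarrow> polydeg (k * n) (\<lambda>x. p x ^ n)"
  by (induction n) (auto intro: polydeg_const polydeg_mult)

text \<open>The adjoint of \<open>A\<close> turns an affine factor evaluated at
  \<open>A x + c\<close> into an affine factor in \<open>x\<close>. This is why
  \<open>polydeg\<close> is built from general affine factors and not from coordinates.\<close>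

lemma polydeg_affine_comp:
  fixes A :: "'a::euclidean_space \<Rightarrow> 'b::euclidean_space"
  assumes "polydeg k p" "linear A"
  shows "polydeg k (\<lambda>x. p (A x + c))"
  using assms(1)
proof (induction rule: polydeg.induct)
  case (polydeg_affine_mult k p w d)
  have "(A x + c) \<bullet> w + d = x \<bullet> adjoint A w + (c \<bullet> w + d)" for x
    using adjoint_works[OF assms(2), of x w] by (simp add: inner_add_left inner_add_right inner_commute)
  then show ?case
    using polydeg.polydeg_affine_mult[OF polydeg_affine_mult.IH, of "adjoint A w" "c \<bullet> w + d"]
    by (simp add: add.assoc)
qed (auto intro: polydeg.intros)

lemma polydeg_continuous: "polydeg k p \<Longrightarrow> continuous_on S p"
  by (induction rule: polydeg.induct) (auto intro!: continuous_intros)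

section \<open>Monomial expansions\<close>

abbreviation mono_exps :: "nat \<Rightarrow> ('a::euclidean_space \<Rightarrow> nat) set" where
  "mono_exps k \<equiv> {m \<in> Basis \<rightarrow>\<^sub>E UNIV. (\<Sum>b\<in>Basis. m b) \<le> k}"

lemma finite_mono_exps: "finite (mono_exps k :: ('a::euclidean_space \<Rightarrow> nat) set)"
proof (rule finite_subset)
  show "mono_exps k \<subseteq> (Basis :: 'a set) \<rightarrow>\<^sub>E {..k}"
  proof (clarsimp simp: PiE_iff)
    fix m :: "'a \<Rightarrow> nat" and b :: 'a
    assume "sum m Basis \<le> k" "b \<in> Basis"
    then show "m b \<le> k" using member_le_sum[of b Basis m] by fastforce
  qed
qed (auto intro: finite_PiE)

text \<open>Terms with equal exponents are collected by summing coefficients over the fibres of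
  \<open>f\<close>, so an expansion may use any finite index set.\<close>

lemma polynomial_of_degree_leI:
  fixes f :: "'i \<Rightarrow> 'a::euclidean_space \<Rightarrow> nat"
  assumes "finite I" "\<And>i. i \<in> I \<Longrightarrow> f i \<in> mono_exps k"
    and "\<And>x. p x = (\<Sum>i\<in>I. c i * (\<Prod>b\<in>Basis. (x \<bullet> b) ^ f i b))"
  shows "polynomial_of_degree_le k p"
  unfolding polynomial_of_degree_le_def
proof (intro exI allI)
  fix x
  have "(\<Sum>m\<in>mono_exps k. (\<Sum>i | i \<in> I \<and> f i = m. c i) * (\<Prod>b\<in>Basis. (x \<bullet> b) ^ m b))
      = (\<Sum>m\<in>mono_exps k. \<Sum>i | i \<in> I \<and> f i = m. c i * (\<Prod>b\<in>Basis. (x \<bullet> b) ^ f i b))"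
    by (intro sum.cong refl) (simp add: sum_distrib_right)
  also have "\<dots> = p x"
    unfolding assms(3) using assms(1,2) by (intro sum.group finite_mono_exps) auto
  finally show "p x = (\<Sum>m\<in>mono_exps k. (\<Sum>i | i \<in> I \<and> f i = m. c i) * (\<Prod>b\<in>Basis. (x \<bullet> b) ^ m b))" ..
qed

lemma polynomial_of_degree_le_add:
  assumes "polynomial_of_degree_le k p" "polynomial_of_degree_le k q"
  shows "polynomial_of_degree_le k (\<lambda>x. p x + q x)"
proof -
  obtain c d where "\<And>x. p x = (\<Sum>m\<in>mono_exps k. c m * (\<Prod>b\<in>Basis. (x \<bullet> b) ^ m b))"
    "\<And>x. q x = (\<Sum>m\<in>mono_exps k. d m * (\<Prod>b\<in>Basis. (x \<bullet> b) ^ m b))"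
    using assms unfolding polynomial_of_degree_le_def by auto
  then show ?thesis
    unfolding polynomial_of_degree_le_def
    by (intro exI[of _ "\<lambda>m. c m + d m"]) (simp add: sum.distrib distrib_right)
qed

lemma polynomial_of_degree_le_cmult:
  assumes "polynomial_of_degree_le k p"
  shows "polynomial_of_degree_le k (\<lambda>x. a * p x)"
proof -
  obtain c where "\<And>x. p x = (\<Sum>m\<in>mono_exps k. c m * (\<Prod>b\<in>Basis. (x \<bullet> b) ^ m b))"
    using assms unfolding polynomial_of_degree_le_def by auto
  then show ?thesis
    unfolding polynomial_of_degree_le_def
    by (intro exI[of _ "\<lambda>m. a * c m"]) (simp add: sum_distrib_left mult.assoc)
qed

lemma polynomial_of_degree_le_const: "polynomial_of_degree_le k (\<lambda>x::'a::euclidean_space. c)"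
  by (rule polynomial_of_degree_leI[of "{()}" "\<lambda>_. (\<lambda>b\<in>Basis. 0)" k _ "\<lambda>_. c"]) auto

lemma polynomial_of_degree_le_sum:
  "(\<And>i. i \<in> I \<Longrightarrow> polynomial_of_degree_le k (p i)) \<Longrightarrow> polynomial_of_degree_le k (\<lambda>x. \<Sum>i\<in>I. p i x)"
  by (induction I rule: infinite_finite_induct)
     (auto intro: polynomial_of_degree_le_const polynomial_of_degree_le_add)

lemma polynomial_of_degree_le_coord_mult:
  fixes b :: "'a::euclidean_space"
  assumes "polynomial_of_degree_le k p" and b: "b \<in> Basis"
  shows "polynomial_of_degree_le (Suc k) (\<lambda>x. (x \<bullet> b) * p x)"
proof -
  obtain c where c: "\<And>x. p x = (\<Sum>m\<in>mono_exps k. c m * (\<Prod>b\<in>Basis. (x \<bullet> b) ^ m b))"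
    using assms unfolding polynomial_of_degree_le_def by auto
  show ?thesis
  proof (rule polynomial_of_degree_leI[of "mono_exps k" "\<lambda>m. m(b := Suc (m b))"])
    fix m :: "'a \<Rightarrow> nat" assume m: "m \<in> mono_exps k"
    have "(\<Sum>a\<in>Basis. (m(b := Suc (m b))) a) = (\<Sum>a\<in>Basis. m a + (if a = b then 1 else 0))"
      by (intro sum.cong) auto
    also have "\<dots> = (\<Sum>a\<in>Basis. m a) + 1"
      using b by (simp add: sum.distrib sum.delta)
    finally show "m(b := Suc (m b)) \<in> mono_exps (Suc k)"
      using m b by (auto simp: PiE_iff extensional_def)
  next
    fix x :: 'a
    have "(\<Prod>a\<in>Basis. (x \<bullet> a) ^ (m(b := Suc (m b))) a) = (x \<bullet> b) * (\<Prod>a\<in>Basis. (x \<bullet> a) ^ m a)" for m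
    proof -
      have "(\<Prod>a\<in>Basis. (x \<bullet> a) ^ (m(b := Suc (m b))) a)
          = (\<Prod>a\<in>Basis. (if a = b then x \<bullet> a else 1) * (x \<bullet> a) ^ m a)"
        by (intro prod.cong) auto
      then show ?thesis using b by (simp add: prod.distrib)
    qed
    then show "x \<bullet> b * p x = (\<Sum>m\<in>mono_exps k. c m * (\<Prod>a\<in>Basis. (x \<bullet> a) ^ (m(b := Suc (m b))) a))"
      unfolding c by (simp add: sum_distrib_left mult.left_commute)
  qed (rule finite_mono_exps)
qed

lemma polynomial_of_degree_le_Suc:
  "polynomial_of_degree_le k p \<Longrightarrow> polynomial_of_degree_le (Suc k) p"
  unfolding polynomial_of_degree_le_def[of k]
  by (erule exE, rule polynomial_of_degree_leI[of "mono_exps k" "\<lambda>m. m"])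
     (auto intro: finite_mono_exps)

text \<open>The finite element spaces are defined by coefficient sums, whereas substitution,
  products and differences are short inductions for \<open>polydeg\<close>. From right to left, an
  affine factor is expanded into coordinates.\<close>

lemma polydeg_iff: "polynomial_of_degree_le k p \<longleftrightarrow> polydeg k p"
proof
  assume "polynomial_of_degree_le k p"
  then obtain c where c: "p = (\<lambda>x. \<Sum>m\<in>mono_exps k. c m * (\<Prod>b\<in>Basis. (x \<bullet> b) ^ m b))"
    unfolding polynomial_of_degree_le_def by auto
  show "polydeg k p"
    unfolding c
  proof (intro polydeg_sum polydeg_cmult)
    fix m :: "'a \<Rightarrow> nat" assume m: "m \<in> mono_exps k"
    have "polydeg (\<Sum>b\<in>Basis. 1 * m b) (\<lambda>x::'a. \<Prod>b\<in>Basis. (x \<bullet> b) ^ m b)"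
      using polydeg_affine[where 'a = 'a and c = 0] by (intro polydeg_prod polydeg_power) auto
    then show "polydeg k (\<lambda>x::'a. \<Prod>b\<in>Basis. (x \<bullet> b) ^ m b)"
      using m by (auto intro: polydeg_mono)
  qed
next
  show "polydeg k p \<Longrightarrow> polynomial_of_degree_le k p"
  proof (induction rule: polydeg.induct)
    case (polydeg_affine_mult k p w c)
    have *: "(\<lambda>x. (x \<bullet> w + c) * p x)
        = (\<lambda>x. (\<Sum>b\<in>Basis. (w \<bullet> b) * ((x \<bullet> b) * p x)) + c * p x)"
    proof
      fix x
      have "x \<bullet> w = (\<Sum>b\<in>Basis. (w \<bullet> b) * (x \<bullet> b))"
        by (subst euclidean_inner) (simp add: mult.commute)
      then show "(x \<bullet> w + c) * p x = (\<Sum>b\<in>Basis. (w \<bullet> b) * ((x \<bullet> b) * p x)) + c * p x"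
        by (simp add: distrib_right sum_distrib_right mult.assoc)
    qed
    show ?case
      unfolding *
      by (intro polynomial_of_degree_le_add polynomial_of_degree_le_sum polynomial_of_degree_le_cmult
          polynomial_of_degree_le_coord_mult polynomial_of_degree_le_Suc polydeg_affine_mult.IH)
  qed (auto intro: polynomial_of_degree_le_const polynomial_of_degree_le_add)
qed

section \<open>Finite differences and zeros on lattices\<close>

lemma polydeg_0: "polydeg k p \<Longrightarrow> k = 0 \<Longrightarrow> p x = p y"
  by (induction rule: polydeg.induct) auto

text \<open>Discrete Leibniz rule: the difference of an affine factor times \<open>p\<close> is that
  factor times the difference of \<open>p\<close>, plus the constant \<open>w \<bullet> u\<close>
  times a translate of \<open>p\<close>.\<close>

lemma polydeg_difference: "polydeg k p \<Longrightarrow> polydeg (k - 1) (\<lambda>x. p (x + w) - p x)"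
proof (induction rule: polydeg.induct)
  case (polydeg_add k p q)
  then show ?case
    using polydeg.polydeg_add[OF polydeg_add.IH] by (simp add: algebra_simps)
next
  case (polydeg_affine_mult k p u c)
  have *: "(\<lambda>x. ((x + w) \<bullet> u + c) * p (x + w) - (x \<bullet> u + c) * p x)
      = (\<lambda>x. (x \<bullet> u + c) * (p (x + w) - p x) + (w \<bullet> u) * p (x + w))"
    by (auto simp: algebra_simps)
  have "polydeg k (\<lambda>x. (x \<bullet> u + c) * (p (x + w) - p x))"
  \<comment> \<open>For \<open>k = 0\<close> truncated subtraction leaves the induction hypothesis
    at degree 0, and the affine factor would raise it to 1. Constancy of \<open>p\<close> makes this
    term vanish instead.\<close>
  proof (cases k)
    case 0
    then have "p (x + w) - p x = 0" for x
      using polydeg_0[OF polydeg_affine_mult.hyps, of "x + w" x] by simp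
    then show ?thesis by (simp add: polydeg_const)
  next
    case (Suc j)
    then show ?thesis using polydeg.polydeg_affine_mult[OF polydeg_affine_mult.IH] by simp
  qed
  moreover have "polydeg k (\<lambda>x. (w \<bullet> u) * p (x + w))"
    using polydeg_affine_comp[OF polydeg_affine_mult.hyps linear_id] by (auto intro: polydeg_cmult)
  ultimately show ?case
    unfolding * by (auto intro: polydeg.polydeg_add)
qed (auto intro: polydeg.intros)

lemma polydeg_line: "polydeg k p \<Longrightarrow> \<exists>q. \<forall>t. p (x + t *\<^sub>R w) = poly q t"
proof (induction rule: polydeg.induct)
  case (polydeg_const k c)
  then show ?case by (intro exI[of _ "[:c:]"]) auto
next
  case (polydeg_add k p q)
  then obtain p' q' where "\<forall>t. p (x + t *\<^sub>R w) = poly p' t" "\<forall>t. q (x + t *\<^sub>R w) = poly q' t" by blast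
  then show ?case by (intro exI[of _ "p' + q'"]) auto
next
  case (polydeg_affine_mult k p u c)
  then obtain p' where "\<forall>t. p (x + t *\<^sub>R w) = poly p' t" by blast
  then show ?case
    by (intro exI[of _ "[:x \<bullet> u + c, w \<bullet> u:] * p'"]) (auto simp: inner_add_left algebra_simps)
qed

text \<open>On a line \<open>p\<close> is a univariate polynomial, and one that takes the same value
  at infinitely many points is constant.\<close>

lemma polydeg_periodic_line:
  assumes "polydeg k p" and "\<And>n::nat. p (x + real n *\<^sub>R w) = p x"
  shows "p (x + t *\<^sub>R w) = p x"
proof -
  obtain q where q: "\<And>t. p (x + t *\<^sub>R w) = poly q t"
    using polydeg_line[OF assms(1)] by blast
  have "range real \<subseteq> {t. poly (q - [:p x:]) t = 0}"
    using assms(2) q by auto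
  moreover have "infinite (range real)"
    by (simp add: finite_image_iff inj_on_def)
  ultimately have "q - [:p x:] = 0"
    using poly_roots_finite finite_subset by blast
  then show ?thesis using q by simp
qed

text \<open>
  Differencing in a lattice direction lowers both the degree and the size of the lattice on which
  the polynomial vanishes.
\<close>

lemma polydeg_zero_if_zero_on_lattice:
  fixes w :: "'i \<Rightarrow> 'a::euclidean_space"
  assumes "polydeg k p" "finite I"
    and "\<And>m. (\<Sum>i\<in>I. m i) \<le> k \<Longrightarrow> p (v + (\<Sum>i\<in>I. real (m i) *\<^sub>R w i)) = 0"
    and "x \<in> span (w ` I)"
  shows "p (v + x) = 0"
  using assms
proof (induction k arbitrary: p x)
  case 0
  then have "p v = 0" using "0.prems"(3)[of "\<lambda>_. 0"] by simp
  then show ?case using polydeg_0[OF "0.prems"(1) refl, of "v + x" v] by simp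
next
  case (Suc k)
  have shift: "p (v + y + w i) = p (v + y)" if i: "i \<in> I" and y: "y \<in> span (w ` I)" for i y
  proof -
    have "polydeg k (\<lambda>x. p (x + w i) - p x)"
      using polydeg_difference[OF Suc.prems(1)] by simp
    then have "p (v + y + w i) - p (v + y) = 0"
    proof (rule Suc.IH[OF _ \<open>finite I\<close> _ y])
      fix m :: "'i \<Rightarrow> nat" assume m: "(\<Sum>i\<in>I. m i) \<le> k"
      let ?m = "\<lambda>j. m j + (if j = i then 1 else 0)"
      have "(\<Sum>i\<in>I. ?m i) \<le> Suc k"
        using m i \<open>finite I\<close> by (simp add: sum.distrib)
      then have "p (v + (\<Sum>j\<in>I. real (?m j) *\<^sub>R w j)) = 0"
        by (rule Suc.prems(3))
      moreover have "(\<Sum>j\<in>I. real (?m j) *\<^sub>R w j) = (\<Sum>j\<in>I. real (m j) *\<^sub>R w j) + w i"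
      proof -
        have "(\<Sum>j\<in>I. real (?m j) *\<^sub>R w j) = (\<Sum>j\<in>I. real (m j) *\<^sub>R w j + (if j = i then w j else 0))"
          by (intro sum.cong) (auto simp: algebra_simps)
        then show ?thesis using i \<open>finite I\<close> by (simp add: sum.distrib)
      qed
      ultimately show "p (v + (\<Sum>j\<in>I. real (m j) *\<^sub>R w j) + w i) - p (v + (\<Sum>j\<in>I. real (m j) *\<^sub>R w j)) = 0"
        using Suc.prems(3)[of m] m by (simp add: add.assoc)
    qed
    then show ?thesis by simp
  qed
  \<comment> \<open>Periodicity under each \<open>w i\<close> becomes invariance under all its real
    multiples, which lets span induction carry the zero at \<open>v\<close> to the whole
    span.\<close>
  have line: "p (v + y + t *\<^sub>R w i) = p (v + y)" if i: "i \<in> I" and y: "y \<in> span (w ` I)" for i y t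
  proof (rule polydeg_periodic_line[OF Suc.prems(1)])
    fix n show "p (v + y + real n *\<^sub>R w i) = p (v + y)"
    proof (induction n)
      case (Suc n)
      have "y + real n *\<^sub>R w i \<in> span (w ` I)"
        using i y by (intro span_add span_scale) (auto intro: span_base)
      from shift[OF i this] Suc show ?case by (simp add: algebra_simps)
    qed simp
  qed
  have "p v = 0" using Suc.prems(3)[of "\<lambda>_. 0"] by simp
  from \<open>x \<in> span (w ` I)\<close> have "x \<in> span (w ` I) \<and> p (v + x) = 0"
  proof (induction rule: span_induct_alt)
    case base
    then show ?case using \<open>p v = 0\<close> by (simp add: span_zero)
  next
    case (step c u y)
    then obtain i where i: "i \<in> I" "u = w i" by auto
    have "p (v + y + c *\<^sub>R w i) = 0"
      using line[OF i(1), of y c] step by simp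
    then show ?case
      using step i by (auto simp: algebra_simps intro: span_add span_scale span_base)
  qed
  then show ?case ..
qed

section \<open>Lagrange points and unisolvence\<close>

definition lattice_points :: "nat \<Rightarrow> 'a::real_vector set \<Rightarrow> 'a set" where
  "lattice_points k C = {\<Sum>v\<in>C. (real (m v) / real k) *\<^sub>R v | m. (\<Sum>v\<in>C. m v) = k}"

lemma lattice_pointsI:
  "(\<Sum>v\<in>C. m v) = k \<Longrightarrow> (\<Sum>v\<in>C. (real (m v) / real k) *\<^sub>R v) \<in> lattice_points k C"
  unfolding lattice_points_def by blast

text \<open>Faces of elements need such points too, hence the vertex set, and not the simplex, is
  the parameter of \<open>lattice_points\<close>.\<close>

lemma lagrange_points_eq: "lagrange_points k T = lattice_points k (vertices T)"
  unfolding lagrange_points_def lattice_points_def ..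

lemma finite_lattice_points: "finite C \<Longrightarrow> finite (lattice_points k C)"
proof -
  assume C: "finite C"
  have "lattice_points k C \<subseteq> (\<lambda>m. \<Sum>v\<in>C. (real (m v) / real k) *\<^sub>R v) ` (C \<rightarrow>\<^sub>E {..k})"
  proof
    fix x assume "x \<in> lattice_points k C"
    then obtain m where m: "x = (\<Sum>v\<in>C. (real (m v) / real k) *\<^sub>R v)" "(\<Sum>v\<in>C. m v) = k"
      unfolding lattice_points_def by auto
    have "m v \<le> k" if "v \<in> C" for v
      using member_le_sum[of v C m] that C m by auto
    then have "restrict m C \<in> C \<rightarrow>\<^sub>E {..k}" by auto
    moreover have "x = (\<Sum>v\<in>C. (real (restrict m C v) / real k) *\<^sub>R v)" using m by simp
    ultimately show "x \<in> (\<lambda>m. \<Sum>v\<in>C. (real (m v) / real k) *\<^sub>R v) ` (C \<rightarrow>\<^sub>E {..k})" by blast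
  qed
  then show ?thesis by (rule finite_subset) (use C in \<open>auto intro: finite_PiE\<close>)
qed

text \<open>Nodes of a face are nodes of the simplex: the other vertices get multiplicity 0.\<close>

lemma lattice_points_mono:
  assumes "finite C" "D \<subseteq> C" shows "lattice_points k D \<subseteq> lattice_points k C"
proof
  fix x assume "x \<in> lattice_points k D"
  then obtain m where m: "x = (\<Sum>v\<in>D. (real (m v) / real k) *\<^sub>R v)" "(\<Sum>v\<in>D. m v) = k"
    unfolding lattice_points_def by auto
  let ?m = "\<lambda>v. if v \<in> D then m v else 0"
  have "(\<Sum>v\<in>C. ?m v) = k" "x = (\<Sum>v\<in>C. (real (?m v) / real k) *\<^sub>R v)"
    unfolding m using assms
    by (auto intro!: sum.mono_neutral_cong_left m(2)[symmetric] simp: m(2)[symmetric] finite_subset sum.mono_neutral_cong_right)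
  then show "x \<in> lattice_points k C"
    using lattice_pointsI[of ?m C k] by simp
qed

lemma lattice_points_subset_hull:
  assumes "finite C" "k \<ge> 1" shows "lattice_points k C \<subseteq> convex hull C"
proof -
  have *: "(\<Sum>v\<in>C. real (m v) / real k) = 1" if "(\<Sum>v\<in>C. m v) = k" for m
  proof -
    have "(\<Sum>v\<in>C. real (m v) / real k) = real (\<Sum>v\<in>C. m v) / real k"
      by (simp add: sum_divide_distrib)
    then show ?thesis using that assms by simp
  qed
  show ?thesis
  proof
    fix x assume "x \<in> lattice_points k C"
    then obtain m where m: "x = (\<Sum>v\<in>C. (real (m v) / real k) *\<^sub>R v)" "(\<Sum>v\<in>C. m v) = k"
      unfolding lattice_points_def by auto
    show "x \<in> convex hull C"
      unfolding convex_hull_finite[OF assms(1)]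
      by (intro CollectI exI[of _ "\<lambda>v. real (m v) / real k"]) (simp add: m(1) *[OF m(2)])
  qed
qed

text \<open>With base point \<open>v\<close> and steps \<open>(u - v) / k\<close> the Lagrange
  points become an integer lattice. As \<open>x\<close> ranges over the affine hull of
  \<open>C\<close>, the lemma also covers faces: traces on a face are fixed by the nodes of that
  face.\<close>

lemma unisolvence:
  assumes p: "polydeg k p" and k: "k \<ge> 1" and C: "finite C"
    and z: "\<And>a. a \<in> lattice_points k C \<Longrightarrow> p a = 0" and x: "x \<in> affine hull C"
  shows "p x = 0"
proof -
  obtain v where v: "v \<in> C" using x by fastforce
  define I where "I = C - {v}"
  define w where "w = (\<lambda>u. (1 / real k) *\<^sub>R (u - v))"
  have fI: "finite I" and CI: "C = insert v I" "v \<notin> I"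
    using C v by (auto simp: I_def)
  have "x - v \<in> span ((\<lambda>u. u - v) ` I)"
    using x affine_hull_span2[OF v] by (auto simp: I_def)
  also have "span ((\<lambda>u. u - v) ` I) \<subseteq> span (w ` I)"
  proof (rule span_minimal)
    show "(\<lambda>u. u - v) ` I \<subseteq> span (w ` I)"
    proof clarify
      fix u assume "u \<in> I"
      then have "real k *\<^sub>R w u \<in> span (w ` I)" by (intro span_scale span_base) auto
      then show "u - v \<in> span (w ` I)" using k by (simp add: w_def)
    qed
  qed (rule subspace_span)
  finally have xs: "x - v \<in> span (w ` I)" .
  have "p (v + (x - v)) = 0"
  proof (rule polydeg_zero_if_zero_on_lattice[OF p fI _ xs])
    fix m :: "'a \<Rightarrow> nat" assume m: "(\<Sum>i\<in>I. m i) \<le> k"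
    \<comment> \<open>The vertex \<open>v\<close> absorbs the multiplicity left over by the others,
      so that the total is exactly \<open>k\<close>.\<close>
    let ?m = "\<lambda>u. if u = v then k - (\<Sum>i\<in>I. m i) else m u"
    have "?m u = m u" if "u \<in> I" for u using that CI by auto
    then have s: "(\<Sum>u\<in>I. ?m u) = (\<Sum>u\<in>I. m u)"
      "(\<Sum>u\<in>I. (real (?m u) / real k) *\<^sub>R u) = (\<Sum>u\<in>I. (real (m u) / real k) *\<^sub>R u)"
      by simp_all
    have "(\<Sum>u\<in>C. ?m u) = k"
      using CI fI m s by simp
    then have "(\<Sum>u\<in>C. (real (?m u) / real k) *\<^sub>R u) \<in> lattice_points k C"
      by (rule lattice_pointsI)
    moreover have "(\<Sum>u\<in>C. (real (?m u) / real k) *\<^sub>R u) = v + (\<Sum>i\<in>I. real (m i) *\<^sub>R w i)"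
    proof -
      have "(\<Sum>u\<in>C. (real (?m u) / real k) *\<^sub>R u) = (real (k - (\<Sum>i\<in>I. m i)) / real k) *\<^sub>R v + (\<Sum>u\<in>I. (real (m u) / real k) *\<^sub>R u)"
        using CI fI s(2) by simp
      also have "(real (k - (\<Sum>i\<in>I. m i)) / real k) = 1 - (\<Sum>i\<in>I. real (m i) / real k)"
        using m k by (simp add: of_nat_diff diff_divide_distrib sum_divide_distrib)
      finally show ?thesis
        by (simp add: w_def algebra_simps sum_subtractf scaleR_sum_left)
    qed
    ultimately show "p (v + (\<Sum>i\<in>I. real (m i) *\<^sub>R w i)) = 0" using z by metis
  qed
  then show ?thesis by simp
qed

section \<open>Affine maps prescribed on vertices and nodal polynomials\<close>

lemma affine_extension:
  fixes f :: "'a::euclidean_space \<Rightarrow> 'b::euclidean_space"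
  assumes "\<not> affine_dependent C"
  obtains A c where "linear A" "\<And>v. v \<in> C \<Longrightarrow> A v + c = f v"
proof (cases "C = {}")
  case True
  then show thesis using that linear_id by (metis empty_iff linear_zero)
next
  case False
  then obtain v where v: "v \<in> C" by auto
  let ?I = "(\<lambda>u. u - v) ` (C - {v})"
  have "independent ?I"
    using assms affine_dependent_iff_dependent2[OF v] by simp
  then obtain A where A: "linear A" "\<forall>u\<in>?I. A u = f (u + v) - f v"
    using linear_independent_extend[of ?I "\<lambda>u. f (u + v) - f v"] by blast
  show thesis
  proof (rule that[OF A(1), of "f v - A v"])
    fix u assume "u \<in> C"
    then have "A (u - v) = f u - f v"
      using A by (cases "u = v") (auto simp: linear_0)
    then show "A u + (f v - A v) = f u" using A(1) by (simp add: linear_diff algebra_simps)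
  qed
qed

lemma affine_map_combination:
  assumes "linear A" "finite C" "(\<Sum>v\<in>C. l v) = 1"
  shows "A (\<Sum>v\<in>C. l v *\<^sub>R v) + c = (\<Sum>v\<in>C. l v *\<^sub>R (A v + c))"
proof -
  have "A (\<Sum>v\<in>C. l v *\<^sub>R v) = (\<Sum>v\<in>C. l v *\<^sub>R A v)"
    using assms by (simp add: linear_sum linear_scale)
  then show ?thesis
    using assms by (simp add: scaleR_add_right sum.distrib scaleR_sum_left[symmetric])
qed

text \<open>Product formula in the barycentric coordinates \<open>l v\<close>: the factor with index
  \<open>i < m v\<close> vanishes where \<open>k * l v = i\<close>, and the number of factors is the
  sum of the multiplicities, which is \<open>k\<close>.\<close>

lemma nodal_polynomial_exists:
  assumes C: "\<not> affine_dependent C" and k: "k \<ge> 1" and a: "a \<in> lattice_points k C"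
  obtains p where "polydeg k p" "p a = 1" "\<And>b. b \<in> lattice_points k C \<Longrightarrow> b \<noteq> a \<Longrightarrow> p b = 0"
proof -
  have fC: "finite C" using C aff_independent_finite by blast
  obtain m where m: "a = (\<Sum>v\<in>C. (real (m v) / real k) *\<^sub>R v)" "(\<Sum>v\<in>C. m v) = k"
    using a unfolding lattice_points_def by auto
  have "\<exists>A c. linear A \<and> (\<forall>u\<in>C. A u + c = (if u = v then 1 else 0 :: real))" for v
    by (rule affine_extension[OF C, of "\<lambda>u. if u = v then 1 else 0 :: real"]) blast
  then obtain A c where A: "\<And>v. linear (A v)" "\<And>u v. u \<in> C \<Longrightarrow> A v u + c v = (if u = v then 1 else 0 :: real)"
    by metis
  define l where "l v x = A v x + c v" for v x
  have l: "l v (\<Sum>u\<in>C. (real (m' u) / real k) *\<^sub>R u) = real (m' v) / real k"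
    if m': "(\<Sum>u\<in>C. m' u) = k" and v: "v \<in> C" for v m'
  proof -
    have "(\<Sum>u\<in>C. real (m' u) / real k) = 1"
      using m' k by (simp add: sum_divide_distrib[symmetric] of_nat_sum[symmetric] del: of_nat_sum)
    then have "l v (\<Sum>u\<in>C. (real (m' u) / real k) *\<^sub>R u) = (\<Sum>u\<in>C. (real (m' u) / real k) *\<^sub>R (if u = v then 1 else 0))"
      unfolding l_def using affine_map_combination[OF A(1) fC] A(2) by simp
    also have "\<dots> = (\<Sum>u\<in>C. if u = v then real (m' u) / real k else 0)"
      by (intro sum.cong) auto
    finally show ?thesis using v fC by simp
  qed
  define p where "p x = (\<Prod>v\<in>C. \<Prod>i<m v. (real k * l v x - real i) / (real (m v) - real i))" for x
  show thesis
  proof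
    have lin: "polydeg 1 (\<lambda>x. (real k * l v x - real i) / (real (m v) - real i))" for v i
    proof -
      have "polydeg 1 (\<lambda>x. A v x + c v)"
        using polydeg_affine_comp[OF polydeg_affine[of 1 "c v"] A(1)[of v], of 0] by simp
      then have "polydeg 1 (\<lambda>x. (1 / (real (m v) - real i)) * (real k * l v x - real i))"
        unfolding l_def by (intro polydeg_cmult polydeg_diff polydeg_const) auto
      then show ?thesis by simp
    qed
    have "polydeg (\<Sum>v\<in>C. \<Sum>i<m v. 1) p"
      unfolding p_def by (intro polydeg_prod fC finite_lessThan lin)
    then show "polydeg k p" using m(2) by simp
    show "p a = 1"
      unfolding p_def m(1) using l[OF m(2)] k by (auto intro!: prod.neutral)
    fix b assume b: "b \<in> lattice_points k C" "b \<noteq> a"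
    then obtain m' where m': "b = (\<Sum>v\<in>C. (real (m' v) / real k) *\<^sub>R v)" "(\<Sum>v\<in>C. m' v) = k"
      unfolding lattice_points_def by auto
    \<comment> \<open>Two different multiplicity vectors with the same sum \<open>k\<close>: some
      entry of the second is smaller. That entry is one of the \<open>i < m v\<close> and makes a
      factor vanish.\<close>
    have "\<exists>v\<in>C. m' v < m v"
    proof (rule ccontr)
      assume "\<not> ?thesis"
      then have "\<forall>v\<in>C. m v \<le> m' v" by (meson not_le)
      then have "\<forall>v\<in>C. m v = m' v"
        using m(2) m'(2) fC by (auto intro: sum_mono_inv[of m C m'])
      then have "a = b" unfolding m(1) m'(1) by (intro sum.cong) auto
      then show False using b by simp
    qed
    then obtain v where v: "v \<in> C" "m' v < m v" by auto
    have "(\<Prod>i<m v. (real k * l v b - real i) / (real (m v) - real i)) = 0"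
      using v l[OF m'(2) v(1)] k unfolding m'(1)
      by (subst prod_zero_iff) (auto intro!: bexI[of _ "m' v"])
    then show "p b = 0" unfolding p_def using v fC by (auto intro!: prod_zero)
  qed
qed

section \<open>Weak gradients\<close>

lemma continuously_differentiable_const: "continuously_differentiable r (\<lambda>x. c)"
  by (induction r arbitrary: c) (auto simp: frechet_derivative_const)

lemma continuously_differentiable_SucD:
  "continuously_differentiable (Suc r) f \<Longrightarrow> continuously_differentiable r f"
proof (induction r arbitrary: f)
  case 0
  then show ?case
    by (auto intro!: continuous_at_imp_continuous_on differentiable_imp_continuous_within)
next
  case (Suc r)
  then show ?case
    unfolding continuously_differentiable.simps(2)[of "Suc r"] continuously_differentiable.simps(2)[of r]
    by blast
qed

lemma frechet_derivative_eq: "(f has_derivative f') (at x) \<Longrightarrow> frechet_derivative f (at x) = f'"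
  using frechet_derivative_at by metis

lemma continuously_differentiable_add:
  "continuously_differentiable r f \<Longrightarrow> continuously_differentiable r g \<Longrightarrow>
    continuously_differentiable r (\<lambda>x. f x + g x)"
proof (induction r arbitrary: f g)
  case (Suc r)
  have "frechet_derivative (\<lambda>x. f x + g x) (at x)
      = (\<lambda>b. frechet_derivative f (at x) b + frechet_derivative g (at x) b)" for x
    using Suc.prems
    by (intro frechet_derivative_eq has_derivative_add) (auto simp: frechet_derivative_works)
  then show ?case using Suc by (auto intro: differentiable_add)
qed (auto intro: continuous_intros)

lemma continuously_differentiable_mult:
  "continuously_differentiable r f \<Longrightarrow> continuously_differentiable r g \<Longrightarrow>
    continuously_differentiable r (\<lambda>x. f x * g x)"
proof (induction r arbitrary: f g)
  case (Suc r)
  have "frechet_derivative (\<lambda>x. f x * g x) (at x)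
      = (\<lambda>b. f x * frechet_derivative g (at x) b + frechet_derivative f (at x) b * g x)" for x
    using Suc.prems
    by (intro frechet_derivative_eq has_derivative_mult) (auto simp: frechet_derivative_works)
  then show ?case
    using Suc continuously_differentiable_SucD[OF Suc.prems(1)] continuously_differentiable_SucD[OF Suc.prems(2)]
    by (auto intro!: differentiable_mult continuously_differentiable_add)
qed (auto intro: continuous_intros)

lemma continuously_differentiable_prod:
  "(\<And>i. i \<in> I \<Longrightarrow> continuously_differentiable r (f i)) \<Longrightarrow>
    continuously_differentiable r (\<lambda>x. \<Prod>i\<in>I. f i x)"
  by (induction I rule: infinite_finite_induct)
     (auto intro: continuously_differentiable_const continuously_differentiable_mult)

text \<open>\<open>D\<close> is a whole tower of derivatives, so that the induction can pass from
  \<open>D j\<close> to \<open>D (Suc j)\<close>: differentiating a ridge function yields a constant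
  times the next one.\<close>

lemma continuously_differentiable_ridge:
  fixes w :: "'a::euclidean_space"
  assumes D: "\<And>j t. (D j has_real_derivative D (Suc j) t) (at t)"
  shows "continuously_differentiable r (\<lambda>x. D j (x \<bullet> w + c))"
proof (induction r arbitrary: j)
  case 0
  have "continuous_on UNIV (D j)"
    using D by (meson DERIV_isCont continuous_at_imp_continuous_on)
  then show ?case
    by (auto intro!: continuous_on_compose2[of UNIV "D j"] continuous_intros)
next
  case (Suc r)
  have *: "((\<lambda>x. D j (x \<bullet> w + c)) has_derivative (\<lambda>y. (y \<bullet> w) * D (Suc j) (x \<bullet> w + c))) (at x)" for x
    by (rule DERIV_compose_FDERIV[OF D]) (auto intro!: derivative_eq_intros)
  show ?case
    using Suc by (auto simp: frechet_derivative_eq[OF *] differentiable_def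
        intro: * continuously_differentiable_mult continuously_differentiable_const)
qed

section \<open>Smooth bumps on boxes\<close>

fun bump_poly :: "nat \<Rightarrow> real poly" where
  "bump_poly 0 = 1"
| "bump_poly (Suc j) = [:0, 0, 1:] * (bump_poly j - pderiv (bump_poly j))"

text \<open>The \<open>j\<close>-th derivative of \<open>exp (- 1 / t)\<close>, extended by 0. With
  \<open>s = 1 / t\<close> the chain rule turns the polynomial prefactor \<open>q(s)\<close> into
  \<open>s^2 * (q(s) - q'(s))\<close>, the recursion of \<open>bump_poly\<close>.\<close>

definition bump :: "nat \<Rightarrow> real \<Rightarrow> real" where
  "bump j t = (if t > 0 then poly (bump_poly j) (1 / t) * exp (- (1 / t)) else 0)"

lemma tendsto_poly_div_exp: "((\<lambda>s. poly q s / exp s) \<longlongrightarrow> (0::real)) at_top"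
proof -
  have "((\<lambda>s. \<Sum>i\<le>degree q. coeff q i * (s ^ i / exp s)) \<longlongrightarrow> (\<Sum>i\<le>degree q. coeff q i * 0)) at_top"
    by (intro tendsto_intros tendsto_power_div_exp_0)
  then show ?thesis by (simp add: poly_altdef sum_divide_distrib)
qed

lemma bump_deriv: "(bump j has_real_derivative bump (Suc j) t) (at t)"
proof -
  consider "t > 0" | "t < 0" | "t = 0" by linarith
  then show ?thesis
  proof cases
    case 1
    have "((\<lambda>t. poly (bump_poly j) (1 / t) * exp (- (1 / t))) has_real_derivative bump (Suc j) t) (at t)"
      using 1 by (auto intro!: derivative_eq_intros DERIV_chain'[OF _ poly_DERIV]
          simp: bump_def field_simps power2_eq_square)
    then show ?thesis
      by (rule DERIV_cong_ev[THEN iffD1, rotated -1])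
        (use 1 in \<open>auto simp: bump_def eventually_at_topological intro!: eventually_nhds_in_open[of "{0<..}", THEN eventually_mono]\<close>)
  next
    case 2
    have "((\<lambda>t. 0) has_real_derivative 0) (at t)" by simp
    then show ?thesis
      by (rule DERIV_cong_ev[THEN iffD1, rotated -1])
        (use 2 in \<open>auto simp: bump_def intro!: eventually_nhds_in_open[of "{..<0}", THEN eventually_mono]\<close>)
  next
    case 3
    \<comment> \<open>Under \<open>s = 1 / y\<close> the difference quotient at 0 becomes a
      polynomial in \<open>s\<close> divided by \<open>exp s\<close>.\<close>
    have r: "((\<lambda>y. bump j y / y) \<longlongrightarrow> 0) (at_right 0)"
      unfolding filterlim_at_right_to_top
    proof (rule Lim_transform_eventually[OF tendsto_poly_div_exp[of "[:0, 1:] * bump_poly j"]])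
      show "\<forall>\<^sub>F s in at_top. poly ([:0, 1:] * bump_poly j) s / exp s = bump j (inverse s) / inverse s"
        using eventually_gt_at_top[of "0::real"]
        by eventually_elim (auto simp: bump_def exp_minus field_simps)
    qed
    have l: "((\<lambda>y. bump j y / y) \<longlongrightarrow> 0) (at_left 0)"
      by (rule Lim_transform_eventually[OF tendsto_const])
        (auto simp: bump_def eventually_at intro!: exI[of _ 1])
    have "((\<lambda>y. bump j y / y) \<longlongrightarrow> 0) (at 0)"
      using filterlim_split_at[OF l r] .
    then show ?thesis unfolding 3 has_field_derivative_iff by (simp add: bump_def)
  qed
qed

lemma bump_0: "bump 0 t = (if t > 0 then exp (- (1 / t)) else 0)"
  by (simp add: bump_def)

text \<open>Stretching the argument by \<open>Suc n\<close> leaves the support unchanged and drives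
  every positive factor to 1, so these functions tend to the indicator of the open box.\<close>

definition box_bump :: "nat \<Rightarrow> 'a::euclidean_space \<Rightarrow> 'a \<Rightarrow> 'a \<Rightarrow> real" where
  "box_bump n l u x =
     (\<Prod>b\<in>Basis. bump 0 (real (Suc n) * (x \<bullet> b - l \<bullet> b)) * bump 0 (real (Suc n) * (u \<bullet> b - x \<bullet> b)))"

lemma box_bump_nonzero: "box_bump n l u x \<noteq> 0 \<longleftrightarrow> x \<in> box l u"
  by (auto simp: box_bump_def bump_0 mem_box zero_less_mult_iff)

lemma test_function_box_bump:
  fixes l u :: "'a::euclidean_space"
  assumes "cbox l u \<subseteq> \<Omega>"
  shows "test_function \<Omega> (box_bump n l u)"
  unfolding test_function_def
proof (intro conjI allI)
  fix r
  have 1: "real (Suc n) * (x \<bullet> b - l \<bullet> b) = x \<bullet> (real (Suc n) *\<^sub>R b) + - real (Suc n) * (l \<bullet> b)"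
    and 2: "real (Suc n) * (u \<bullet> b - x \<bullet> b) = x \<bullet> (- real (Suc n) *\<^sub>R b) + real (Suc n) * (u \<bullet> b)"
    for x b :: 'a by (simp_all add: algebra_simps)
  show "continuously_differentiable r (box_bump n l u)"
    unfolding box_bump_def 1 2
    by (intro continuously_differentiable_prod continuously_differentiable_mult
        continuously_differentiable_ridge bump_deriv)
next
  have *: "closure {x. box_bump n l u x \<noteq> 0} \<subseteq> cbox l u"
    unfolding box_bump_nonzero Collect_mem_eq by (intro closure_minimal box_subset_cbox closed_cbox)
  then show "compact (closure {x. box_bump n l u x \<noteq> 0})"
    by (meson bounded_cbox bounded_subset closed_closure compact_eq_bounded_closed)
  show "closure {x. box_bump n l u x \<noteq> 0} \<subseteq> \<Omega>" using * assms by blast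
qed

lemma box_bump_bounds: "0 \<le> box_bump n l u x" "box_bump n l u x \<le> 1"
  unfolding box_bump_def by (auto simp: bump_0 intro!: prod_nonneg prod_le_1 mult_le_one)

lemma box_bump_tendsto: "(\<lambda>n. box_bump n l u x) \<longlonglongrightarrow> indicator (box l u) x"
proof (cases "x \<in> box l u")
  case True
  have lim: "(\<lambda>n. bump 0 (real (Suc n) * t)) \<longlonglongrightarrow> 1" if "t > 0" for t
  proof -
    have "(\<lambda>n. exp (- (1 / t * inverse (real (Suc n))))) \<longlonglongrightarrow> exp (- (1 / t * 0))"
      by (intro tendsto_intros LIMSEQ_inverse_real_of_nat)
    moreover have "bump 0 (real (Suc n) * t) = exp (- (1 / t * inverse (real (Suc n))))" for n
      using that by (simp add: bump_0 divide_simps mult.commute)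
    ultimately show ?thesis by simp
  qed
  have "(\<lambda>n. box_bump n l u x) \<longlonglongrightarrow> (\<Prod>b\<in>(Basis :: 'a set). 1 * 1)"
    unfolding box_bump_def using True by (intro tendsto_prod tendsto_mult lim) (auto simp: mem_box)
  then show ?thesis using True by simp
next
  case False
  then have "box_bump n l u x = 0" for n using box_bump_nonzero by blast
  then show ?thesis using False by simp
qed

lemma continuous_box_bump: "continuous_on UNIV (box_bump n l u)"
  using test_function_box_bump[of l u UNIV n] unfolding test_function_def
  by (metis continuously_differentiable.simps(1) subset_UNIV)

section \<open>The fundamental lemma of the calculus of variations\<close>

lemma borel_measurable_lebesgue_onI:
  fixes f :: "'a::euclidean_space \<Rightarrow> real"
  assumes "f \<in> borel_measurable borel"
  shows "f \<in> borel_measurable (lebesgue_on \<Omega>)"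
proof -
  have "f \<in> borel_measurable lborel" using assms by simp
  then show ?thesis by (intro measurable_restrict_space1 measurable_completion)
qed

text \<open>Dominated convergence along the box bumps; they lie between 0 and 1, so
  \<open>\<bar>f\<bar>\<close> dominates. The closed box must lie in \<Omega> because it contains
  the supports.\<close>

lemma integral_box_zero:
  fixes f :: "'a::euclidean_space \<Rightarrow> real"
  assumes f: "integrable (lebesgue_on \<Omega>) f"
    and z: "\<And>\<phi>. test_function \<Omega> \<phi> \<Longrightarrow> (\<integral>x. f x * \<phi> x \<partial>lebesgue_on \<Omega>) = 0"
    and b: "cbox l u \<subseteq> \<Omega>"
  shows "(\<integral>x. f x * indicator (box l u) x \<partial>lebesgue_on \<Omega>) = 0"
proof -
  have "(\<lambda>n. \<integral>x. f x * box_bump n l u x \<partial>lebesgue_on \<Omega>) \<longlonglongrightarrow> (\<integral>x. f x * indicator (box l u) x \<partial>lebesgue_on \<Omega>)"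
  proof (rule integral_dominated_convergence[where w = "\<lambda>x. \<bar>f x\<bar>"])
    have fm: "f \<in> borel_measurable (lebesgue_on \<Omega>)" using f by auto
    show "(\<lambda>x. f x * indicator (box l u) x) \<in> borel_measurable (lebesgue_on \<Omega>)"
      by (intro borel_measurable_times[OF fm] borel_measurable_lebesgue_onI) auto
    show "(\<lambda>x. f x * box_bump n l u x) \<in> borel_measurable (lebesgue_on \<Omega>)" for n
      by (intro borel_measurable_times[OF fm] borel_measurable_lebesgue_onI
          borel_measurable_continuous_onI continuous_box_bump)
    show "AE x in lebesgue_on \<Omega>. (\<lambda>n. f x * box_bump n l u x) \<longlonglongrightarrow> f x * indicator (box l u) x"
      by (auto intro!: tendsto_intros box_bump_tendsto)
    show "AE x in lebesgue_on \<Omega>. norm (f x * box_bump n l u x) \<le> \<bar>f x\<bar>" for n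
      using box_bump_bounds[of n l u] by (auto simp: abs_mult intro!: mult_left_le)
  qed (use f in auto)
  moreover have "(\<integral>x. f x * box_bump n l u x \<partial>lebesgue_on \<Omega>) = 0" for n
    by (intro z test_function_box_bump b)
  ultimately show ?thesis by (simp add: LIMSEQ_const_iff)
qed

text \<open>Positive and negative part of the integrand are densities of two measures that agree on
  boxes, an intersection-stable generator of the Borel sets. So the measures and the densities
  agree, and a number whose positive and negative parts are equal is 0.\<close>

lemma box_integrals_zero_imp_AE_zero:
  fixes F :: "'a::euclidean_space \<Rightarrow> real"
  assumes F: "integrable lebesgue F"
    and z: "\<And>a b. box a b \<subseteq> box l u \<Longrightarrow> (\<integral>x. F x * indicator (box a b) x \<partial>lebesgue) = 0"
  shows "AE x in lebesgue. x \<in> box l u \<longrightarrow> F x = 0"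
proof -
  obtain g where g[measurable]: "g \<in> borel_measurable lborel" and Fg: "AE x in lborel. F x = g x"
    using completion_ex_borel_measurable_real[of F lborel] F by auto
  have Fg': "AE x in lebesgue. F x = g x" using Fg by (rule AE_completion)
  have gl: "integrable lebesgue g"
    by (rule integrable_cong_AE_imp[OF F measurable_completion[OF g] Fg'])
  then have gi: "integrable lborel g" using integrable_completion[OF g] by blast
  \<comment> \<open>\<open>p 1\<close> and \<open>p (-1)\<close> are the positive and the negative
    part of the Borel representative \<open>g\<close>, cut off to the box.\<close>
  define p where "p s x = ennreal (indicator (box l u) x * max 0 (s * g x))" for s x
  have pm[measurable]: "p s \<in> borel_measurable lborel" for s unfolding p_def by measurable
  have int: "integrable lborel (\<lambda>x. indicator (box a b \<inter> box l u) x * max 0 (s * g x))" for a b s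
    by (rule Bochner_Integration.integrable_bound[OF integrable_mult_right[OF gi, of s]])
       (auto split: split_indicator)
  have em: "emeasure (density lborel (p s)) (box a b)
      = ennreal (\<integral>x. indicator (box a b \<inter> box l u) x * max 0 (s * g x) \<partial>lborel)" for a b s
  proof -
    have "emeasure (density lborel (p s)) (box a b)
        = (\<integral>\<^sup>+x. ennreal (indicator (box a b \<inter> box l u) x * max 0 (s * g x)) \<partial>lborel)"
      by (auto simp: emeasure_density p_def intro!: nn_integral_cong split: split_indicator)
    then show ?thesis
      by (simp add: nn_integral_eq_integral[OF int])
  qed
  have eq: "(\<integral>x. indicator (box a b \<inter> box l u) x * max 0 (1 * g x) \<partial>lborel)
      = (\<integral>x. indicator (box a b \<inter> box l u) x * max 0 (-1 * g x) \<partial>lborel)" for a b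
  proof -
    obtain c d where cd: "box a b \<inter> box l u = box c d"
      using box_Int_box by blast
    have "(\<integral>x. indicator (box a b \<inter> box l u) x * max 0 (1 * g x) \<partial>lborel)
      - (\<integral>x. indicator (box a b \<inter> box l u) x * max 0 (-1 * g x) \<partial>lborel)
      = (\<integral>x. g x * indicator (box c d) x \<partial>lborel)"
      by (subst Bochner_Integration.integral_diff[OF int int, symmetric], unfold cd,
          intro Bochner_Integration.integral_cong) (auto split: split_indicator)
    also have "\<dots> = (\<integral>x. g x * indicator (box c d) x \<partial>lebesgue)"
      by (rule integral_completion[symmetric]) measurable
    also have "\<dots> = (\<integral>x. F x * indicator (box c d) x \<partial>lebesgue)"
    proof (rule integral_cong_AE)
      have *: "indicat_real (box c d) \<in> borel_measurable lebesgue"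
        by (rule measurable_completion) simp
      show "(\<lambda>x. g x * indicator (box c d) x) \<in> borel_measurable lebesgue"
        by (rule borel_measurable_times[OF measurable_completion[OF g] *])
      show "(\<lambda>x. F x * indicator (box c d) x) \<in> borel_measurable lebesgue"
        by (rule borel_measurable_times[OF borel_measurable_integrable[OF F] *])
    qed (use Fg' in auto)
    also have "\<dots> = 0" using cd by (intro z) auto
    finally show ?thesis by simp
  qed
  have "density lborel (p 1) = density lborel (p (-1))"
  proof (rule measure_eqI_generator_eq[where E = "range (\<lambda>(a, b). box a b)" and \<Omega> = UNIV
        and A = "\<lambda>n. box (- (real n *\<^sub>R One)) (real n *\<^sub>R One)"])
    show "Int_stable (range (\<lambda>(a, b). box a b))"
      by (auto simp: Int_stable_def box_Int_box)
    show "emeasure (density lborel (p 1)) X = emeasure (density lborel (p (-1))) X"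
      if "X \<in> range (\<lambda>(a, b). box a b)" for X
      using that eq em by auto
    have *: "sets (density lborel (p s)) = sigma_sets UNIV (range (\<lambda>(a, b). box a b))" for s
      unfolding sets_density sets_lborel by (subst borel_eq_box, rule sets_measure_of) simp
    show "sets (density lborel (p 1)) = sigma_sets UNIV (range (\<lambda>(a, b). box a b))"
      "sets (density lborel (p (-1))) = sigma_sets UNIV (range (\<lambda>(a, b). box a b))"
      by (rule *)+
    show "emeasure (density lborel (p 1)) (box (- (real n *\<^sub>R One)) (real n *\<^sub>R One)) \<noteq> \<infinity>" for n
      unfolding em by simp
    show "(\<Union>n. box (- (real n *\<^sub>R One)) (real n *\<^sub>R One)) = (UNIV :: 'a set)"
      by (rule UN_box_eq_UNIV)
    show "range (\<lambda>n. box (- (real n *\<^sub>R One)) (real n *\<^sub>R One)) \<subseteq> range (\<lambda>(a, b). box a b)"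
      by auto
  qed simp_all
  then have "AE x in lborel. p 1 x = p (-1) x"
    by (subst sigma_finite_measure.density_unique_iff[OF lborel.sigma_finite_measure_axioms, symmetric]) auto
  then have "AE x in lborel. x \<in> box l u \<longrightarrow> F x = 0"
    using Fg by eventually_elim (auto simp: p_def max_def split: if_splits)
  then show ?thesis by (rule AE_completion)
qed

lemma test_integrals_zero_imp_AE_zero:
  fixes f :: "'a::euclidean_space \<Rightarrow> real"
  assumes f: "integrable (lebesgue_on \<Omega>) f" and \<Omega>: "open \<Omega>"
    and z: "\<And>\<phi>. test_function \<Omega> \<phi> \<Longrightarrow> (\<integral>x. f x * \<phi> x \<partial>lebesgue_on \<Omega>) = 0"
  shows "AE x in lebesgue_on \<Omega>. f x = 0"
proof -
  have \<Omega>s: "\<Omega> \<in> sets lebesgue" using \<Omega> by auto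
  define F where "F x = indicator \<Omega> x * f x" for x
  have F: "integrable lebesgue F"
    using f \<Omega>s integrable_restrict_space[of \<Omega> lebesgue f] by (simp add: F_def[abs_def])
  have box: "AE x in lebesgue. x \<in> cbox l u \<longrightarrow> F x = 0" if lu: "cbox l u \<subseteq> \<Omega>" for l u
  \<comment> \<open>Only for a nonempty open box is its closure the closed box. A closed box with
    empty interior is a null set.\<close>
  proof (cases "box l u = {}")
    case True
    then have "negligible (cbox l u)"
      by (metis negligible_interval(1))
    then have "AE x in lebesgue. x \<notin> cbox l u"
      by (auto simp: negligible_iff_null_sets intro: AE_not_in)
    then show ?thesis by eventually_elim auto
  next
    case False
    have "AE x in lebesgue. x \<in> box l u \<longrightarrow> F x = 0"
    proof (rule box_integrals_zero_imp_AE_zero[OF F])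
      fix a b assume ab: "box a b \<subseteq> box l u"
      show "(\<integral>x. F x * indicator (box a b) x \<partial>lebesgue) = 0"
      proof (cases "box a b = {}")
        case ne: False
        have "cbox a b \<subseteq> cbox l u"
          using closure_mono[OF ab] ne False by simp
        then have "(\<integral>x. f x * indicator (box a b) x \<partial>lebesgue_on \<Omega>) = 0"
          using lu by (intro integral_box_zero[OF f z]) auto
        then show ?thesis
          using \<Omega>s by (simp add: integral_restrict_space F_def mult.assoc)
      qed simp
    qed
    moreover have "AE x in lebesgue. x \<notin> cbox l u - box l u"
      by (rule AE_not_in) (metis negligible_frontier_interval negligible_iff_null_sets)
    ultimately show ?thesis by eventually_elim auto
  qed
  obtain \<D> where D: "countable \<D>" "\<D> \<subseteq> Pow \<Omega>" "\<And>X. X \<in> \<D> \<Longrightarrow> \<exists>a b. X = cbox a b" "\<Union>\<D> = \<Omega>"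
    using open_countable_Union_open_cbox[OF \<Omega>] by blast
  have "AE x in lebesgue. \<forall>X\<in>\<D>. x \<in> X \<longrightarrow> F x = 0"
    using D box by (subst AE_ball_countable) (auto, metis PowD subsetD)
  then have "AE x in lebesgue. x \<in> \<Omega> \<longrightarrow> f x = 0"
    by eventually_elim (use D(4) in \<open>auto simp: F_def indicator_def\<close>)
  then show ?thesis using \<Omega>s by (simp add: AE_restrict_space_iff)
qed

section \<open>Weak sequential compactness in L2\<close>

definition L2_inner :: "'a::euclidean_space set \<Rightarrow> ('a \<Rightarrow> real) \<Rightarrow> ('a \<Rightarrow> real) \<Rightarrow> real" where
  "L2_inner \<Omega> f g = (\<integral>x. f x * g x \<partial>lebesgue_on \<Omega>)"

lemma L2_mult_integrable:
  assumes "f \<in> L2 \<Omega>" "g \<in> L2 \<Omega>"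
  shows "integrable (lebesgue_on \<Omega>) (\<lambda>x. f x * g x)"
proof (rule Bochner_Integration.integrable_bound)
  show "integrable (lebesgue_on \<Omega>) (\<lambda>x. (f x)\<^sup>2 + (g x)\<^sup>2)"
    using assms by (auto simp: L2_def)
  show "(\<lambda>x. f x * g x) \<in> borel_measurable (lebesgue_on \<Omega>)"
    using assms by (auto simp: L2_def)
  have "\<bar>a * b\<bar> \<le> a\<^sup>2 + b\<^sup>2" for a b :: real
  proof -
    have "2 * (\<bar>a\<bar> * \<bar>b\<bar>) \<le> a\<^sup>2 + b\<^sup>2"
      using sum_squares_bound[of "\<bar>a\<bar>" "\<bar>b\<bar>"] by simp
    moreover have "0 \<le> \<bar>a\<bar> * \<bar>b\<bar>" by simp
    ultimately have "\<bar>a\<bar> * \<bar>b\<bar> \<le> a\<^sup>2 + b\<^sup>2" by linarith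
    then show ?thesis by (simp add: abs_mult)
  qed
  then show "AE x in lebesgue_on \<Omega>. norm (f x * g x) \<le> norm ((f x)\<^sup>2 + (g x)\<^sup>2)" by auto
qed

lemma L2_cmult: "f \<in> L2 \<Omega> \<Longrightarrow> (\<lambda>x. c * f x) \<in> L2 \<Omega>"
  by (auto simp: L2_def power_mult_distrib)

lemma L2_add:
  assumes "f \<in> L2 \<Omega>" "g \<in> L2 \<Omega>" shows "(\<lambda>x. f x + g x) \<in> L2 \<Omega>"
proof -
  have "integrable (lebesgue_on \<Omega>) (\<lambda>x. (f x)\<^sup>2 + 2 * (f x * g x) + (g x)\<^sup>2)"
    using assms L2_mult_integrable[OF assms]
    by (intro Bochner_Integration.integrable_add integrable_mult_right) (auto simp: L2_def)
  then show ?thesis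
    using assms by (auto simp: L2_def power2_sum mult.assoc add_ac)
qed

lemma L2_diff: "f \<in> L2 \<Omega> \<Longrightarrow> g \<in> L2 \<Omega> \<Longrightarrow> (\<lambda>x. f x - g x) \<in> L2 \<Omega>"
  using L2_add[of f \<Omega> "\<lambda>x. - 1 * g x"] L2_cmult[of g \<Omega> "-1"] by simp

lemma L2_zero: "(\<lambda>x. 0) \<in> L2 \<Omega>"
  by (simp add: L2_def)

lemma L2_sum: "(\<And>i. i \<in> I \<Longrightarrow> f i \<in> L2 \<Omega>) \<Longrightarrow> (\<lambda>x. \<Sum>i\<in>I. f i x) \<in> L2 \<Omega>"
  by (induction I rule: infinite_finite_induct) (auto intro: L2_zero L2_add)

lemma L2_const: "\<Omega> \<in> lmeasurable \<Longrightarrow> (\<lambda>x. c) \<in> L2 \<Omega>"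
  by (simp add: L2_def finite_measure.integrable_const[OF finite_measure_lebesgue_on])

lemma L2_abs: "f \<in> L2 \<Omega> \<Longrightarrow> (\<lambda>x. \<bar>f x\<bar>) \<in> L2 \<Omega>"
  by (auto simp: L2_def)

lemma L2_integrable: "\<Omega> \<in> lmeasurable \<Longrightarrow> f \<in> L2 \<Omega> \<Longrightarrow> integrable (lebesgue_on \<Omega>) f"
  using L2_mult_integrable[OF L2_const[of \<Omega> 1]] by simp

lemma L2_inner_commute: "L2_inner \<Omega> f g = L2_inner \<Omega> g f"
  by (simp add: L2_inner_def mult.commute)

lemma L2_inner_cmult_left: "L2_inner \<Omega> (\<lambda>x. c * f x) g = c * L2_inner \<Omega> f g"
  by (simp add: L2_inner_def mult.assoc)

lemma L2_inner_cmult_right: "L2_inner \<Omega> f (\<lambda>x. c * g x) = c * L2_inner \<Omega> f g"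
  by (simp add: L2_inner_def mult.left_commute)

lemma L2_inner_add_left:
  "f \<in> L2 \<Omega> \<Longrightarrow> g \<in> L2 \<Omega> \<Longrightarrow> h \<in> L2 \<Omega> \<Longrightarrow>
    L2_inner \<Omega> (\<lambda>x. f x + g x) h = L2_inner \<Omega> f h + L2_inner \<Omega> g h"
  by (simp add: L2_inner_def distrib_right L2_mult_integrable)

lemma L2_inner_diff_left:
  "f \<in> L2 \<Omega> \<Longrightarrow> g \<in> L2 \<Omega> \<Longrightarrow> h \<in> L2 \<Omega> \<Longrightarrow>
    L2_inner \<Omega> (\<lambda>x. f x - g x) h = L2_inner \<Omega> f h - L2_inner \<Omega> g h"
  by (simp add: L2_inner_def left_diff_distrib L2_mult_integrable)

lemma L2_inner_add_right:
  "f \<in> L2 \<Omega> \<Longrightarrow> g \<in> L2 \<Omega> \<Longrightarrow> h \<in> L2 \<Omega> \<Longrightarrow>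
    L2_inner \<Omega> h (\<lambda>x. f x + g x) = L2_inner \<Omega> h f + L2_inner \<Omega> h g"
  by (simp add: L2_inner_def distrib_left L2_mult_integrable)

lemma L2_inner_diff_right:
  "f \<in> L2 \<Omega> \<Longrightarrow> g \<in> L2 \<Omega> \<Longrightarrow> h \<in> L2 \<Omega> \<Longrightarrow>
    L2_inner \<Omega> h (\<lambda>x. f x - g x) = L2_inner \<Omega> h f - L2_inner \<Omega> h g"
  by (simp add: L2_inner_def right_diff_distrib L2_mult_integrable)

lemma L2_inner_sum_left:
  "(\<And>i. i \<in> I \<Longrightarrow> f i \<in> L2 \<Omega>) \<Longrightarrow> h \<in> L2 \<Omega> \<Longrightarrow>
    L2_inner \<Omega> (\<lambda>x. \<Sum>i\<in>I. f i x) h = (\<Sum>i\<in>I. L2_inner \<Omega> (f i) h)"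
  by (simp add: L2_inner_def sum_distrib_right L2_mult_integrable)

lemma L2_inner_sum_right:
  "(\<And>i. i \<in> I \<Longrightarrow> f i \<in> L2 \<Omega>) \<Longrightarrow> h \<in> L2 \<Omega> \<Longrightarrow>
    L2_inner \<Omega> h (\<lambda>x. \<Sum>i\<in>I. f i x) = (\<Sum>i\<in>I. L2_inner \<Omega> h (f i))"
  by (simp add: L2_inner_def sum_distrib_left L2_mult_integrable)

lemma L2_inner_nonneg: "0 \<le> L2_inner \<Omega> f f"
  by (auto simp: L2_inner_def intro: Bochner_Integration.integral_nonneg)

lemma L2_norm_eq: "(L2_norm \<Omega> f)\<^sup>2 = L2_inner \<Omega> f f"
  using L2_inner_nonneg[of \<Omega> f] by (simp add: L2_norm_def L2_inner_def power2_eq_square)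

lemma L2_inner_eq_0_iff: "f \<in> L2 \<Omega> \<Longrightarrow> L2_inner \<Omega> f f = 0 \<longleftrightarrow> (AE x in lebesgue_on \<Omega>. f x = 0)"
  unfolding L2_inner_def
  by (subst integral_nonneg_eq_0_iff_AE) (auto intro: L2_mult_integrable)

lemma L2_inner_cong_AE:
  assumes "f \<in> L2 \<Omega>" "f' \<in> L2 \<Omega>" "g \<in> L2 \<Omega>" "g' \<in> L2 \<Omega>"
    and "AE x in lebesgue_on \<Omega>. f x = f' x" "AE x in lebesgue_on \<Omega>. g x = g' x"
  shows "L2_inner \<Omega> f g = L2_inner \<Omega> f' g'"
  unfolding L2_inner_def
  by (rule integral_cong_AE) (use assms in \<open>auto simp: L2_def\<close>)

lemma L2_inner_Cauchy_Schwarz: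
  assumes f: "f \<in> L2 \<Omega>" and g: "g \<in> L2 \<Omega>"
  shows "(L2_inner \<Omega> f g)\<^sup>2 \<le> L2_inner \<Omega> f f * L2_inner \<Omega> g g"
proof -
  have q: "0 \<le> L2_inner \<Omega> f f + 2 * t * L2_inner \<Omega> f g + t\<^sup>2 * L2_inner \<Omega> g g" for t
  proof -
    have "L2_inner \<Omega> (\<lambda>x. f x + t * g x) (\<lambda>x. f x + t * g x)
        = L2_inner \<Omega> f f + 2 * t * L2_inner \<Omega> f g + t\<^sup>2 * L2_inner \<Omega> g g"
      using f g L2_cmult[OF g, of t] L2_add[OF f L2_cmult[OF g, of t]]
      by (simp add: L2_inner_add_left L2_inner_add_right L2_inner_cmult_left L2_inner_cmult_right
          L2_inner_commute[of \<Omega> g f] power2_eq_square algebra_simps)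
    then show ?thesis using L2_inner_nonneg by metis
  qed
  show ?thesis
  proof (cases "L2_inner \<Omega> g g = 0")
    case True
    have "L2_inner \<Omega> f g = 0"
    proof (rule ccontr)
      assume "L2_inner \<Omega> f g \<noteq> 0"
      then show False
        \<comment> \<open>Without its quadratic term the expression in \<open>q\<close> is affine in
          \<open>t\<close>; this \<open>t\<close> makes it equal to -1.\<close>
        using q[of "- ((L2_inner \<Omega> f f + 1) / 2) / L2_inner \<Omega> f g"] True by simp
    qed
    then show ?thesis using True by simp
  next
    case False
    then have "L2_inner \<Omega> g g > 0" using L2_inner_nonneg[of \<Omega> g] by simp
    then show ?thesis
      using q[of "- L2_inner \<Omega> f g / L2_inner \<Omega> g g"]
      by (simp add: field_simps power2_eq_square)
  qed
qed

lemma L2_inner_bound: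
  assumes "f \<in> L2 \<Omega>" "g \<in> L2 \<Omega>" "L2_inner \<Omega> f f \<le> C"
  shows "\<bar>L2_inner \<Omega> f g\<bar> \<le> sqrt (C * L2_inner \<Omega> g g)"
proof -
  have "(L2_inner \<Omega> f g)\<^sup>2 \<le> C * L2_inner \<Omega> g g"
    using L2_inner_Cauchy_Schwarz[OF assms(1,2)] mult_right_mono[OF assms(3) L2_inner_nonneg] by (rule order_trans)
  then show ?thesis by (metis real_sqrt_abs real_sqrt_le_mono)
qed

text \<open>Riesz-Fischer on a set of finite measure: Cauchy-Schwarz against 1 makes the sequence
  Cauchy in L1, a subsequence then converges almost everywhere, and Fatou's lemma turns the Cauchy
  estimate into an L2 bound for the distance to the limit.\<close>

lemma L2_complete:
  assumes \<Omega>: "\<Omega> \<in> lmeasurable" and w: "\<And>n. w n \<in> L2 \<Omega>"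
    and C: "\<And>e. e > 0 \<Longrightarrow> \<exists>N. \<forall>i\<ge>N. \<forall>j\<ge>N. L2_inner \<Omega> (\<lambda>x. w i x - w j x) (\<lambda>x. w i x - w j x) < e"
  obtains u where "u \<in> L2 \<Omega>" "(\<lambda>n. L2_inner \<Omega> (\<lambda>x. w n x - u x) (\<lambda>x. w n x - u x)) \<longlonglongrightarrow> 0"
proof -
  let ?M = "lebesgue_on \<Omega>"
  let ?D = "\<lambda>i j. L2_inner \<Omega> (\<lambda>x. w i x - w j x) (\<lambda>x. w i x - w j x)"
  have wm[measurable]: "w n \<in> borel_measurable ?M" for n using w by (auto simp: L2_def)
  have L1: "\<exists>N. \<forall>i\<ge>N. \<forall>j\<ge>N. (LINT x|?M. norm (w i x - w j x)) < e" if e: "e > 0" for e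
  proof -
    \<comment> \<open>The added 1 keeps the divisor positive even when \<Omega> has measure
      0.\<close>
    let ?m = "L2_inner \<Omega> (\<lambda>x. 1) (\<lambda>x. 1) + 1"
    have m: "?m > 0" using L2_inner_nonneg[of \<Omega> "\<lambda>x. 1"] by linarith
    obtain N where N: "\<And>i j. i \<ge> N \<Longrightarrow> j \<ge> N \<Longrightarrow> ?D i j < e\<^sup>2 / ?m"
      using C[of "e\<^sup>2 / ?m"] e m by auto
    have "(LINT x|?M. norm (w i x - w j x)) < e" if ij: "i \<ge> N" "j \<ge> N" for i j
    proof -
      have "(L2_inner \<Omega> (\<lambda>x. \<bar>w i x - w j x\<bar>) (\<lambda>x. 1))\<^sup>2 \<le> ?D i j * L2_inner \<Omega> (\<lambda>x. 1) (\<lambda>x. 1)"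
        using L2_inner_Cauchy_Schwarz[OF L2_abs[OF L2_diff[OF w[of i] w[of j]]] L2_const[OF \<Omega>, of 1]]
        by (simp add: L2_inner_def)
      also have "\<dots> \<le> ?D i j * ?m"
        by (intro mult_left_mono L2_inner_nonneg) simp
      also have "\<dots> < e\<^sup>2" using N[OF ij] m by (simp add: field_simps)
      finally show ?thesis using e by (simp add: L2_inner_def power_less_imp_less_base)
    qed
    then show ?thesis by blast
  qed
  obtain r :: "nat \<Rightarrow> nat" where r: "strict_mono r" "AE x in ?M. Cauchy (\<lambda>i. w (r i) x)"
    using cauchy_L1_AE_cauchy_subseq[of ?M w, OF L2_integrable[OF \<Omega> w] L1] by blast
  define u where "u x = lim (\<lambda>i. w (r i) x)" for x
  have um[measurable]: "u \<in> borel_measurable ?M"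
    unfolding u_def by (intro borel_measurable_lim_metric) auto
  have conv: "AE x in ?M. (\<lambda>i. w (r i) x) \<longlonglongrightarrow> u x"
    using r(2) by eventually_elim (auto simp: u_def Cauchy_convergent_iff convergent_LIMSEQ_iff)
  have bnd: "(\<integral>\<^sup>+x. ennreal ((w n x - u x)\<^sup>2) \<partial>?M) \<le> ennreal e"
    if e: "e > 0" and n: "\<forall>j\<ge>N. ?D n j < e" for n N e
  proof -
    have "(\<integral>\<^sup>+x. ennreal ((w n x - u x)\<^sup>2) \<partial>?M) = (\<integral>\<^sup>+x. liminf (\<lambda>i. ennreal ((w n x - w (r i) x)\<^sup>2)) \<partial>?M)"
    proof (rule nn_integral_cong_AE)
      show "AE x in ?M. ennreal ((w n x - u x)\<^sup>2) = liminf (\<lambda>i. ennreal ((w n x - w (r i) x)\<^sup>2))"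
        using conv
      proof eventually_elim
        case (elim x)
        then have "(\<lambda>i. ennreal ((w n x - w (r i) x)\<^sup>2)) \<longlonglongrightarrow> ennreal ((w n x - u x)\<^sup>2)"
          by (intro tendsto_ennrealI tendsto_intros)
        from lim_imp_Liminf[OF trivial_limit_sequentially this] show ?case by simp
      qed
    qed
    also have "\<dots> \<le> liminf (\<lambda>i. \<integral>\<^sup>+x. ennreal ((w n x - w (r i) x)\<^sup>2) \<partial>?M)"
      by (rule nn_integral_liminf) measurable
    also have "\<dots> \<le> limsup (\<lambda>i. \<integral>\<^sup>+x. ennreal ((w n x - w (r i) x)\<^sup>2) \<partial>?M)"
      by (rule Liminf_le_Limsup) simp
    also have "\<dots> \<le> ennreal e"
    proof (rule Limsup_bounded)
      show "\<forall>\<^sub>F i in sequentially. (\<integral>\<^sup>+x. ennreal ((w n x - w (r i) x)\<^sup>2) \<partial>?M) \<le> ennreal e"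
        using eventually_ge_at_top[of N]
      proof eventually_elim
        case (elim i)
        then have "?D n (r i) < e" using n seq_suble[OF r(1), of i] by auto
        moreover have "(\<integral>\<^sup>+x. ennreal ((w n x - w (r i) x)\<^sup>2) \<partial>?M) = ennreal (?D n (r i))"
          using L2_mult_integrable[OF L2_diff[OF w[of n] w[of "r i"]] L2_diff[OF w[of n] w[of "r i"]]]
          by (subst nn_integral_eq_integral) (auto simp: L2_inner_def power2_eq_square)
        ultimately show ?case by (simp add: ennreal_leI)
      qed
    qed
    finally show ?thesis .
  qed
  have diffL2: "(\<lambda>x. w n x - u x) \<in> L2 \<Omega>" if e: "e > 0" and n: "\<forall>j\<ge>N. ?D n j < e" for n N e
    using bnd[OF that] unfolding L2_def
    by (auto intro!: integrableI_bounded simp: order_le_less_trans[OF _ ennreal_less_top])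
  obtain N1 where N1: "\<forall>j\<ge>N1. ?D N1 j < 1" using C[of 1] by auto
  \<comment> \<open>The limit is a member of the sequence minus a difference already known to be
    square integrable.\<close>
  have uL: "u \<in> L2 \<Omega>"
    using L2_diff[OF w[of N1] diffL2[OF _ N1]] by simp
  have "(\<lambda>n. L2_inner \<Omega> (\<lambda>x. w n x - u x) (\<lambda>x. w n x - u x)) \<longlonglongrightarrow> 0"
  proof (rule LIMSEQ_I)
    fix e :: real assume e: "e > 0"
    obtain N where N: "\<forall>i\<ge>N. \<forall>j\<ge>N. ?D i j < e / 2" using C[of "e / 2"] e by auto
    have *: "L2_inner \<Omega> (\<lambda>x. w n x - u x) (\<lambda>x. w n x - u x) \<le> e / 2" if "n \<ge> N" for n
    proof -
      have "ennreal (L2_inner \<Omega> (\<lambda>x. w n x - u x) (\<lambda>x. w n x - u x)) = (\<integral>\<^sup>+x. ennreal ((w n x - u x)\<^sup>2) \<partial>?M)"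
        using L2_mult_integrable[OF L2_diff[OF w[of n] uL] L2_diff[OF w[of n] uL]]
        by (subst nn_integral_eq_integral) (auto simp: L2_inner_def power2_eq_square)
      also have "\<dots> \<le> ennreal (e / 2)" using bnd[of "e / 2" N n] N that e by simp
      finally show ?thesis using e by (simp add: ennreal_le_iff)
    qed
    show "\<exists>no. \<forall>n\<ge>no. norm (L2_inner \<Omega> (\<lambda>x. w n x - u x) (\<lambda>x. w n x - u x) - 0) < e"
    proof (intro exI[of _ N] allI impI)
      fix n assume "N \<le> n"
      then show "norm (L2_inner \<Omega> (\<lambda>x. w n x - u x) (\<lambda>x. w n x - u x) - 0) < e"
        using *[of n] L2_inner_nonneg[of \<Omega> "\<lambda>x. w n x - u x"] e by simp
    qed
  qed
  then show thesis using that uL by blast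
qed

text \<open>Closure under midpoints is the form of convexity that the parallelogram law consumes,
  and it comes with an induction rule for transferring estimates from the sequence.\<close>

inductive_set midpoint_tail :: "(nat \<Rightarrow> 'a \<Rightarrow> real) \<Rightarrow> nat \<Rightarrow> ('a \<Rightarrow> real) set"
  for f n where
  midpoint_tail_base: "i \<ge> n \<Longrightarrow> f i \<in> midpoint_tail f n"
| midpoint_tail_mid: "v \<in> midpoint_tail f n \<Longrightarrow> w \<in> midpoint_tail f n \<Longrightarrow>
    (\<lambda>x. 1 / 2 * (v x + w x)) \<in> midpoint_tail f n"

lemma midpoint_tail_antimono: "n \<le> m \<Longrightarrow> midpoint_tail f m \<subseteq> midpoint_tail f n"
proof
  fix w assume "n \<le> m" "w \<in> midpoint_tail f m"
  from this(2,1) show "w \<in> midpoint_tail f n"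
  proof induction
    case (midpoint_tail_mid v w)
    then show ?case by (intro midpoint_tail.midpoint_tail_mid) auto
  qed (auto intro: midpoint_tail.intros)
qed

text \<open>
  Elements of almost minimal norm in the midpoint-closed tails form a Cauchy sequence by the
  parallelogram law; this replaces the Riesz and Banach-Alaoglu theorems.
\<close>

lemma L2_weak_cluster_candidate:
  assumes \<Omega>: "\<Omega> \<in> lmeasurable" and f: "\<And>n. f n \<in> L2 \<Omega>" and C: "\<And>n. L2_inner \<Omega> (f n) (f n) \<le> C"
  obtains u where "u \<in> L2 \<Omega>"
    "\<And>g l. g \<in> L2 \<Omega> \<Longrightarrow> (\<lambda>i. L2_inner \<Omega> (f i) g) \<longlonglongrightarrow> l \<Longrightarrow> L2_inner \<Omega> u g = l"
proof -
  let ?K = "midpoint_tail f" and ?Q = "\<lambda>w. L2_inner \<Omega> w w"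
  have KL2: "w \<in> L2 \<Omega>" if "w \<in> ?K n" for w n
    using that
  proof induction
    case (midpoint_tail_mid v w)
    then show ?case by (intro L2_cmult L2_add) auto
  qed (rule f)
  define d where "d n = Inf (?Q ` ?K n)" for n
  have bb: "bdd_below (?Q ` A)" for A
    by (rule bdd_belowI2[of _ 0]) (rule L2_inner_nonneg)
  have ne: "?K n \<noteq> {}" for n using midpoint_tail_base[of n n f] by auto
  have d_le: "d n \<le> ?Q w" if "w \<in> ?K n" for w n
    unfolding d_def using that bb by (intro cInf_lower) auto
  \<comment> \<open>The tails shrink, so their infima increase; bounded by \<open>C\<close>, they
    converge.\<close>
  have "incseq d"
    unfolding incseq_def d_def
    by (intro allI impI cInf_superset_mono image_mono midpoint_tail_antimono bb) (simp_all add: ne)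
  moreover have "d n \<le> C" for n
    using d_le[OF midpoint_tail_base[of n n f]] C[of n] by simp
  ultimately obtain L where "d \<longlonglongrightarrow> L"
    using incseq_convergent[of d C] by blast
  then have "Cauchy d" by (rule LIMSEQ_imp_Cauchy)
  have "\<exists>w\<in>?K n. ?Q w < d n + 1 / real (Suc n)" for n
    using cInf_lessD[of "?Q ` ?K n" "d n + 1 / real (Suc n)"] ne[of n] by (auto simp: d_def)
  then obtain w where w: "\<And>n. w n \<in> ?K n" "\<And>n. ?Q (w n) < d n + 1 / real (Suc n)" by metis
  have wL: "w n \<in> L2 \<Omega>" for n using w KL2 by blast
  \<comment> \<open>Parallelogram law: the midpoint of \<open>w n\<close> and \<open>w m\<close>
    lies in the \<open>n\<close>-th tail, so four times its squared norm is at least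
    \<open>4 * d n\<close>. The two errors of almost minimality contribute at most
    \<open>4 / Suc n\<close>.\<close>
  have par: "?Q (\<lambda>x. w n x - w m x) \<le> 2 * (d m - d n) + 4 / real (Suc n)" if nm: "n \<le> m" for n m
  proof -
    have "d n \<le> ?Q (\<lambda>x. 1 / 2 * (w n x + w m x))"
      using nm w midpoint_tail_antimono by (intro d_le midpoint_tail_mid) blast+
    moreover have "?Q (\<lambda>x. 1 / 2 * (w n x + w m x)) = (?Q (w n) + 2 * L2_inner \<Omega> (w n) (w m) + ?Q (w m)) / 4"
      using wL L2_add[OF wL[of n] wL[of m]]
      by (simp only: L2_inner_cmult_left L2_inner_cmult_right L2_inner_add_left L2_inner_add_right
          L2_inner_commute[of \<Omega> "w m" "w n"]) simp
    moreover have "?Q (\<lambda>x. w n x - w m x) = ?Q (w n) - 2 * L2_inner \<Omega> (w n) (w m) + ?Q (w m)"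
      using wL L2_diff[OF wL[of n] wL[of m]]
      by (simp add: L2_inner_diff_left L2_inner_diff_right L2_inner_commute[of \<Omega> "w m" "w n"])
    moreover have "1 / real (Suc m) \<le> 1 / real (Suc n)" using nm by (simp add: frac_le)
    ultimately show ?thesis using w(2)[of n] w(2)[of m] by argo
  qed
  have cau: "\<exists>N. \<forall>i\<ge>N. \<forall>j\<ge>N. ?Q (\<lambda>x. w i x - w j x) < e" if e: "e > 0" for e
  proof -
    \<comment> \<open>With \<open>e / 8\<close> for both quantities the bound \<open>par\<close>
      adds up to less than \<open>2 * e / 8 + 4 * e / 8\<close>, which is below
      \<open>e\<close>.\<close>
    obtain N1 where N1: "\<forall>i\<ge>N1. \<forall>j\<ge>N1. dist (d i) (d j) < e / 8"
      using \<open>Cauchy d\<close> e unfolding Cauchy_def by (meson divide_pos_pos zero_less_numeral)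
    obtain N2 where N2: "1 / real (Suc N2) < e / 8"
      using e nat_approx_posE[of "e / 8"] by auto
    have le: "?Q (\<lambda>x. w i x - w j x) < e" if "i \<ge> max N1 N2" "i \<le> j" for i j
    proof -
      have "1 / real (Suc i) \<le> 1 / real (Suc N2)" using that by (simp add: frac_le)
      moreover have "d j - d i < e / 8"
        using N1 that by (auto simp: dist_real_def abs_if split: if_splits) (smt (verit) le_trans)
      ultimately show ?thesis using par[OF that(2)] N2 e by argo
    qed
    have sym: "?Q (\<lambda>x. w i x - w j x) = ?Q (\<lambda>x. w j x - w i x)" for i j
      by (auto simp: L2_inner_def algebra_simps)
    show ?thesis
      using le sym by (intro exI[of _ "max N1 N2"] allI impI) (metis linear)
  qed
  obtain u where u: "u \<in> L2 \<Omega>" "(\<lambda>n. ?Q (\<lambda>x. w n x - u x)) \<longlonglongrightarrow> 0"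
    using L2_complete[OF \<Omega> wL cau] by blast
  show thesis
  proof (rule that[OF u(1)])
    fix g l assume g: "g \<in> L2 \<Omega>" and l: "(\<lambda>i. L2_inner \<Omega> (f i) g) \<longlonglongrightarrow> l"
    \<comment> \<open>A bound on the distance to \<open>l\<close> survives midpoints, so it passes
      from late \<open>f i\<close> to late \<open>w n\<close>.\<close>
    have 1: "(\<lambda>n. L2_inner \<Omega> (w n) g) \<longlonglongrightarrow> l"
    proof (rule LIMSEQ_I)
      fix e :: real assume "e > 0"
      then obtain N where N: "\<And>i. i \<ge> N \<Longrightarrow> \<bar>L2_inner \<Omega> (f i) g - l\<bar> < e"
        using LIMSEQ_D[OF l] by auto
      have "\<bar>L2_inner \<Omega> v g - l\<bar> < e" if "v \<in> ?K N" for v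
        using that
      proof induction
        case (midpoint_tail_mid v w)
        have "L2_inner \<Omega> (\<lambda>x. 1 / 2 * (v x + w x)) g = (L2_inner \<Omega> v g + L2_inner \<Omega> w g) / 2"
          using KL2 midpoint_tail_mid(1,2) g
          by (simp only: L2_inner_cmult_left L2_inner_add_left)
        then show ?case using midpoint_tail_mid(3,4) by argo
      qed (rule N)
      then have "\<forall>n\<ge>N. \<bar>L2_inner \<Omega> (w n) g - l\<bar> < e"
        using w(1) midpoint_tail_antimono by blast
      then show "\<exists>no. \<forall>n\<ge>no. norm (L2_inner \<Omega> (w n) g - l) < e" by auto
    qed
    have "(\<lambda>n. L2_inner \<Omega> (w n) g - L2_inner \<Omega> u g) \<longlonglongrightarrow> 0"
    proof (rule Lim_null_comparison)
      show "(\<lambda>n. sqrt (?Q (\<lambda>x. w n x - u x) * ?Q g)) \<longlonglongrightarrow> 0"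
        using tendsto_real_sqrt[OF tendsto_mult_right[OF u(2), of "?Q g"]] by simp
      show "\<forall>\<^sub>F n in sequentially. norm (L2_inner \<Omega> (w n) g - L2_inner \<Omega> u g) \<le> sqrt (?Q (\<lambda>x. w n x - u x) * ?Q g)"
        using L2_inner_bound[OF L2_diff[OF wL u(1)] g order_refl]
        by (simp add: L2_inner_diff_left wL u(1) g)
    qed
    then have "(\<lambda>n. L2_inner \<Omega> (w n) g) \<longlonglongrightarrow> L2_inner \<Omega> u g"
      by (simp add: LIM_zero_iff)
    then show "L2_inner \<Omega> u g = l" using 1 LIMSEQ_unique by blast
  qed
qed

lemma bounded_real_subseq:
  fixes x :: "nat \<Rightarrow> real"
  assumes "\<And>n. \<bar>x n\<bar> \<le> B"
  obtains r l where "strict_mono r" "(\<lambda>i. x (r i)) \<longlonglongrightarrow> l"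
proof -
  have "compact {- B..B}" by simp
  moreover have "x n \<in> {- B..B}" for n using assms[of n] by auto
  ultimately show thesis using that unfolding compact_def comp_def by metis
qed

text \<open>A diagonal argument makes the products with every \<open>f m\<close> converge; the
  sequence itself plays the role of a dense family. If weak convergence failed for some
  \<open>g\<close>, a further subsequence would have another candidate limit, and both candidates
  have the same products with all \<open>f m\<close>.\<close>

lemma L2_weakly_sequentially_compact:
  fixes f :: "nat \<Rightarrow> 'a::euclidean_space \<Rightarrow> real"
  assumes \<Omega>: "\<Omega> \<in> lmeasurable" and f: "\<And>n. f n \<in> L2 \<Omega>" and C: "\<And>n. L2_inner \<Omega> (f n) (f n) \<le> C"
  obtains r u where "strict_mono r" "weakly_converges_L2 \<Omega> (\<lambda>i. f (r i)) u"
proof -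
  define P :: "nat \<Rightarrow> (nat \<Rightarrow> nat) \<Rightarrow> bool" where "P = (\<lambda>m s. convergent (\<lambda>i. L2_inner \<Omega> (f (s i)) (f m)))"
  interpret subseqs P
  proof
    fix n :: nat and s :: "nat \<Rightarrow> nat" assume "strict_mono s"
    obtain r l where "strict_mono r" "(\<lambda>i. L2_inner \<Omega> (f (s (r i))) (f n)) \<longlonglongrightarrow> l"
      using bounded_real_subseq[of "\<lambda>i. L2_inner \<Omega> (f (s i)) (f n)"] L2_inner_bound[OF f f C] by metis
    then show "\<exists>r'. strict_mono r' \<and> P n (s \<circ> r')"
      unfolding P_def comp_def by (auto simp: convergent_def)
  qed
  define r where "r = diagseq"
  have r: "strict_mono r" unfolding r_def by (rule subseq_diagseq)
  have conv: "convergent (\<lambda>i. L2_inner \<Omega> (f (r i)) (f m))" for m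
  proof -
    \<comment> \<open>Only from index \<open>Suc m\<close> on is the diagonal sequence a subsequence
      of the one extracted for \<open>m\<close>; the initial segment is irrelevant for
      convergence.\<close>
    have "P m (diagseq \<circ> ((+) (Suc m)))"
    proof (rule diagseq_holds)
      fix s r :: "nat \<Rightarrow> nat" and n assume "strict_mono r" "P n s"
      then show "P n (s \<circ> r)"
        unfolding P_def using convergent_subseq_convergent[of "\<lambda>i. L2_inner \<Omega> (f (s i)) (f n)" r]
        by (simp add: comp_def)
    qed
    then have "convergent (\<lambda>i. L2_inner \<Omega> (f (r (i + Suc m))) (f m))"
      unfolding P_def r_def by (simp add: comp_def add.commute)
    then show ?thesis
      using convergent_ignore_initial_segment[of "\<lambda>i. L2_inner \<Omega> (f (r i)) (f m)" "Suc m"] by simp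
  qed
  obtain u where u: "u \<in> L2 \<Omega>"
    "\<And>g l. g \<in> L2 \<Omega> \<Longrightarrow> (\<lambda>i. L2_inner \<Omega> (f (r i)) g) \<longlonglongrightarrow> l \<Longrightarrow> L2_inner \<Omega> u g = l"
    using L2_weak_cluster_candidate[OF \<Omega>, of "\<lambda>i. f (r i)" C] f C by blast
  have "(\<lambda>i. L2_inner \<Omega> (f (r i)) g) \<longlonglongrightarrow> L2_inner \<Omega> u g" if g: "g \<in> L2 \<Omega>" for g
  proof (rule ccontr)
    let ?x = "\<lambda>i. L2_inner \<Omega> (f (r i)) g"
    assume "\<not> ?x \<longlonglongrightarrow> L2_inner \<Omega> u g"
    then obtain e where e: "e > 0" "\<exists>\<^sub>F i in sequentially. dist (?x i) (L2_inner \<Omega> u g) \<ge> e"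
      unfolding tendsto_iff by (auto simp: frequently_def not_le)
    then have "infinite {i. dist (?x i) (L2_inner \<Omega> u g) \<ge> e}"
      by (simp add: frequently_cofinite[symmetric] cofinite_eq_sequentially)
    then obtain s :: "nat \<Rightarrow> nat" where s: "strict_mono s" "\<And>i. dist (?x (s i)) (L2_inner \<Omega> u g) \<ge> e"
      using infinite_enumerate[of "{i. dist (?x i) (L2_inner \<Omega> u g) \<ge> e}"] by auto
    obtain t l where t: "strict_mono t" "(\<lambda>i. ?x (s (t i))) \<longlonglongrightarrow> l"
      using bounded_real_subseq[of "\<lambda>i. ?x (s i)"] L2_inner_bound[OF f g C] by metis
    have "e \<le> dist l (L2_inner \<Omega> u g)"
      by (rule tendsto_lowerbound[OF tendsto_dist[OF t(2) tendsto_const]]) (use s(2) in auto)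
    obtain u' where u': "u' \<in> L2 \<Omega>"
      "\<And>g l. g \<in> L2 \<Omega> \<Longrightarrow> (\<lambda>i. L2_inner \<Omega> (f (r (s (t i)))) g) \<longlonglongrightarrow> l \<Longrightarrow> L2_inner \<Omega> u' g = l"
      using L2_weak_cluster_candidate[OF \<Omega>, of "\<lambda>i. f (r (s (t i)))" C] f C by blast
    have same: "L2_inner \<Omega> u (f m) = L2_inner \<Omega> u' (f m)" for m
    proof -
      obtain a where a: "(\<lambda>i. L2_inner \<Omega> (f (r i)) (f m)) \<longlonglongrightarrow> a"
        using conv by (auto simp: convergent_def)
      have "(\<lambda>i. L2_inner \<Omega> (f (r (s (t i)))) (f m)) \<longlonglongrightarrow> a"
        using LIMSEQ_subseq_LIMSEQ[OF a strict_mono_o[OF s(1) t(1)]] by (simp add: comp_def)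
      then show ?thesis using u(2)[OF f a] u'(2)[OF f] by simp
    qed
    define h where "h x = u x - u' x" for x
    have h: "h \<in> L2 \<Omega>" unfolding h_def[abs_def] by (rule L2_diff[OF u(1) u'(1)])
    have "L2_inner \<Omega> (f m) h = 0" for m
      using same[of m] u(1) u'(1) f unfolding h_def[abs_def]
      by (subst L2_inner_commute) (simp add: L2_inner_diff_left)
    \<comment> \<open>As \<open>h\<close> is orthogonal to all \<open>f m\<close>, the products with
      \<open>h\<close> converge to 0 along both subsequences. So \<open>h\<close> is orthogonal to
      \<open>u\<close> and \<open>u'\<close>, hence to itself.\<close>
    then have "L2_inner \<Omega> u h = 0" "L2_inner \<Omega> u' h = 0"
      using u(2)[OF h, of 0] u'(2)[OF h, of 0] by simp_all
    then have hh: "L2_inner \<Omega> h h = 0"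
      using L2_inner_diff_left[OF u(1) u'(1) h] by (simp add: h_def[abs_def])
    have "L2_inner \<Omega> h g = 0" using L2_inner_Cauchy_Schwarz[OF h g] hh by simp
    then have "L2_inner \<Omega> u g = L2_inner \<Omega> u' g"
      using L2_inner_diff_left[OF u(1) u'(1) g] by (simp add: h_def[abs_def])
    then show False using u'(2)[OF g t(2)] \<open>e \<le> dist l _\<close> e(1) by simp
  qed
  then have "weakly_converges_L2 \<Omega> (\<lambda>i. f (r i)) u"
    unfolding weakly_converges_L2_def using f u(1) by (auto simp: L2_inner_def)
  then show thesis using that r by blast
qed

section \<open>Integration of test functions and weak gradients\<close>

lemma bounded_if_zero_off_compact:
  fixes g :: "'a::euclidean_space \<Rightarrow> real"
  assumes "continuous_on UNIV g" "compact K" "\<And>x. x \<notin> K \<Longrightarrow> g x = 0"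
  obtains C where "C \<ge> 0" "\<And>x. \<bar>g x\<bar> \<le> C"
proof -
  have "bounded (g ` K)"
    using assms by (meson compact_continuous_image compact_imp_bounded continuous_on_subset subset_UNIV)
  then obtain C where C: "C > 0" "\<And>x. x \<in> K \<Longrightarrow> \<bar>g x\<bar> \<le> C"
    by (auto simp: bounded_pos)
  show thesis
    by (rule that[of C]) (use C assms(3) in \<open>force+\<close>)
qed

lemma L2_bounded:
  assumes "\<Omega> \<in> lmeasurable" "f \<in> borel_measurable (lebesgue_on \<Omega>)" "\<And>x. x \<in> \<Omega> \<Longrightarrow> \<bar>f x\<bar> \<le> C"
  shows "f \<in> L2 \<Omega>"
proof -
  interpret finite_measure "lebesgue_on \<Omega>" by (rule finite_measure_lebesgue_on[OF assms(1)])
  have "(f x)\<^sup>2 \<le> C\<^sup>2" if "x \<in> \<Omega>" for x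
    using assms(3)[OF that] abs_le_square_iff[of "f x" C] by auto
  then have "integrable (lebesgue_on \<Omega>) (\<lambda>x. (f x)\<^sup>2)"
    using assms(2) by (intro integrable_const_bound[where B = "C\<^sup>2"] AE_I2) auto
  then show ?thesis using assms(2) by (simp add: L2_def)
qed

lemma test_function_continuously_differentiable:
  "test_function \<Omega> \<phi> \<Longrightarrow> continuously_differentiable r \<phi>"
  by (simp add: test_function_def)

lemma test_function_continuous: "test_function \<Omega> \<phi> \<Longrightarrow> continuous_on UNIV \<phi>"
  using test_function_continuously_differentiable[of \<Omega> \<phi> 0] by simp

lemma test_function_differentiable: "test_function \<Omega> \<phi> \<Longrightarrow> \<phi> differentiable (at x)"
  using test_function_continuously_differentiable[of \<Omega> \<phi> "Suc 0"] by simp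

lemma test_function_derivative_continuous:
  "test_function \<Omega> \<phi> \<Longrightarrow> b \<in> Basis \<Longrightarrow> continuous_on UNIV (\<lambda>x. frechet_derivative \<phi> (at x) b)"
  using test_function_continuously_differentiable[of \<Omega> \<phi> "Suc 0"] by simp

lemma test_function_derivative_zero:
  assumes "test_function \<Omega> \<phi>" "x \<notin> closure {x. \<phi> x \<noteq> 0}"
  shows "frechet_derivative \<phi> (at x) b = 0"
proof -
  have "((\<lambda>x. 0) has_derivative (\<lambda>x. 0)) (at x)" by simp
  then have "(\<phi> has_derivative (\<lambda>x. 0)) (at x)"
    by (rule has_derivative_transform_within_open[of _ _ _ _ "- closure {x. \<phi> x \<noteq> 0}"])
       (use assms(2) closure_subset[of "{x. \<phi> x \<noteq> 0}"] in auto)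
  then show ?thesis using frechet_derivative_eq by fastforce
qed

lemma test_function_bounded:
  assumes "test_function \<Omega> \<phi>" obtains C where "\<And>x. \<bar>\<phi> x\<bar> \<le> C"
proof -
  show thesis
    using test_function_continuous[OF assms] bounded_if_zero_off_compact[of \<phi> "closure {x. \<phi> x \<noteq> 0}"] that assms closure_subset[of "{x. \<phi> x \<noteq> 0}"]
    unfolding test_function_def by blast
qed

lemma test_function_derivative_bounded:
  assumes "test_function \<Omega> \<phi>" "b \<in> Basis"
  obtains C where "C \<ge> 0" "\<And>x. \<bar>frechet_derivative \<phi> (at x) b\<bar> \<le> C"
  using bounded_if_zero_off_compact[OF test_function_derivative_continuous[OF assms], of "closure {x. \<phi> x \<noteq> 0}"]
    test_function_derivative_zero[OF assms(1)] assms(1) unfolding test_function_def by blast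

lemma test_function_L2:
  assumes "test_function \<Omega> \<phi>" "\<Omega> \<in> lmeasurable" shows "\<phi> \<in> L2 \<Omega>"
proof -
  obtain C where "\<And>x. \<bar>\<phi> x\<bar> \<le> C" using test_function_bounded[OF assms(1)] by blast
  moreover note test_function_continuous[OF assms(1)]
  ultimately show ?thesis
    by (intro L2_bounded[OF assms(2)] borel_measurable_lebesgue_onI borel_measurable_continuous_onI)
qed

lemma test_function_derivative_L2:
  assumes "test_function \<Omega> \<phi>" "\<Omega> \<in> lmeasurable" "b \<in> Basis"
  shows "(\<lambda>x. frechet_derivative \<phi> (at x) b) \<in> L2 \<Omega>"
proof -
  obtain C where "\<And>x. \<bar>frechet_derivative \<phi> (at x) b\<bar> \<le> C"
    using test_function_derivative_bounded[OF assms(1,3)] by blast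
  then show ?thesis
    using test_function_derivative_continuous[OF assms(1,3)]
    by (intro L2_bounded[OF assms(2)] borel_measurable_lebesgue_onI borel_measurable_continuous_onI)
qed

text \<open>Difference quotients have integral 0 by translation invariance, and they converge to the
  derivative. The mean value theorem bounds them by a constant on a fixed ball.\<close>

lemma integral_directional_derivative_eq_0:
  fixes \<phi> :: "'a::euclidean_space \<Rightarrow> real"
  assumes \<phi>: "test_function \<Omega> \<phi>" and b: "b \<in> Basis"
  shows "(\<integral>x. frechet_derivative \<phi> (at x) b \<partial>lborel) = 0"
proof -
  let ?K = "closure {x. \<phi> x \<noteq> 0}"
  obtain C where C: "C \<ge> 0" "\<And>x. \<bar>frechet_derivative \<phi> (at x) b\<bar> \<le> C"
    using test_function_derivative_bounded[OF \<phi> b] by blast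
  note cont = test_function_continuous[OF \<phi>]
  have K: "compact ?K" using \<phi> by (simp add: test_function_def)
  obtain R where R: "\<And>x. x \<in> ?K \<Longrightarrow> norm x \<le> R"
    using compact_imp_bounded[OF K] by (auto simp: bounded_iff)
  \<comment> \<open>Increments of at most 1 keep all difference quotients supported in the ball of
    radius \<open>R + 1\<close>.\<close>
  define h where "h n = 1 / real (Suc n)" for n
  have h: "0 < h n" "h n \<le> 1" for n by (auto simp: h_def)
  define q where "q n x = (\<phi> (x + h n *\<^sub>R b) - \<phi> x) / h n" for n x
  have line: "((\<lambda>t. \<phi> (x + t *\<^sub>R b)) has_real_derivative frechet_derivative \<phi> (at (x + t *\<^sub>R b)) b) (at t)" for x t
  proof -
    have "((\<lambda>t. \<phi> (x + t *\<^sub>R b)) has_derivative (\<lambda>s. frechet_derivative \<phi> (at (x + t *\<^sub>R b)) (s *\<^sub>R b))) (at t)"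
      using test_function_differentiable[OF \<phi>, of "x + t *\<^sub>R b"]
      by (intro has_derivative_compose[where g = \<phi> and f = "\<lambda>t. x + t *\<^sub>R b"])
         (auto intro!: derivative_eq_intros simp: frechet_derivative_works)
    moreover have "frechet_derivative \<phi> (at (x + t *\<^sub>R b)) (s *\<^sub>R b) = s * frechet_derivative \<phi> (at (x + t *\<^sub>R b)) b" for s
      using linear_frechet_derivative[OF test_function_differentiable[OF \<phi>]] by (simp add: linear_scale)
    ultimately show ?thesis
      by (simp add: has_field_derivative_def mult.commute[of _ "frechet_derivative \<phi> _ b"] cong: if_cong)
  qed
  have \<phi>_int: "integrable lborel \<phi>"
  proof -
    have "integrable lborel (\<lambda>x. indicator ?K x *\<^sub>R \<phi> x)"
      using K cont by (intro borel_integrable_compact) (auto intro: continuous_on_subset)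
    moreover have "(\<lambda>x. indicator ?K x *\<^sub>R \<phi> x) = \<phi>"
      using closure_subset[of "{x. \<phi> x \<noteq> 0}"] by (auto simp: fun_eq_iff indicator_def)
    ultimately show ?thesis by simp
  qed
  have shift: "integrable lborel (\<lambda>x. \<phi> (x + v))" "(\<integral>x. \<phi> (x + v) \<partial>lborel) = (\<integral>x. \<phi> x \<partial>lborel)" for v
  proof -
    have m: "(\<lambda>x. v + x) \<in> lborel \<rightarrow>\<^sub>M lborel" by simp
    have e: "distr lborel lborel (\<lambda>x. v + x) = lborel"
      using lborel_distr_plus[of v] by (simp cong: distr_cong)
    have \<phi>m: "\<phi> \<in> borel_measurable lborel" using \<phi>_int by auto
    show "integrable lborel (\<lambda>x. \<phi> (x + v))"
      using integrable_distr_eq[OF m \<phi>m] \<phi>_int unfolding e by (simp add: add.commute)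
    show "(\<integral>x. \<phi> (x + v) \<partial>lborel) = (\<integral>x. \<phi> x \<partial>lborel)"
      using integral_distr[OF m \<phi>m] unfolding e by (simp add: add.commute)
  qed
  have "(\<lambda>n. \<integral>x. q n x \<partial>lborel) \<longlonglongrightarrow> (\<integral>x. frechet_derivative \<phi> (at x) b \<partial>lborel)"
  proof (rule integral_dominated_convergence[where w = "\<lambda>x. C * indicator (cball 0 (R + 1)) x"])
    show "(\<lambda>x. frechet_derivative \<phi> (at x) b) \<in> borel_measurable lborel"
      using borel_measurable_continuous_onI[OF test_function_derivative_continuous[OF \<phi> b]] by simp
    show "q n \<in> borel_measurable lborel" for n
      unfolding q_def using borel_measurable_integrable[OF shift(1)] borel_measurable_integrable[OF \<phi>_int]
      by simp
    show "integrable lborel (\<lambda>x. C * indicator (cball 0 (R + 1)) x)"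
      by (intro integrable_mult_right integrable_real_indicator emeasure_lborel_cball_finite) auto
    show "AE x in lborel. (\<lambda>n. q n x) \<longlonglongrightarrow> frechet_derivative \<phi> (at x) b"
    proof (rule AE_I2)
      fix x
      have "((\<lambda>t. (\<phi> (x + t *\<^sub>R b) - \<phi> x) / t) \<longlongrightarrow> frechet_derivative \<phi> (at x) b) (at 0)"
        using line[of x 0] by (simp add: has_field_derivative_iff)
      moreover have "filterlim h (at 0) sequentially"
        unfolding filterlim_at
      proof
        show "h \<longlonglongrightarrow> 0" using LIMSEQ_inverse_real_of_nat by (simp add: h_def[abs_def] inverse_eq_divide)
        show "\<forall>\<^sub>F n in sequentially. h n \<in> UNIV \<and> h n \<noteq> 0" using h(1) by (auto simp: less_imp_neq[symmetric])
      qed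
      ultimately show "(\<lambda>n. q n x) \<longlonglongrightarrow> frechet_derivative \<phi> (at x) b"
        unfolding q_def by (rule filterlim_compose)
    qed
    show "AE x in lborel. norm (q n x) \<le> C * indicator (cball 0 (R + 1)) x" for n
    proof (rule AE_I2)
      fix x
      obtain z where z: "\<phi> (x + h n *\<^sub>R b) - \<phi> (x + 0 *\<^sub>R b) = (h n - 0) * frechet_derivative \<phi> (at (x + z *\<^sub>R b)) b"
        using MVT2[OF h(1)[of n] line[of x]] by blast
      then have "norm (q n x) \<le> C"
        using C(2)[of "x + z *\<^sub>R b"] h(1)[of n] by (simp add: q_def)
      moreover have "q n x = 0" if "x \<notin> cball 0 (R + 1)"
      proof -
        have "norm (h n *\<^sub>R b) \<le> 1" using h[of n] b by simp
        then have "norm (x + h n *\<^sub>R b) > R" "norm x > R"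
          using that norm_triangle_ineq2[of x "- (h n *\<^sub>R b)"] by (auto simp: not_le)
        then have "x + h n *\<^sub>R b \<notin> ?K" "x \<notin> ?K" using R by (auto simp: not_le[symmetric])
        then have "\<phi> (x + h n *\<^sub>R b) = 0" "\<phi> x = 0"
          using closure_subset[of "{x. \<phi> x \<noteq> 0}"] by blast+
        then show ?thesis by (simp add: q_def)
      qed
      ultimately show "norm (q n x) \<le> C * indicator (cball 0 (R + 1)) x"
        by (auto split: split_indicator)
    qed
  qed
  moreover have "(\<integral>x. q n x \<partial>lborel) = 0" for n
    using shift \<phi>_int by (simp add: q_def)
  ultimately show ?thesis by (simp add: LIMSEQ_const_iff)
qed

lemma has_weak_gradient_iff:
  "has_weak_gradient \<Omega> f G \<longleftrightarrow> (\<forall>b\<in>Basis. (\<lambda>x. G x \<bullet> b) \<in> L2 \<Omega> \<and>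
    (\<forall>\<phi>. test_function \<Omega> \<phi> \<longrightarrow>
      L2_inner \<Omega> f (\<lambda>x. frechet_derivative \<phi> (at x) b) = - L2_inner \<Omega> (\<lambda>x. G x \<bullet> b) \<phi>))"
  by (simp add: has_weak_gradient_def L2_inner_def)

text \<open>Constants are represented by functions that may take any value off \<Omega>, where
  derivatives of test functions vanish. So the integral over \<Omega> is one over the whole
  space.\<close>

lemma has_weak_gradient_const:
  assumes \<Omega>: "\<Omega> \<in> lmeasurable" and v: "\<And>x. x \<in> \<Omega> \<Longrightarrow> v x = c"
  shows "has_weak_gradient \<Omega> v (\<lambda>x. 0)"
  unfolding has_weak_gradient_def
proof (intro ballI conjI allI impI)
  fix b :: 'a and \<phi> assume b: "b \<in> Basis" and \<phi>: "test_function \<Omega> \<phi>"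
  let ?d = "\<lambda>x. frechet_derivative \<phi> (at x) b"
  have \<Omega>': "\<Omega> \<in> sets lebesgue" using \<Omega> by auto
  have zero: "?d x = 0" if "x \<notin> \<Omega>" for x
    using test_function_derivative_zero[OF \<phi>] that \<phi> unfolding test_function_def by blast
  have "(\<integral>x. v x * ?d x \<partial>lebesgue_on \<Omega>) = (\<integral>x. c * ?d x \<partial>lebesgue_on \<Omega>)"
    by (intro Bochner_Integration.integral_cong) (auto simp: v)
  also have "\<dots> = (\<integral>x. indicator \<Omega> x * (c * ?d x) \<partial>lebesgue)"
    using \<Omega>' by (subst integral_restrict_space) auto
  also have "\<dots> = (\<integral>x. c * ?d x \<partial>lebesgue)"
    by (intro Bochner_Integration.integral_cong) (auto simp: zero split: split_indicator)
  also have "\<dots> = (\<integral>x. c * ?d x \<partial>lborel)"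
    using borel_measurable_continuous_onI[OF test_function_derivative_continuous[OF \<phi> b]]
    by (intro integral_completion) simp
  also have "\<dots> = 0"
    using integral_directional_derivative_eq_0[OF \<phi> b] by simp
  finally show "(\<integral>x. v x * ?d x \<partial>lebesgue_on \<Omega>) = - (\<integral>x. 0 \<bullet> b * \<phi> x \<partial>lebesgue_on \<Omega>)" by simp
qed (simp add: L2_zero)

lemma has_weak_gradient_add:
  assumes "\<Omega> \<in> lmeasurable" "f \<in> L2 \<Omega>" "g \<in> L2 \<Omega>" "has_weak_gradient \<Omega> f F" "has_weak_gradient \<Omega> g G"
  shows "has_weak_gradient \<Omega> (\<lambda>x. f x + g x) (\<lambda>x. F x + G x)"
  using assms unfolding has_weak_gradient_iff
  by (auto simp: inner_add_left L2_add L2_inner_add_left test_function_L2 test_function_derivative_L2)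

lemma has_weak_gradient_cmult:
  assumes "has_weak_gradient \<Omega> f F"
  shows "has_weak_gradient \<Omega> (\<lambda>x. c * f x) (\<lambda>x. c *\<^sub>R F x)"
  using assms unfolding has_weak_gradient_iff by (auto simp: L2_cmult L2_inner_cmult_left)

text \<open>Frees later computations from the particular choice made by
  \<open>weak_gradient\<close>. It is the fundamental lemma applied to the difference in each
  coordinate.\<close>

lemma has_weak_gradient_unique:
  assumes \<Omega>: "open \<Omega>" "\<Omega> \<in> lmeasurable" and "has_weak_gradient \<Omega> f F" "has_weak_gradient \<Omega> f G"
  shows "AE x in lebesgue_on \<Omega>. F x = G x"
proof -
  have "AE x in lebesgue_on \<Omega>. F x \<bullet> b - G x \<bullet> b = 0" if b: "b \<in> Basis" for b
  proof (rule test_integrals_zero_imp_AE_zero[OF _ \<Omega>(1)])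
    have L: "(\<lambda>x. F x \<bullet> b) \<in> L2 \<Omega>" "(\<lambda>x. G x \<bullet> b) \<in> L2 \<Omega>"
      using assms b by (auto simp: has_weak_gradient_iff)
    then show "integrable (lebesgue_on \<Omega>) (\<lambda>x. F x \<bullet> b - G x \<bullet> b)"
      by (intro L2_integrable \<Omega> L2_diff)
    fix \<phi> assume \<phi>: "test_function \<Omega> \<phi>"
    have "L2_inner \<Omega> (\<lambda>x. F x \<bullet> b - G x \<bullet> b) \<phi> = 0"
      using assms(3,4) b \<phi> L test_function_L2[OF \<phi> \<Omega>(2)]
      by (simp add: L2_inner_diff_left has_weak_gradient_iff)
    then show "(\<integral>x. (F x \<bullet> b - G x \<bullet> b) * \<phi> x \<partial>lebesgue_on \<Omega>) = 0"
      by (simp add: L2_inner_def)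
  qed
  then have "AE x in lebesgue_on \<Omega>. \<forall>b\<in>Basis. F x \<bullet> b - G x \<bullet> b = 0"
    by (subst AE_ball_countable[OF countable_finite[OF finite_Basis]]) blast
  then show ?thesis
  proof eventually_elim
    case (elim x)
    show ?case by (rule euclidean_eqI) (use elim in auto)
  qed
qed

lemma weak_gradient_works: "f \<in> H1 \<Omega> \<Longrightarrow> has_weak_gradient \<Omega> f (weak_gradient \<Omega> f)"
  unfolding H1_def weak_gradient_def using someI[of "has_weak_gradient \<Omega> f"] by blast

lemma H1_L2: "f \<in> H1 \<Omega> \<Longrightarrow> f \<in> L2 \<Omega>"
  by (simp add: H1_def)

lemma H1I: "f \<in> L2 \<Omega> \<Longrightarrow> has_weak_gradient \<Omega> f F \<Longrightarrow> f \<in> H1 \<Omega>"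
  by (auto simp: H1_def)

lemma H1_add: "\<Omega> \<in> lmeasurable \<Longrightarrow> f \<in> H1 \<Omega> \<Longrightarrow> g \<in> H1 \<Omega> \<Longrightarrow> (\<lambda>x. f x + g x) \<in> H1 \<Omega>"
  by (rule H1I[OF L2_add has_weak_gradient_add]) (auto intro: H1_L2 weak_gradient_works)

lemma H1_cmult: "f \<in> H1 \<Omega> \<Longrightarrow> (\<lambda>x. c * f x) \<in> H1 \<Omega>"
  by (rule H1I[OF L2_cmult has_weak_gradient_cmult]) (auto intro: H1_L2 weak_gradient_works)

section \<open>The H1 inner product\<close>

definition H1_inner :: "'a::euclidean_space set \<Rightarrow> ('a \<Rightarrow> real) \<Rightarrow> ('a \<Rightarrow> real) \<Rightarrow> real" where
  "H1_inner \<Omega> f g = (\<integral>x. weak_gradient \<Omega> f x \<bullet> weak_gradient \<Omega> g x + f x * g x \<partial>lebesgue_on \<Omega>)"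

text \<open>The chosen gradient of a sum need not be the sum of the chosen gradients. Since any weak
  gradients may be inserted here, bilinearity follows by inserting the convenient ones.\<close>

lemma H1_inner_eq:
  assumes "f \<in> H1 \<Omega>" "g \<in> H1 \<Omega>"
    and F: "has_weak_gradient \<Omega> f F" and G: "has_weak_gradient \<Omega> g G" and \<Omega>: "open \<Omega>" "\<Omega> \<in> lmeasurable"
  shows "H1_inner \<Omega> f g = (\<Sum>b\<in>Basis. L2_inner \<Omega> (\<lambda>x. F x \<bullet> b) (\<lambda>x. G x \<bullet> b)) + L2_inner \<Omega> f g"
proof -
  let ?F = "weak_gradient \<Omega> f" and ?G = "weak_gradient \<Omega> g"
  have L: "(\<lambda>x. ?F x \<bullet> b) \<in> L2 \<Omega>" "(\<lambda>x. ?G x \<bullet> b) \<in> L2 \<Omega>"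
    "(\<lambda>x. F x \<bullet> b) \<in> L2 \<Omega>" "(\<lambda>x. G x \<bullet> b) \<in> L2 \<Omega>" if "b \<in> Basis" for b
    using weak_gradient_works[OF assms(1)] weak_gradient_works[OF assms(2)] F G that
    by (auto simp: has_weak_gradient_def)
  have "H1_inner \<Omega> f g = (\<integral>x. (\<Sum>b\<in>Basis. (?F x \<bullet> b) * (?G x \<bullet> b)) + f x * g x \<partial>lebesgue_on \<Omega>)"
    unfolding H1_inner_def by (subst euclidean_inner) simp
  also have "\<dots> = (\<Sum>b\<in>Basis. L2_inner \<Omega> (\<lambda>x. ?F x \<bullet> b) (\<lambda>x. ?G x \<bullet> b)) + L2_inner \<Omega> f g"
    unfolding L2_inner_def using L assms(1,2)
    by (subst Bochner_Integration.integral_add)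
       (auto intro!: Bochner_Integration.integrable_sum L2_mult_integrable H1_L2 simp: Bochner_Integration.integral_sum L2_mult_integrable)
  also have "(\<Sum>b\<in>Basis. L2_inner \<Omega> (\<lambda>x. ?F x \<bullet> b) (\<lambda>x. ?G x \<bullet> b)) = (\<Sum>b\<in>Basis. L2_inner \<Omega> (\<lambda>x. F x \<bullet> b) (\<lambda>x. G x \<bullet> b))"
  proof (intro sum.cong refl L2_inner_cong_AE L)
    show "AE x in lebesgue_on \<Omega>. ?F x \<bullet> b = F x \<bullet> b" for b
      using has_weak_gradient_unique[OF \<Omega> weak_gradient_works[OF assms(1)] F] by eventually_elim simp
    show "AE x in lebesgue_on \<Omega>. ?G x \<bullet> b = G x \<bullet> b" for b
      using has_weak_gradient_unique[OF \<Omega> weak_gradient_works[OF assms(2)] G] by eventually_elim simp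
  qed
  finally show ?thesis .
qed

lemma H1_inner_commute: "H1_inner \<Omega> f g = H1_inner \<Omega> g f"
  by (simp add: H1_inner_def inner_commute mult.commute)

lemma H1_inner_add_left:
  assumes \<Omega>: "open \<Omega>" "\<Omega> \<in> lmeasurable" and "f \<in> H1 \<Omega>" "g \<in> H1 \<Omega>" "h \<in> H1 \<Omega>"
  shows "H1_inner \<Omega> (\<lambda>x. f x + g x) h = H1_inner \<Omega> f h + H1_inner \<Omega> g h"
proof -
  note F = weak_gradient_works[OF assms(3)] and G = weak_gradient_works[OF assms(4)] and H = weak_gradient_works[OF assms(5)]
  note FG = has_weak_gradient_add[OF \<Omega>(2) H1_L2[OF assms(3)] H1_L2[OF assms(4)] F G]
  have L: "(\<lambda>x. weak_gradient \<Omega> f x \<bullet> b) \<in> L2 \<Omega>" "(\<lambda>x. weak_gradient \<Omega> g x \<bullet> b) \<in> L2 \<Omega>"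
    "(\<lambda>x. weak_gradient \<Omega> h x \<bullet> b) \<in> L2 \<Omega>" if "b \<in> Basis" for b
    using F G H that by (auto simp: has_weak_gradient_def)
  show ?thesis
    unfolding H1_inner_eq[OF H1_add[OF \<Omega>(2) assms(3,4)] assms(5) FG H \<Omega>]
      H1_inner_eq[OF assms(3,5) F H \<Omega>] H1_inner_eq[OF assms(4,5) G H \<Omega>]
    using L assms H1_L2 by (simp add: inner_add_left L2_inner_add_left sum.distrib H1_L2)
qed

lemma H1_inner_cmult_left:
  assumes \<Omega>: "open \<Omega>" "\<Omega> \<in> lmeasurable" and "f \<in> H1 \<Omega>" "h \<in> H1 \<Omega>"
  shows "H1_inner \<Omega> (\<lambda>x. c * f x) h = c * H1_inner \<Omega> f h"
  unfolding H1_inner_eq[OF H1_cmult[OF assms(3)] assms(4) has_weak_gradient_cmult[OF weak_gradient_works[OF assms(3)]]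
      weak_gradient_works[OF assms(4)] \<Omega>]
    H1_inner_eq[OF assms(3,4) weak_gradient_works[OF assms(3)] weak_gradient_works[OF assms(4)] \<Omega>]
  by (simp add: L2_inner_cmult_left sum_distrib_left distrib_left)

lemma H1_inner_ge_L2_inner:
  assumes \<Omega>: "open \<Omega>" "\<Omega> \<in> lmeasurable" and "f \<in> H1 \<Omega>"
  shows "L2_inner \<Omega> f f \<le> H1_inner \<Omega> f f"
  unfolding H1_inner_eq[OF assms(3,3) weak_gradient_works[OF assms(3)] weak_gradient_works[OF assms(3)] \<Omega>]
  by (simp add: sum_nonneg L2_inner_nonneg)

lemma H1_inner_const:
  assumes \<Omega>: "open \<Omega>" "\<Omega> \<in> lmeasurable" and "f \<in> H1 \<Omega>" "v \<in> H1 \<Omega>" "\<And>x. x \<in> \<Omega> \<Longrightarrow> v x = c"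
  shows "H1_inner \<Omega> f v = L2_inner \<Omega> f v"
proof -
  have "has_weak_gradient \<Omega> v (\<lambda>x. 0)"
    by (rule has_weak_gradient_const[OF \<Omega>(2)]) (rule assms(5))
  from H1_inner_eq[OF assms(3,4) weak_gradient_works[OF assms(3)] this \<Omega>] show ?thesis
    by (simp add: L2_inner_def)
qed

section \<open>Galerkin approximation\<close>

definition fun_span :: "('a \<Rightarrow> real) set \<Rightarrow> ('a \<Rightarrow> real) set" where
  "fun_span B = {\<lambda>x. \<Sum>f\<in>B. c f * f x | c. True}"

lemma finite_dimensional_subspace_iff:
  "finite_dimensional_subspace V \<longleftrightarrow> (\<exists>B. finite B \<and> V = fun_span B)"
  by (simp add: finite_dimensional_subspace_def fun_span_def)

lemma fun_span_add:
  assumes "v \<in> fun_span B" "w \<in> fun_span B" shows "(\<lambda>x. v x + w x) \<in> fun_span B"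
proof -
  obtain c d where "v = (\<lambda>x. \<Sum>f\<in>B. c f * f x)" "w = (\<lambda>x. \<Sum>f\<in>B. d f * f x)"
    using assms by (auto simp: fun_span_def)
  then have "(\<lambda>x. v x + w x) = (\<lambda>x. \<Sum>f\<in>B. (c f + d f) * f x)"
    by (simp add: sum.distrib distrib_right)
  then show ?thesis by (auto simp: fun_span_def)
qed

lemma fun_span_cmult:
  assumes "v \<in> fun_span B" shows "(\<lambda>x. a * v x) \<in> fun_span B"
proof -
  obtain c where "v = (\<lambda>x. \<Sum>f\<in>B. c f * f x)"
    using assms by (auto simp: fun_span_def)
  then have "(\<lambda>x. a * v x) = (\<lambda>x. \<Sum>f\<in>B. (a * c f) * f x)"
    by (simp add: sum_distrib_left mult.assoc)
  then show ?thesis by (auto simp: fun_span_def)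
qed

lemma fun_span_zero: "(\<lambda>x. 0) \<in> fun_span B"
  by (auto simp: fun_span_def intro!: exI[of _ "\<lambda>_. 0"])

lemma fun_span_sum: "(\<And>i. i \<in> I \<Longrightarrow> f i \<in> fun_span B) \<Longrightarrow> (\<lambda>x. \<Sum>i\<in>I. f i x) \<in> fun_span B"
  by (induction I rule: infinite_finite_induct) (auto intro: fun_span_zero fun_span_add)

lemma fun_span_base: "finite B \<Longrightarrow> b \<in> B \<Longrightarrow> b \<in> fun_span B"
  by (auto simp: fun_span_def if_distrib[of "\<lambda>c. c * _"] cong: if_cong intro!: exI[of _ "\<lambda>f. if f = b then 1 else 0"])

lemma fun_span_induct:
  assumes "finite B" "v \<in> fun_span B"
    and "P (\<lambda>x. 0)" "\<And>b. b \<in> B \<Longrightarrow> P b" "\<And>v w. P v \<Longrightarrow> P w \<Longrightarrow> P (\<lambda>x. v x + w x)" "\<And>a v. P v \<Longrightarrow> P (\<lambda>x. a * v x)"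
  shows "P v"
proof -
  obtain c where v: "v = (\<lambda>x. \<Sum>f\<in>B. c f * f x)" using assms by (auto simp: fun_span_def)
  have "P (\<lambda>x. \<Sum>f\<in>A. c f * f x)" if "A \<subseteq> B" for A
    using finite_subset[OF that assms(1)] that
  proof (induction A rule: finite_induct)
    case (insert f A)
    then have "P (\<lambda>x. c f * f x + (\<Sum>f\<in>A. c f * f x))"
      by (intro assms(5)[OF assms(6)[OF assms(4)]]) auto
    then show ?case using insert by simp
  qed (use assms(3) in simp)
  then show ?thesis using v by blast
qed

lemma fun_span_mono: "finite B \<Longrightarrow> A \<subseteq> B \<Longrightarrow> fun_span A \<subseteq> fun_span B"
proof
  fix v assume "finite B" "A \<subseteq> B" "v \<in> fun_span A"
  then show "v \<in> fun_span B"
    by (intro fun_span_induct[of A v "\<lambda>v. v \<in> fun_span B"])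
       (auto intro: finite_subset fun_span_zero fun_span_add fun_span_cmult fun_span_base)
qed

text \<open>
  Gram-Schmidt, skipping the directions on which the form degenerates.
\<close>

lemma represent_functional_on_fun_span:
  fixes a :: "('a \<Rightarrow> real) \<Rightarrow> ('a \<Rightarrow> real) \<Rightarrow> real"
  assumes H_add: "\<And>f g. f \<in> H \<Longrightarrow> g \<in> H \<Longrightarrow> (\<lambda>x. f x + g x) \<in> H"
    and H_cmult: "\<And>f c. f \<in> H \<Longrightarrow> (\<lambda>x. c * f x) \<in> H"
    and H_zero: "(\<lambda>x. 0) \<in> H"
    and a_add: "\<And>f g h. f \<in> H \<Longrightarrow> g \<in> H \<Longrightarrow> h \<in> H \<Longrightarrow> a (\<lambda>x. f x + g x) h = a f h + a g h"
    and a_cmult: "\<And>f h c. f \<in> H \<Longrightarrow> h \<in> H \<Longrightarrow> a (\<lambda>x. c * f x) h = c * a f h"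
    and a_sym: "\<And>f g. a f g = a g f"
    and a_null: "\<And>f g. f \<in> H \<Longrightarrow> g \<in> H \<Longrightarrow> a f f = 0 \<Longrightarrow> a f g = 0"
    and B: "finite B" "B \<subseteq> H"
    and l_add: "\<And>f g. f \<in> H \<Longrightarrow> g \<in> H \<Longrightarrow> l (\<lambda>x. f x + g x) = l f + l g"
    and l_cmult: "\<And>f c. f \<in> H \<Longrightarrow> l (\<lambda>x. c * f x) = c * l f"
    and l_null: "\<And>f. f \<in> H \<Longrightarrow> a f f = 0 \<Longrightarrow> l f = 0"
  shows "\<exists>y\<in>fun_span B. \<forall>v\<in>fun_span B. a y v = l v"
proof -
  have span_H: "fun_span A \<subseteq> H" if "finite A" "A \<subseteq> H" for A
  proof
    fix v assume "v \<in> fun_span A"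
    with that show "v \<in> H"
      by (intro fun_span_induct[of A v "\<lambda>v. v \<in> H"]) (auto intro: H_add H_cmult H_zero)
  qed
  have ext: "\<forall>v\<in>fun_span A. a y v = l v"
    if A: "finite A" "A \<subseteq> H" and y: "y \<in> H" and eq: "\<And>b. b \<in> A \<Longrightarrow> a y b = l b"
      and l: "\<And>f g. f \<in> H \<Longrightarrow> g \<in> H \<Longrightarrow> l (\<lambda>x. f x + g x) = l f + l g"
        "\<And>f c. f \<in> H \<Longrightarrow> l (\<lambda>x. c * f x) = c * l f" for A y and l :: "('a \<Rightarrow> real) \<Rightarrow> real"
  proof
    fix v assume v: "v \<in> fun_span A"
    have "v \<in> H \<and> a y v = l v"
    proof (rule fun_span_induct[OF A(1) v])
      show "(\<lambda>x. 0) \<in> H \<and> a y (\<lambda>x. 0) = l (\<lambda>x. 0)"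
        using H_zero a_cmult[OF H_zero y, of 0] l(2)[OF H_zero, of 0] by (simp add: a_sym[of y])
      show "(\<lambda>x. v x + w x) \<in> H \<and> a y (\<lambda>x. v x + w x) = l (\<lambda>x. v x + w x)"
        if "v \<in> H \<and> a y v = l v" "w \<in> H \<and> a y w = l w" for v w
        using that l(1)[of v w] a_add[of v w y] H_add y by (simp add: a_sym[of y])
      show "(\<lambda>x. c * v x) \<in> H \<and> a y (\<lambda>x. c * v x) = l (\<lambda>x. c * v x)"
        if "v \<in> H \<and> a y v = l v" for c v
        using that l(2)[of v c] a_cmult[of v y c] H_cmult y by (simp add: a_sym[of y])
    qed (use A eq in auto)
    then show "a y v = l v" ..
  qed
  from B l_add l_cmult l_null show ?thesis
  proof (induction B arbitrary: l rule: finite_induct)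
    case empty
    have "a (\<lambda>x. 0) v = l v" if "v \<in> fun_span {}" for v
      using ext[of "{}" "\<lambda>x. 0" l] empty H_zero that by auto
    then show ?case using fun_span_zero by blast
  next
    case (insert b A)
    have AH: "A \<subseteq> H" "b \<in> H" using insert.prems(1) by auto
    obtain y0 where y0: "y0 \<in> fun_span A" "\<forall>v\<in>fun_span A. a y0 v = l v"
      using insert.IH[of l, OF AH(1) insert.prems(2-4)] by blast
    \<comment> \<open>The induction hypothesis for the functional \<open>a b\<close> yields the
      orthogonal projection of \<open>b\<close> onto the span of \<open>A\<close>; this is why the
      functional is arbitrary in the induction.\<close>
    have "\<exists>q\<in>fun_span A. \<forall>v\<in>fun_span A. a q v = a b v"
    proof (rule insert.IH[of "a b", OF AH(1)])
      show "a b (\<lambda>x. f x + g x) = a b f + a b g" if "f \<in> H" "g \<in> H" for f g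
        unfolding a_sym[of b] by (rule a_add[OF that AH(2)])
      show "a b (\<lambda>x. c * f x) = c * a b f" if "f \<in> H" for f c
        unfolding a_sym[of b] by (rule a_cmult[OF that AH(2)])
      show "a b f = 0" if "f \<in> H" "a f f = 0" for f
        unfolding a_sym[of b] by (rule a_null[OF that(1) AH(2) that(2)])
    qed
    then obtain q where q: "q \<in> fun_span A" "\<forall>v\<in>fun_span A. a q v = a b v" by blast
    define e where "e x = b x + -1 * q x" for x
    have H: "y0 \<in> H" "q \<in> H" using y0 q span_H[OF \<open>finite A\<close> AH(1)] by auto
    have eH: "e \<in> H" unfolding e_def[abs_def] using H AH by (intro H_add H_cmult)
    have b_eq: "b = (\<lambda>x. e x + q x)" by (simp add: e_def[abs_def])
    have e_orth: "a e v = 0" if "v \<in> fun_span A" for v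
    proof -
      have v: "v \<in> H" using that span_H[OF \<open>finite A\<close> AH(1)] by auto
      have "a e v = a b v + -1 * a q v"
        unfolding e_def[abs_def] using a_add[OF AH(2) H_cmult[OF H(2)] v] a_cmult[OF H(2) v] by metis
      then show ?thesis using q that by simp
    qed
    \<comment> \<open>If \<open>e\<close> has norm 0, both \<open>l e\<close> and
      \<open>a y0 e\<close> vanish and every \<open>t\<close> is correct. Otherwise \<open>t\<close>
      solves \<open>a y e = l e\<close>.\<close>
    define t where "t = (if a e e = 0 then 0 else (l e - a y0 e) / a e e)"
    define y where "y x = y0 x + t * e x" for x
    have yH: "y \<in> H" unfolding y_def[abs_def] using H eH by (intro H_add H_cmult)
    have ay: "a y v = a y0 v + t * a e v" if "v \<in> H" for v
      unfolding y_def[abs_def] using a_add[OF H(1) H_cmult[OF eH] that] a_cmult[OF eH that] by metis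
    have "a y e = l e"
    proof (cases "a e e = 0")
      case True
      then show ?thesis
        using ay[OF eH] a_null[OF eH H(1)] insert.prems(4)[OF eH] by (simp add: t_def a_sym[of y0])
    next
      case False
      then show ?thesis using ay[OF eH] by (simp add: t_def)
    qed
    moreover have ayA: "a y v = l v" if "v \<in> fun_span A" for v
      using ay[of v] e_orth[OF that] y0(2) that span_H[OF \<open>finite A\<close> AH(1)] by auto
    ultimately have "a y b = l b"
      using a_add[OF eH H(2) yH] insert.prems(2)[OF eH H(2)] ayA[OF q(1)]
      unfolding b_eq[symmetric] by (simp add: a_sym[of y])
    then have "\<forall>v\<in>fun_span (insert b A). a y v = l v"
      using ayA fun_span_base[OF \<open>finite A\<close>] insert.prems(1-3) \<open>finite A\<close> yH
      by (intro ext) auto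
    moreover have "y \<in> fun_span (insert b A)"
    proof -
      have "fun_span A \<subseteq> fun_span (insert b A)" using \<open>finite A\<close> by (intro fun_span_mono) auto
      then have "y0 \<in> fun_span (insert b A)" "q \<in> fun_span (insert b A)" "b \<in> fun_span (insert b A)"
        using y0(1) q(1) \<open>finite A\<close> by (auto intro: fun_span_base)
      then show ?thesis
        unfolding y_def[abs_def] e_def[abs_def] by (intro fun_span_add fun_span_cmult)
    qed
    ultimately show ?case by blast
  qed
qed

section \<open>The discrete state\<close>

locale galerkin =
  fixes \<Omega> :: "'a::euclidean_space set" and V :: "('a \<Rightarrow> real) set"
  assumes open_\<Omega>: "open \<Omega>" and lmeasurable_\<Omega>: "\<Omega> \<in> lmeasurable"
    and V_H1: "V \<subseteq> H1 \<Omega>" and fin_V: "finite_dimensional_subspace V"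
begin

abbreviation state :: "('a \<Rightarrow> real) \<Rightarrow> 'a \<Rightarrow> real" where
  "state \<equiv> discrete_state \<Omega> V"

lemma V_L2: "v \<in> V \<Longrightarrow> v \<in> L2 \<Omega>"
  using V_H1 H1_L2 by blast

lemma V_sum: "(\<And>i. i \<in> I \<Longrightarrow> f i \<in> V) \<Longrightarrow> (\<lambda>x. \<Sum>i\<in>I. c i * f i x) \<in> V"
  using fin_V by (auto simp: finite_dimensional_subspace_iff intro!: fun_span_sum fun_span_cmult)

lemma H1_null: "f \<in> H1 \<Omega> \<Longrightarrow> H1_inner \<Omega> f f = 0 \<Longrightarrow> L2_inner \<Omega> f f = 0"
  using H1_inner_ge_L2_inner[OF open_\<Omega> lmeasurable_\<Omega>, of f] L2_inner_nonneg[of \<Omega> f] by simp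

lemma H1_inner_null:
  assumes "f \<in> H1 \<Omega>" "g \<in> H1 \<Omega>" "H1_inner \<Omega> f f = 0" shows "H1_inner \<Omega> f g = 0"
proof (rule ccontr)
  assume n: "H1_inner \<Omega> f g \<noteq> 0"
  note O = open_\<Omega> lmeasurable_\<Omega>
  \<comment> \<open>As \<open>f\<close> has norm 0, the squared norm of \<open>t * f + g\<close> is
    affine in \<open>t\<close>; this \<open>t\<close> gives the impossible value -1.\<close>
  define t where "t = - (H1_inner \<Omega> g g + 1) / (2 * H1_inner \<Omega> f g)"
  have tf: "(\<lambda>x. t * f x) \<in> H1 \<Omega>" by (rule H1_cmult[OF assms(1)])
  have s: "(\<lambda>x. t * f x + g x) \<in> H1 \<Omega>" by (rule H1_add[OF O(2) tf assms(2)])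
  have sh: "H1_inner \<Omega> (\<lambda>x. t * f x + g x) h = t * H1_inner \<Omega> f h + H1_inner \<Omega> g h" if "h \<in> H1 \<Omega>" for h
    using H1_inner_add_left[OF O tf assms(2) that] H1_inner_cmult_left[OF O assms(1) that] by simp
  have "H1_inner \<Omega> (\<lambda>x. t * f x + g x) (\<lambda>x. t * f x + g x)
      = t * H1_inner \<Omega> (\<lambda>x. t * f x + g x) f + H1_inner \<Omega> (\<lambda>x. t * f x + g x) g"
    by (subst sh[OF s]) (simp only: H1_inner_commute[of \<Omega> _ "\<lambda>x. t * f x + g x"])
  also have "\<dots> = 2 * t * H1_inner \<Omega> f g + H1_inner \<Omega> g g"
    unfolding sh[OF assms(1)] sh[OF assms(2)] using assms(3) H1_inner_commute[of \<Omega> g f] by simp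
  also have "\<dots> = -1" using n by (simp add: t_def field_simps)
  finally show False
    using H1_inner_ge_L2_inner[OF O s] L2_inner_nonneg[of \<Omega> "\<lambda>x. t * f x + g x"] by simp
qed

text \<open>Supplies the witness for the choice in \<open>discrete_state\<close>. The H1 form
  dominates the L2 form, so the right-hand side vanishes on functions of H1 norm 0, as the
  representation lemma demands.\<close>

lemma state_works:
  assumes u: "u \<in> L2 \<Omega>"
  shows "state u \<in> V" "v \<in> V \<Longrightarrow> H1_inner \<Omega> (state u) v = L2_inner \<Omega> u v"
proof -
  note O = open_\<Omega> lmeasurable_\<Omega>
  obtain B where B: "finite B" "V = fun_span B"
    using fin_V by (auto simp: finite_dimensional_subspace_iff)
  have "\<exists>y\<in>fun_span B. \<forall>v\<in>fun_span B. H1_inner \<Omega> y v = L2_inner \<Omega> u v"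
  proof (rule represent_functional_on_fun_span[where H = "H1 \<Omega>"])
    show "B \<subseteq> H1 \<Omega>" using B V_H1 fun_span_base by blast
    show "(\<lambda>x. 0) \<in> H1 \<Omega>" using B V_H1 fun_span_zero by blast
    show "L2_inner \<Omega> u f = 0" if "f \<in> H1 \<Omega>" "H1_inner \<Omega> f f = 0" for f
      using L2_inner_Cauchy_Schwarz[OF u H1_L2[OF that(1)]] H1_null[OF that] by simp
  qed (auto intro: B H1_add[OF O(2)] H1_cmult H1_inner_add_left[OF O] H1_inner_cmult_left[OF O]
      H1_inner_commute H1_inner_null simp: L2_inner_add_right L2_inner_cmult_right u H1_L2)
  then have "\<exists>y. y \<in> V \<and> (\<forall>v\<in>V. H1_inner \<Omega> y v = L2_inner \<Omega> u v)"
    using B by blast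
  from someI_ex[OF this] have "state u \<in> V \<and> (\<forall>v\<in>V. H1_inner \<Omega> (state u) v = L2_inner \<Omega> u v)"
    unfolding discrete_state_def H1_inner_def L2_inner_def .
  then show "state u \<in> V" "v \<in> V \<Longrightarrow> H1_inner \<Omega> (state u) v = L2_inner \<Omega> u v" by auto
qed

lemma state_unique:
  assumes u: "u \<in> L2 \<Omega>" and y: "y \<in> V" "\<And>v. v \<in> V \<Longrightarrow> H1_inner \<Omega> y v = L2_inner \<Omega> u v"
  shows "AE x in lebesgue_on \<Omega>. state u x = y x"
proof -
  note O = open_\<Omega> lmeasurable_\<Omega>
  let ?d = "\<lambda>x. state u x + -1 * y x"
  have sH: "state u \<in> H1 \<Omega>" and yH: "y \<in> H1 \<Omega>"
    using state_works(1)[OF u] y(1) V_H1 by auto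
  have my: "(\<lambda>x. -1 * y x) \<in> H1 \<Omega>" by (rule H1_cmult[OF yH])
  have dV: "?d \<in> V"
    using fin_V state_works(1)[OF u] y(1)
    by (auto simp only: finite_dimensional_subspace_iff intro!: fun_span_add fun_span_cmult)
  then have dH: "?d \<in> H1 \<Omega>" using V_H1 by blast
  have "H1_inner \<Omega> ?d ?d = 0"
    unfolding H1_inner_add_left[OF O sH my dH] H1_inner_cmult_left[OF O yH dH]
    using state_works(2)[OF u dV] y(2)[OF dV] by simp
  then have "L2_inner \<Omega> ?d ?d = 0" by (rule H1_null[OF dH])
  then have "AE x in lebesgue_on \<Omega>. ?d x = 0"
    using L2_inner_eq_0_iff[OF H1_L2[OF dH]] by blast
  then show ?thesis by eventually_elim simp
qed

lemma state_L2: "u \<in> L2 \<Omega> \<Longrightarrow> state u \<in> L2 \<Omega>"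
  using state_works(1) V_L2 by blast

text \<open>Each state is a separate choice, so linearity is available only almost everywhere: the
  combination of states solves the equation of the combined control.\<close>

lemma state_sum:
  assumes I: "finite I" and u: "\<And>i. i \<in> I \<Longrightarrow> u i \<in> L2 \<Omega>"
  shows "AE x in lebesgue_on \<Omega>. state (\<lambda>x. \<Sum>i\<in>I. c i * u i x) x = (\<Sum>i\<in>I. c i * state (u i) x)"
proof (rule state_unique)
  note O = open_\<Omega> lmeasurable_\<Omega>
  show "(\<lambda>x. \<Sum>i\<in>I. c i * u i x) \<in> L2 \<Omega>" by (intro L2_sum L2_cmult u)
  show "(\<lambda>x. \<Sum>i\<in>I. c i * state (u i) x) \<in> V" by (rule V_sum) (rule state_works(1)[OF u])
  fix v assume v: "v \<in> V"
  then have vH: "v \<in> H1 \<Omega>" using V_H1 by blast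
  have sH: "state (u i) \<in> H1 \<Omega>" if "i \<in> I" for i using state_works(1)[OF u[OF that]] V_H1 by blast
  have "(\<lambda>x. \<Sum>i\<in>J. c i * state (u i) x) \<in> H1 \<Omega> \<and>
      H1_inner \<Omega> (\<lambda>x. \<Sum>i\<in>J. c i * state (u i) x) v = (\<Sum>i\<in>J. c i * L2_inner \<Omega> (u i) v)"
    if "J \<subseteq> I" for J
    using finite_subset[OF that I] that
  proof (induction J rule: finite_induct)
    case empty
    have "(\<lambda>x. 0) \<in> H1 \<Omega>" using H1_cmult[OF vH, of 0] by simp
    then show ?case using H1_inner_cmult_left[OF O vH vH, of 0] by simp
  next
    case (insert i J)
    then have i: "i \<in> I" by auto
    from insert have IH: "(\<lambda>x. \<Sum>i\<in>J. c i * state (u i) x) \<in> H1 \<Omega>"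
      "H1_inner \<Omega> (\<lambda>x. \<Sum>i\<in>J. c i * state (u i) x) v = (\<Sum>i\<in>J. c i * L2_inner \<Omega> (u i) v)" by auto
    have ci: "(\<lambda>x. c i * state (u i) x) \<in> H1 \<Omega>" by (rule H1_cmult[OF sH[OF i]])
    show ?case
      using insert.hyps H1_add[OF O(2) ci IH(1)] H1_inner_add_left[OF O ci IH(1) vH]
        H1_inner_cmult_left[OF O sH[OF i] vH] state_works(2)[OF u[OF i] v] IH(2)
      by simp
  qed
  moreover have "L2_inner \<Omega> (\<lambda>x. \<Sum>i\<in>I. c i * u i x) v = (\<Sum>i\<in>I. c i * L2_inner \<Omega> (u i) v)"
    using u V_L2[OF v] by (simp add: L2_inner_sum_left L2_cmult L2_inner_cmult_left)
  ultimately show "H1_inner \<Omega> (\<lambda>x. \<Sum>i\<in>I. c i * state (u i) x) v = L2_inner \<Omega> (\<lambda>x. \<Sum>i\<in>I. c i * u i x) v"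
    by simp
qed

text \<open>Testing the equation with the state itself bounds its squared norm by its product with
  \<open>u\<close>; Cauchy-Schwarz then cancels one factor.\<close>

lemma state_norm_le:
  assumes u: "u \<in> L2 \<Omega>"
  shows "L2_inner \<Omega> (state u) (state u) \<le> L2_inner \<Omega> u u"
proof -
  let ?y = "L2_inner \<Omega> (state u) (state u)"
  have "?y \<le> H1_inner \<Omega> (state u) (state u)"
    using state_works(1)[OF u] V_H1 by (intro H1_inner_ge_L2_inner open_\<Omega> lmeasurable_\<Omega>) auto
  also have "\<dots> = L2_inner \<Omega> u (state u)" by (rule state_works(2)[OF u state_works(1)[OF u]])
  finally have "?y\<^sup>2 \<le> (L2_inner \<Omega> u (state u))\<^sup>2"
    using L2_inner_nonneg by (intro power_mono)
  also have "\<dots> \<le> L2_inner \<Omega> u u * ?y" by (rule L2_inner_Cauchy_Schwarz[OF u state_L2[OF u]])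
  finally have "?y * ?y \<le> L2_inner \<Omega> u u * ?y" by (simp add: power2_eq_square)
  then show ?thesis
    using L2_inner_nonneg[of \<Omega> "state u"] L2_inner_nonneg[of \<Omega> u] by (cases "?y = 0") auto
qed

end

locale galerkin_consts = galerkin +
  assumes const_V: "\<exists>v\<in>V. \<forall>x\<in>\<Omega>. v x = c"
begin

lemma state_integral:
  assumes u: "u \<in> L2 \<Omega>"
  shows "L2_inner \<Omega> (state u) (\<lambda>x. 1) = L2_inner \<Omega> u (\<lambda>x. 1)"
proof -
  obtain v where v: "v \<in> V" "\<forall>x\<in>\<Omega>. v x = 1" using const_V by blast
  have *: "L2_inner \<Omega> w v = L2_inner \<Omega> w (\<lambda>x. 1)" for w
    unfolding L2_inner_def by (intro Bochner_Integration.integral_cong) (use v in auto)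
  have "L2_inner \<Omega> (state u) v = H1_inner \<Omega> (state u) v"
    using v state_works(1)[OF u] V_H1
    by (intro H1_inner_const[symmetric, of _ _ _ 1] open_\<Omega> lmeasurable_\<Omega>) auto
  then show ?thesis using state_works(2)[OF u v(1)] * by simp
qed

lemma discrete_cost_eq:
  assumes u: "u \<in> L2 \<Omega>"
  shows "discrete_cost \<Omega> (\<lambda>_. -1) \<alpha> V u
    = L2_inner \<Omega> (state u) (state u) + 2 * L2_inner \<Omega> u (\<lambda>x. 1) + measure lebesgue \<Omega> + \<alpha> * L2_inner \<Omega> u u"
proof -
  have one: "(\<lambda>x. 1) \<in> L2 \<Omega>" by (rule L2_const[OF lmeasurable_\<Omega>])
  have m: "L2_inner \<Omega> (\<lambda>x. 1) (\<lambda>x. 1) = measure lebesgue \<Omega>"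
    using lmeasurable_\<Omega> by (simp add: L2_inner_def measure_restrict_space fmeasurableD)
  have "L2_inner \<Omega> (\<lambda>x. state u x + 1) (\<lambda>x. state u x + 1)
      = L2_inner \<Omega> (state u) (state u) + 2 * L2_inner \<Omega> (state u) (\<lambda>x. 1) + measure lebesgue \<Omega>"
    using L2_add[OF state_L2[OF u] one] state_L2[OF u] one
    by (simp add: L2_inner_add_left L2_inner_add_right L2_inner_commute[of \<Omega> "\<lambda>x. 1" "state u"] m)
  then show ?thesis
    unfolding discrete_cost_def L2_norm_eq using state_integral[OF u] by simp
qed

end

section \<open>Simplices and Lagrange bases\<close>

lemma nn_integral_lborel_shift:
  fixes f :: "'a::euclidean_space \<Rightarrow> ennreal"
  assumes f: "f \<in> borel_measurable borel"
  shows "(\<integral>\<^sup>+x. f (x + v) \<partial>lborel) = (\<integral>\<^sup>+x. f x \<partial>lborel)"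
proof -
  have "(\<integral>\<^sup>+x. f x \<partial>lborel) = (\<integral>\<^sup>+x. f x \<partial>distr lborel borel ((+) v))"
    by (simp add: lborel_distr_plus)
  also have "\<dots> = (\<integral>\<^sup>+x. f (v + x) \<partial>lborel)"
    using f by (subst nn_integral_distr) auto
  finally show ?thesis by (simp add: add.commute)
qed

text \<open>
  The library's change of variables formula requires a well-ordered index type, so the scaling factor
  is obtained here from the uniqueness argument for Haar measure.
\<close>

lemma nn_integral_linear_image:
  fixes A :: "'a::euclidean_space \<Rightarrow> 'a"
  assumes A: "linear A" "inj A"
  obtains c :: real where "c > 0"
    "\<And>f. f \<in> borel_measurable borel \<Longrightarrow> (\<integral>\<^sup>+x. f (A x) \<partial>lborel) = ennreal c * (\<integral>\<^sup>+x. f x \<partial>lborel)"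
proof -
  obtain A' where A': "linear A'" "\<And>x. A' (A x) = x" "\<And>x. A (A' x) = x"
    using linear_injective_isomorphism[OF A] by blast
  have cont: "continuous_on UNIV A" "continuous_on UNIV A'"
    using A A' by (auto intro: linear_continuous_on linear_conv_bounded_linear[THEN iffD1])
  have Am[measurable]: "A \<in> borel_measurable borel" using cont by (auto intro: borel_measurable_continuous_onI)
  define Q where "Q = box (- One :: 'a) One"
  define g :: "'a \<Rightarrow> ennreal" where "g = indicator Q"
  have gm[measurable]: "g \<in> borel_measurable borel" unfolding g_def Q_def by measurable
  have Q0: "0 \<in> Q" by (simp add: Q_def mem_box)
  \<comment> \<open>The preimage of \<open>Q\<close> under \<open>x \<mapsto> - A x\<close>; its
    volume \<open>s\<close> becomes the numerator of the scaling factor.\<close>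
  let ?S = "(\<lambda>x. A' (- x)) ` Q"
  have S_eq: "?S = {x. - A x \<in> Q}"
    using A' A by (auto simp: image_iff linear_neg) (metis A'(2) linear_neg[OF A'(1)] minus_minus)
  have S_open: "open ?S"
    unfolding S_eq unfolding Q_def using open_vimage[OF open_box continuous_on_minus[OF cont(1)]]
    by (simp add: vimage_def)
  have S_bdd: "bounded ?S"
  proof -
    have "compact ((\<lambda>x. A' (- x)) ` cbox (- One) One)"
      by (intro compact_continuous_image continuous_on_compose2[OF cont(2)] continuous_intros) auto
    then show ?thesis
      by (rule bounded_subset[OF compact_imp_bounded]) (auto simp: Q_def intro!: imageI box_subset_cbox[THEN subsetD])
  qed
  have S_ne: "?S \<noteq> {}" using Q0 by auto
  have pos_fin: "\<exists>r>0. emeasure lborel S = ennreal r" if "open S" "bounded S" "S \<noteq> {}" for S :: "'a set"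
  proof -
    have "emeasure lborel S < \<infinity>" using emeasure_bounded_finite[OF that(2)] .
    then have e: "emeasure lborel S = ennreal (measure lborel S)"
      by (intro emeasure_eq_ennreal_measure) auto
    moreover have "emeasure lborel S \<noteq> 0"
      using that open_not_negligible[of S] by (auto simp: negligible_iff_emeasure0 null_sets_def)
    ultimately have "measure lborel S \<noteq> 0" by auto
    then have "measure lborel S > 0" by (simp add: zero_less_measure_iff)
    then show ?thesis using e by blast
  qed
  obtain s where s: "s > 0" "emeasure lborel ?S = ennreal s" using pos_fin[OF S_open S_bdd S_ne] by blast
  obtain m where m: "m > 0" "emeasure lborel Q = ennreal m"
    using pos_fin[of Q] Q0 by (auto simp: Q_def)
  \<comment> \<open>Multiply by the integral of \<open>g\<close>, translate \<open>x\<close> by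
    \<open>A' y\<close> to bring \<open>y\<close> into the argument of \<open>f\<close>, exchange
    the integrals, substitute \<open>z = A x + y\<close> and exchange again. The inner integral of
    \<open>g (z - A x)\<close> is then the same number \<open>s\<close> for every
    \<open>z\<close>.\<close>
  have key: "(\<integral>\<^sup>+x. f (A x) \<partial>lborel) * ennreal m = ennreal s * (\<integral>\<^sup>+x. f x \<partial>lborel)"
    if f[measurable]: "f \<in> borel_measurable borel" for f
  proof -
    have "(\<integral>\<^sup>+x. f (A x) \<partial>lborel) * ennreal m = (\<integral>\<^sup>+y. g y * (\<integral>\<^sup>+x. f (A x) \<partial>lborel) \<partial>lborel)"
      using m(2) by (subst nn_integral_multc) (auto simp: g_def Q_def mult.commute)
    also have "\<dots> = (\<integral>\<^sup>+y. g y * (\<integral>\<^sup>+x. f (A x + y) \<partial>lborel) \<partial>lborel)"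
    proof (rule nn_integral_cong, rule arg_cong2[where f = "(*)"], rule refl)
      fix y
      have "(\<integral>\<^sup>+x. f (A x) \<partial>lborel) = (\<integral>\<^sup>+x. f (A (x + A' y)) \<partial>lborel)"
        by (rule nn_integral_lborel_shift[symmetric]) measurable
      moreover have "A (x + A' y) = A x + y" for x by (simp add: linear_add[OF A(1)] A')
      ultimately show "(\<integral>\<^sup>+x. f (A x) \<partial>lborel) = (\<integral>\<^sup>+x. f (A x + y) \<partial>lborel)" by simp
    qed
    also have "\<dots> = (\<integral>\<^sup>+y. \<integral>\<^sup>+x. g y * f (A x + y) \<partial>lborel \<partial>lborel)"
      by (intro nn_integral_cong nn_integral_cmult[symmetric]) measurable
    also have "\<dots> = (\<integral>\<^sup>+x. \<integral>\<^sup>+y. g y * f (A x + y) \<partial>lborel \<partial>lborel)"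
      by (rule lborel_pair.Fubini') measurable
    also have "\<dots> = (\<integral>\<^sup>+x. \<integral>\<^sup>+z. g (z - A x) * f z \<partial>lborel \<partial>lborel)"
    proof (rule nn_integral_cong)
      fix x
      have "(\<integral>\<^sup>+y. g y * f (A x + y) \<partial>lborel) = (\<integral>\<^sup>+z. g (z + - A x) * f (A x + (z + - A x)) \<partial>lborel)"
        by (rule nn_integral_lborel_shift[symmetric]) measurable
      then show "(\<integral>\<^sup>+y. g y * f (A x + y) \<partial>lborel) = (\<integral>\<^sup>+z. g (z - A x) * f z \<partial>lborel)" by simp
    qed
    also have "\<dots> = (\<integral>\<^sup>+z. \<integral>\<^sup>+x. g (z - A x) * f z \<partial>lborel \<partial>lborel)"
      by (rule lborel_pair.Fubini') measurable
    also have "\<dots> = (\<integral>\<^sup>+z. ennreal s * f z \<partial>lborel)"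
    proof (rule nn_integral_cong)
      fix z
      have "(\<integral>\<^sup>+x. g (z - A x) \<partial>lborel) = (\<integral>\<^sup>+x. g (z - A (x + A' z)) \<partial>lborel)"
        by (rule nn_integral_lborel_shift[symmetric]) measurable
      also have "\<dots> = (\<integral>\<^sup>+x. indicator ?S x \<partial>lborel)"
        unfolding S_eq by (intro nn_integral_cong) (auto simp: linear_add[OF A(1)] A' g_def split: split_indicator)
      also have "\<dots> = ennreal s" using s(2) S_open by simp
      finally have "(\<integral>\<^sup>+x. g (z - A x) \<partial>lborel) = ennreal s" .
      moreover have "(\<lambda>x. g (z - A x)) \<in> borel_measurable lborel" by measurable
      ultimately show "(\<integral>\<^sup>+x. g (z - A x) * f z \<partial>lborel) = ennreal s * f z"
        by (simp add: nn_integral_multc)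
    qed
    also have "\<dots> = ennreal s * (\<integral>\<^sup>+x. f x \<partial>lborel)" by (rule nn_integral_cmult) measurable
    finally show ?thesis .
  qed
  show thesis
  proof (rule that[of "s / m"])
    show "s / m > 0" using s m by simp
    fix f :: "'a \<Rightarrow> ennreal" assume f: "f \<in> borel_measurable borel"
    have "(\<integral>\<^sup>+x. f (A x) \<partial>lborel) = (\<integral>\<^sup>+x. f (A x) \<partial>lborel) * ennreal m * ennreal (1 / m)"
      using m(1) by (simp add: mult.assoc ennreal_mult[symmetric])
    also have "\<dots> = ennreal (s / m) * (\<integral>\<^sup>+x. f x \<partial>lborel)"
      unfolding key[OF f] using m(1) s(1)
      by (simp add: mult.assoc mult.commute[of _ "ennreal (1/m)"] ennreal_mult[symmetric]) (simp add: mult.assoc[symmetric] ennreal_mult[symmetric])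
    finally show "(\<integral>\<^sup>+x. f (A x) \<partial>lborel) = ennreal (s / m) * (\<integral>\<^sup>+x. f x \<partial>lborel)" .
  qed
qed

text \<open>The factor is the reciprocal of the absolute value of the determinant. Passing through
  an equality of measures extends the formula from nonnegative to signed integrands.\<close>

lemma integral_affine_image:
  fixes A :: "'a::euclidean_space \<Rightarrow> 'a"
  assumes A: "linear A" "inj A"
  obtains c :: real where "c > 0"
    "\<And>f :: 'a \<Rightarrow> real. f \<in> borel_measurable borel \<Longrightarrow> (\<integral>x. f (A x + d) \<partial>lborel) = c * (\<integral>x. f x \<partial>lborel)"
proof -
  obtain c where c: "c > 0"
    "\<And>f. f \<in> borel_measurable borel \<Longrightarrow> (\<integral>\<^sup>+x. f (A x) \<partial>lborel) = ennreal c * (\<integral>\<^sup>+x. f x \<partial>lborel)"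
    using nn_integral_linear_image[OF A] by blast
  have Am: "(\<lambda>x. A x + d) \<in> borel_measurable borel"
    using A(1) by (intro borel_measurable_continuous_onI continuous_intros linear_continuous_on)
      (auto simp: linear_conv_bounded_linear)
  have "distr lborel borel (\<lambda>x. A x + d) = density lborel (\<lambda>_. ennreal c)"
  proof (rule measure_eqI)
    fix X assume "X \<in> sets (distr lborel borel (\<lambda>x. A x + d))"
    then have X: "X \<in> sets borel" by simp
    have "emeasure (distr lborel borel (\<lambda>x. A x + d)) X = (\<integral>\<^sup>+x. indicator X x \<partial>distr lborel borel (\<lambda>x. A x + d))"
      using X by simp
    also have "\<dots> = (\<integral>\<^sup>+x. indicator X (A x + d) \<partial>lborel)"
      using X Am by (intro nn_integral_distr) auto
    also have "\<dots> = ennreal c * (\<integral>\<^sup>+x. indicator X (x + d) \<partial>lborel)"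
      using X by (intro c(2)[of "\<lambda>x. indicator X (x + d)"] measurable_compose[of "\<lambda>x. x + d" borel borel "indicator X"]) auto
    also have "(\<integral>\<^sup>+x. indicator X (x + d) \<partial>lborel) = (\<integral>\<^sup>+x. indicator X x \<partial>lborel)"
      using nn_integral_lborel_shift[of "indicator X" d] X by simp
    finally show "emeasure (distr lborel borel (\<lambda>x. A x + d)) X = emeasure (density lborel (\<lambda>_. ennreal c)) X"
      using X by (simp add: emeasure_density nn_integral_cmult)
  qed simp
  then have "(\<integral>x. f (A x + d) \<partial>lborel) = c * (\<integral>x. f x \<partial>lborel)"
    if f: "f \<in> borel_measurable borel" for f :: "'a \<Rightarrow> real"
    using integral_distr[of "\<lambda>x. A x + d" lborel borel f] Am f c(1) by (simp add: integral_density)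
  then show thesis using that c(1) by blast
qed

text \<open>All facts come from recovering the spanning set \<open>C\<close>. Its affine hull is the
  whole space, so the convex hull has nonempty interior and is the closure of that interior; its
  extreme points are \<open>C\<close>.\<close>

lemma open_simplexD:
  fixes T :: "'a::euclidean_space set"
  assumes "open_simplex T"
  shows "\<not> affine_dependent (vertices T)" "card (vertices T) = Suc DIM('a)" "finite (vertices T)"
    "closure T = convex hull (vertices T)" "T = interior (convex hull (vertices T))"
    "T \<noteq> {}" "open T" "affine hull (vertices T) = UNIV" "bounded T"
proof -
  obtain C where C: "\<not> affine_dependent C" "card C = Suc DIM('a)" "T = interior (convex hull C)"
    using assms by (auto simp: open_simplex_def simplex_def)
  have fin: "finite C" using C aff_independent_finite by blast
  have aff: "affine hull C = UNIV" by (rule affine_independent_span_eq[OF C(1,2)])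
  then have "rel_interior (convex hull C) = interior (convex hull C)"
    by (intro rel_interior_interior) simp
  moreover have "convex hull C \<noteq> {}" using C(2) by auto
  ultimately have ne: "interior (convex hull C) \<noteq> {}"
    using rel_interior_eq_empty[OF convex_convex_hull, of C] by simp
  have cl: "closure T = convex hull C"
    unfolding C(3) using convex_closure_interior[OF convex_convex_hull ne] fin
    by (simp add: closure_closed compact_imp_closed finite_imp_compact_convex_hull)
  have v: "vertices T = C"
    unfolding vertices_def cl using extreme_point_of_convex_hull_affine_independent[OF C(1)] by auto
  have "bounded (convex hull C)"
    using fin by (simp add: compact_imp_bounded finite_imp_compact_convex_hull)
  then have "bounded T" unfolding C(3) using interior_subset bounded_subset by blast
  then show "\<not> affine_dependent (vertices T)" "card (vertices T) = Suc DIM('a)" "finite (vertices T)"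
    "closure T = convex hull (vertices T)" "T = interior (convex hull (vertices T))"
    "T \<noteq> {}" "open T" "affine hull (vertices T) = UNIV" "bounded T"
    unfolding v using C fin cl ne aff by auto
qed

lemma open_simplex_reference: "open_simplex (reference_simplex :: 'a::euclidean_space set)"
proof -
  have "\<not> affine_dependent (insert 0 Basis :: 'a set)"
    using affine_dependent_iff_dependent[of "0::'a" Basis] independent_Basis by simp
  moreover have "card (insert 0 Basis :: 'a set) = Suc DIM('a)"
    by (simp add: card_insert_if)
  ultimately have "int DIM('a) simplex (convex hull (insert 0 Basis :: 'a set))"
    unfolding simplex_def by (intro exI[of _ "insert 0 Basis"]) auto
  then show ?thesis unfolding open_simplex_def reference_simplex_def by blast
qed

section \<open>Nodal bases\<close>

definition nodal_basis :: "nat \<Rightarrow> 'a::euclidean_space set \<Rightarrow> ('a \<Rightarrow> real) set" where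
  "nodal_basis k C = {p. polydeg k p \<and>
     (\<exists>a\<in>lattice_points k C. p a = 1 \<and> (\<forall>b\<in>lattice_points k C - {a}. p b = 0))}"

text \<open>Allowing any vertex set lets basis functions pulled back to an element be described on
  that element itself.\<close>

lemma reference_basis_eq: "reference_basis k = nodal_basis k (vertices reference_simplex)"
  by (simp add: reference_basis_def nodal_basis_def polydeg_iff lagrange_points_eq)

lemma unisolvence_eq:
  assumes "polydeg k p" "polydeg k q" "k \<ge> 1" "finite C"
    and "\<And>a. a \<in> lattice_points k C \<Longrightarrow> p a = q a" and "x \<in> affine hull C"
  shows "p x = q x"
  using unisolvence[OF polydeg_diff[OF assms(1,2)] assms(3,4) _ assms(6)] assms(5) by simp

text \<open>A member is nonzero at its own node only. Hence one common node with nonzero values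
  fixes all nodal values of both, and unisolvence does the rest.\<close>

lemma nodal_basis_eqI:
  assumes "k \<ge> 1" "finite C" "affine hull C = UNIV" "p \<in> nodal_basis k C" "q \<in> nodal_basis k C"
    and a: "a \<in> lattice_points k C" "p a \<noteq> 0" "q a \<noteq> 0"
  shows "p = q"
proof
  fix x
  have *: "r b = (if b = a then 1 else 0)" if "b \<in> lattice_points k C" "r \<in> nodal_basis k C" "r a \<noteq> 0" for r b
  proof -
    obtain c where "r c = 1" "\<forall>b\<in>lattice_points k C - {c}. r b = 0"
      using \<open>r \<in> nodal_basis k C\<close> by (auto simp: nodal_basis_def)
    then show ?thesis using that a(1) by (cases "a = c") auto
  qed
  have eq: "p b = q b" if "b \<in> lattice_points k C" for b
    using *[of b p] *[of b q] assms(4,5) a(2,3) that by simp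
  have "polydeg k p" "polydeg k q" using assms(4,5) by (auto simp: nodal_basis_def)
  from unisolvence_eq[OF this assms(1,2) eq] show "p x = q x" using assms(3) by simp
qed

lemma finite_nodal_basis:
  fixes C :: "'a::euclidean_space set"
  assumes "k \<ge> 1" "finite C" "affine hull C = UNIV" shows "finite (nodal_basis k C)"
proof -
  have "\<forall>p\<in>nodal_basis k C. \<exists>a. a \<in> lattice_points k C \<and> p a = 1"
    by (auto simp: nodal_basis_def)
  then obtain a where a: "\<And>p. p \<in> nodal_basis k C \<Longrightarrow> a p \<in> lattice_points k C \<and> p (a p) = 1" by metis
  have "inj_on a (nodal_basis k C)"
    using a nodal_basis_eqI[OF assms] by (intro inj_onI) (metis zero_neq_one)
  then show ?thesis
    using a finite_lattice_points[OF assms(2)] by (meson finite_imageD finite_subset image_subsetI)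
qed

lemma sum_lattice_weights:
  assumes "(\<Sum>v\<in>C. m v) = k" "k \<ge> 1" shows "(\<Sum>v\<in>C. real (m v) / real k) = 1"
proof -
  have "(\<Sum>v\<in>C. real (m v) / real k) = real (\<Sum>v\<in>C. m v) / real k"
    by (simp add: sum_divide_distrib)
  then show ?thesis using assms by simp
qed

text \<open>Affine maps preserve barycentric coordinates; multiplicities are transported along the
  vertex bijection.\<close>

lemma affine_image_lattice_points:
  assumes A: "linear A" and C: "finite C" and k: "k \<ge> 1" and inj: "inj_on (\<lambda>x. A x + c) C"
  shows "(\<lambda>x. A x + c) ` lattice_points k C = lattice_points k ((\<lambda>x. A x + c) ` C)"
proof -
  let ?G = "\<lambda>x. A x + c"
  have G: "?G (\<Sum>v\<in>C. (real (m v) / real k) *\<^sub>R v) = (\<Sum>v\<in>C. (real (m v) / real k) *\<^sub>R ?G v)"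
    if "(\<Sum>v\<in>C. m v) = k" for m
    by (rule affine_map_combination[OF A C sum_lattice_weights[OF that k]])
  show ?thesis
  proof (intro equalityI subsetI)
    fix y assume "y \<in> ?G ` lattice_points k C"
    then obtain m where m: "(\<Sum>v\<in>C. m v) = k" "y = ?G (\<Sum>v\<in>C. (real (m v) / real k) *\<^sub>R v)"
      unfolding lattice_points_def by auto
    let ?m = "\<lambda>w. m (the_inv_into C ?G w)"
    have "y = (\<Sum>w\<in>?G ` C. (real (?m w) / real k) *\<^sub>R w)" "(\<Sum>w\<in>?G ` C. ?m w) = k"
      unfolding sum.reindex[OF inj] m(2) G[OF m(1)] using m(1)
      by (auto simp: the_inv_into_f_f[OF inj] intro!: sum.cong)
    then show "y \<in> lattice_points k (?G ` C)" using lattice_pointsI by metis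
  next
    fix y assume "y \<in> lattice_points k (?G ` C)"
    then obtain m where m: "(\<Sum>v\<in>?G ` C. m v) = k" "y = (\<Sum>v\<in>?G ` C. (real (m v) / real k) *\<^sub>R v)"
      unfolding lattice_points_def by auto
    then have m': "(\<Sum>v\<in>C. m (?G v)) = k" "y = (\<Sum>v\<in>C. (real (m (?G v)) / real k) *\<^sub>R ?G v)"
      unfolding sum.reindex[OF inj] by (auto simp: comp_def)
    show "y \<in> ?G ` lattice_points k C"
      unfolding m'(2) G[OF m'(1), symmetric] by (intro imageI lattice_pointsI m'(1))
  qed
qed

lemma nodal_basis_affine_comp:
  fixes A :: "'a::euclidean_space \<Rightarrow> 'a"
  assumes \<psi>: "\<psi> \<in> nodal_basis k D" and A: "linear A" "inj A" and C: "finite C" and k: "k \<ge> 1"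
    and D: "(\<lambda>x. A x + c) ` C = D"
  shows "(\<lambda>x. \<psi> (A x + c)) \<in> nodal_basis k C"
proof -
  let ?G = "\<lambda>x. A x + c"
  have inj: "inj ?G" using A(2) by (auto simp: inj_on_def)
  have L: "?G ` lattice_points k C = lattice_points k D"
    using affine_image_lattice_points[OF A(1) C k inj_on_subset[OF inj]] D by auto
  obtain a' where a': "a' \<in> lattice_points k D" "\<psi> a' = 1" "\<forall>b\<in>lattice_points k D - {a'}. \<psi> b = 0"
    using \<psi> by (auto simp: nodal_basis_def)
  then obtain a where a: "a \<in> lattice_points k C" "a' = ?G a" using L by auto
  have "\<psi> (?G b) = 0" if "b \<in> lattice_points k C - {a}" for b
  proof -
    have "?G b \<in> lattice_points k D" "?G b \<noteq> a'"
      using that L inj a by (auto simp: inj_on_def)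
    then show ?thesis using a'(3) by blast
  qed
  moreover have "polydeg k (\<lambda>x. \<psi> (?G x))"
    using \<psi> polydeg_affine_comp[OF _ A(1)] by (auto simp: nodal_basis_def)
  ultimately show ?thesis using a a'(2) by (auto simp: nodal_basis_def)
qed

lemma simplex_affine_bijection:
  fixes C D :: "'a::euclidean_space set"
  assumes C: "\<not> affine_dependent C" and D: "affine hull D = UNIV" and \<sigma>: "\<sigma> ` C = D"
  obtains A c where "linear A" "inj A" "\<And>v. v \<in> C \<Longrightarrow> A v + c = \<sigma> v"
proof -
  obtain A c where A: "linear A" "\<And>v. v \<in> C \<Longrightarrow> A v + c = \<sigma> v"
    using affine_extension[OF C, of \<sigma>] by blast
  \<comment> \<open>The range is an affine set containing \<open>D\<close>, hence the whole space.
    So the linear part is onto and, between equal dimensions, injective.\<close>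
  have "affine ((\<lambda>x. A x + c) ` UNIV)"
  proof -
    have "(\<lambda>x. A x + c) ` UNIV = (+) c ` (A ` UNIV)" by (auto simp: add.commute image_image)
    then show ?thesis
      using affine_translation[of "A ` UNIV" c] linear_subspace_image[OF A(1) subspace_UNIV] subspace_imp_affine by auto
  qed
  moreover have "D \<subseteq> (\<lambda>x. A x + c) ` UNIV" unfolding \<sigma>[symmetric] by (auto simp: A(2)[symmetric])
  ultimately have "(\<lambda>x. A x + c) ` UNIV = UNIV" using D hull_minimal[of D "range (\<lambda>x. A x + c)" affine] by auto
  then have *: "y + c \<in> range (\<lambda>x. A x + c)" for y by simp
  have "\<exists>x. y = A x" for y using *[of y] by auto
  then have "surj A" unfolding surj_def by blast
  then have "inj A" using A(1) linear_surjective_imp_injective by blast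
  then show thesis using that A by blast
qed

lemma affine_image_convex_hull:
  "linear A \<Longrightarrow> (\<lambda>x. A x + c) ` (convex hull S) = convex hull ((\<lambda>x. A x + c) ` S)"
proof -
  assume A: "linear A"
  have "(\<lambda>x. A x + c) ` X = (+) c ` (A ` X)" for X by (auto simp: add.commute image_image)
  then show ?thesis by (simp add: convex_hull_translation convex_hull_linear_image[OF A])
qed

lemma affine_image_interior:
  fixes A :: "'a::euclidean_space \<Rightarrow> 'a"
  shows "linear A \<Longrightarrow> inj A \<Longrightarrow> (\<lambda>x. A x + c) ` interior S = interior ((\<lambda>x. A x + c) ` S)"
proof -
  assume A: "linear A" "inj A"
  have "(\<lambda>x. A x + c) ` X = (+) c ` (A ` X)" for X by (auto simp: add.commute image_image)
  then show ?thesis by (simp add: interior_translation interior_injective_linear_image[OF A])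
qed

lemma affine_image_open_simplex:
  fixes T T' :: "'a::euclidean_space set"
  assumes "open_simplex T" "open_simplex T'" "linear A" "inj A" "(\<lambda>x. A x + c) ` vertices T = vertices T'"
  shows "(\<lambda>x. A x + c) ` T = T'" "(\<lambda>x. A x + c) ` closure T = closure T'"
  using open_simplexD(4,5)[OF assms(1)] open_simplexD(4,5)[OF assms(2)] assms(5)
    affine_image_interior[OF assms(3,4)] affine_image_convex_hull[OF assms(3)] by metis+

text \<open>\<open>fe_basis\<close> asks only for an affine map of the open sets. Its image is open
  and nonempty, so the linear part is onto, hence injective. Closures then correspond, extreme
  points of the image lie among the image vertices, and equal cardinalities force equality.\<close>

lemma affine_image_vertices:
  fixes T T' :: "'a::euclidean_space set"
  assumes T: "open_simplex T" "open_simplex T'" and A: "linear A" and TT': "(\<lambda>x. A x + c) ` T = T'"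
  shows "inj A" "(\<lambda>x. A x + c) ` vertices T = vertices T'"
proof -
  define G where "G x = A x + c" for x
  have G: "(\<lambda>x. A x + c) = G" by (simp add: G_def[abs_def])
  have split: "G ` X = (+) c ` (A ` X)" for X by (auto simp: add.commute image_image G_def)
  have TG: "T' = G ` T" using TT' unfolding G by simp
  have "T' \<subseteq> (+) c ` range A" unfolding TG split by blast
  moreover have "affine ((+) c ` range A)"
    using affine_translation[of "range A" c] linear_subspace_image[OF A subspace_UNIV] subspace_imp_affine by auto
  moreover have "affine hull T' = UNIV"
    using affine_hull_open[OF open_simplexD(7,6)[OF T(2)]] .
  ultimately have "(+) c ` range A = UNIV" using hull_minimal[of T' "(+) c ` range A" affine] by auto
  then have *: "c + y \<in> (+) c ` range A" for y by simp
  have "\<exists>x. y = A x" for y using *[of y] by auto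
  then have "surj A" unfolding surj_def by blast
  then show inj: "inj A" using A linear_surjective_imp_injective by blast
  have "closure T' = G ` closure T"
    unfolding TG split by (simp add: closure_translation closure_injective_linear_image[OF A inj])
  also have "\<dots> = convex hull (G ` vertices T)"
    using affine_image_convex_hull[OF A, of c "vertices T"] open_simplexD(4)[OF T(1)] unfolding G by simp
  finally have "vertices T' \<subseteq> G ` vertices T"
    unfolding vertices_def[of T'] using extreme_point_of_convex_hull by auto
  moreover have "finite (G ` vertices T)" using open_simplexD(3)[OF T(1)] by simp
  moreover have "card (G ` vertices T) \<le> card (vertices T')"
    using open_simplexD(2)[OF T(1)] open_simplexD(2)[OF T(2)] card_image_le[OF open_simplexD(3)[OF T(1)], of G] by simp
  ultimately show "(\<lambda>x. A x + c) ` vertices T = vertices T'" unfolding G by (metis card_seteq)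
qed

section \<open>Finite element spaces\<close>

locale mesh =
  fixes \<Omega> :: "'a::euclidean_space set" and h :: real and \<T> :: "'a set set" and k :: nat
  assumes open_\<Omega>: "open \<Omega>" and bounded_\<Omega>: "bounded \<Omega>"
    and decomposition: "simplicial_decomposition \<Omega> h \<T>" and k: "k \<ge> 1"
begin

lemma finite_mesh: "finite \<T>"
  and mesh_simplex: "T \<in> \<T> \<Longrightarrow> open_simplex T"
  and mesh_subset: "T \<in> \<T> \<Longrightarrow> T \<subseteq> \<Omega>"
  and closure_\<Omega>: "closure \<Omega> = (\<Union>T\<in>\<T>. closure T)"
  using decomposition by (auto simp: simplicial_decomposition_def)

lemma mesh_disjoint: "T \<in> \<T> \<Longrightarrow> T' \<in> \<T> \<Longrightarrow> x \<in> T \<Longrightarrow> x \<in> T' \<Longrightarrow> T = T'"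
  using decomposition unfolding simplicial_decomposition_def pairwise_def disjnt_def by blast

lemma lmeasurable_\<Omega>: "\<Omega> \<in> lmeasurable"
  using open_\<Omega> bounded_\<Omega> by (rule lmeasurable_open[rotated])

text \<open>A face of a simplex is the hull of some of its vertices. The intersection is a face of
  both closures, and its extreme points show that the two vertex subsets coincide, so they consist
  of shared vertices.\<close>

lemma mesh_face:
  assumes T: "T \<in> \<T>" "T' \<in> \<T>"
  shows "closure T \<inter> closure T' \<subseteq> convex hull (vertices T \<inter> vertices T')"
proof -
  note s = open_simplexD[OF mesh_simplex[OF T(1)]] and s' = open_simplexD[OF mesh_simplex[OF T(2)]]
  have tri: "triangulation (closure ` \<T>)" using decomposition by (auto simp: simplicial_decomposition_def)
  have "closure T \<inter> closure T' face_of closure T" "closure T' \<inter> closure T face_of closure T'"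
    using tri T unfolding triangulation_def by blast+
  then obtain c c' where c: "c \<subseteq> vertices T" "closure T \<inter> closure T' = convex hull c"
    and c': "c' \<subseteq> vertices T'" "closure T' \<inter> closure T = convex hull c'"
    unfolding s(4) s'(4) face_of_convex_hull_affine_independent[OF s(1)]
      face_of_convex_hull_affine_independent[OF s'(1)] by blast
  have "x \<in> c \<longleftrightarrow> x \<in> c'" for x
    using extreme_point_of_convex_hull_affine_independent[of c x]
      extreme_point_of_convex_hull_affine_independent[of c' x]
      affine_independent_subset[OF s(1) c(1)] affine_independent_subset[OF s'(1) c'(1)] c(2) c'(2)
    by (simp add: Int_commute)
  then have "c \<subseteq> vertices T \<inter> vertices T'" using c c' by blast
  then show ?thesis unfolding c(2) by (rule hull_mono)
qed

text \<open>What the open elements leave uncovered lies on finitely many frontiers of convex sets,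
  which are null.\<close>

lemma negligible_skeleton: "negligible (\<Omega> - \<Union>\<T>)"
proof (rule negligible_subset)
  have "negligible (frontier T)" if "T \<in> \<T>" for T
  proof (rule negligible_convex_frontier)
    show "convex T"
      by (subst open_simplexD(5)[OF mesh_simplex[OF that]]) (simp add: convex_interior)
  qed
  then show "negligible (\<Union>T\<in>\<T>. frontier T)"
    using finite_mesh by (intro negligible_Union) auto
  show "\<Omega> - \<Union>\<T> \<subseteq> (\<Union>T\<in>\<T>. frontier T)"
  proof
    fix x assume x: "x \<in> \<Omega> - \<Union>\<T>"
    then obtain T where T: "T \<in> \<T>" "x \<in> closure T"
      using closure_\<Omega> closure_subset[of \<Omega>] by auto
    then have "x \<in> frontier T"
      using x interior_subset[of T] by (auto simp: frontier_def)
    then show "x \<in> (\<Union>T\<in>\<T>. frontier T)" using T by blast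
  qed
qed

section \<open>Nodal values and gluing of continuous elements\<close>

definition nodes :: "'a set" where
  "nodes = (\<Union>T\<in>\<T>. lattice_points k (vertices T))"

lemma finite_nodes: "finite nodes"
  unfolding nodes_def using finite_mesh open_simplexD(3)[OF mesh_simplex]
  by (auto intro: finite_lattice_points)

lemma nodes_closure: "T \<in> \<T> \<Longrightarrow> lattice_points k (vertices T) \<subseteq> closure T"
  using lattice_points_subset_hull[OF open_simplexD(3)[OF mesh_simplex] k] open_simplexD(4)[OF mesh_simplex]
  by blast

lemma fe_basis_Continuous:
  "fe_basis Continuous k \<Omega> \<T> = {\<phi> \<in> fe_space Continuous k \<Omega> \<T>.
     \<exists>a\<in>nodes. \<phi> a = 1 \<and> (\<forall>b\<in>nodes - {a}. \<phi> b = 0)}"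
  by (simp add: nodes_def lagrange_points_eq)

text \<open>Nodes may lie on the boundary of an open element, so the polynomial identity is carried
  to the closure by continuity.\<close>

lemma fe_space_Continuous_polynomial:
  assumes "u \<in> fe_space Continuous k \<Omega> \<T>" "T \<in> \<T>"
  obtains p where "polydeg k p" "\<And>x. x \<in> closure T \<Longrightarrow> u x = p x"
proof -
  obtain p where p: "polydeg k p" "\<And>x. x \<in> T \<Longrightarrow> u x = p x"
    using assms by (auto simp: polydeg_iff)
  have "continuous_on (closure T) u"
    using assms closure_mono[OF mesh_subset[OF assms(2)]] by (auto intro: continuous_on_subset)
  then have "u x - p x = 0" if "x \<in> closure T" for x
    using that p(2) polydeg_continuous[OF p(1)]
    by - (rule continuous_constant_on_closure[of T "\<lambda>x. u x - p x"], auto intro!: continuous_intros)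
  then show thesis using that p(1) by force
qed

lemma fe_space_Continuous_zero:
  assumes u: "u \<in> fe_space Continuous k \<Omega> \<T>" and z: "\<And>a. a \<in> nodes \<Longrightarrow> u a = 0"
  shows "u = (\<lambda>x. 0)"
proof
  fix x
  show "u x = 0"
  proof (cases "x \<in> closure \<Omega>")
    case True
    then obtain T where T: "T \<in> \<T>" "x \<in> closure T" using closure_\<Omega> by auto
    obtain p where p: "polydeg k p" "\<And>x. x \<in> closure T \<Longrightarrow> u x = p x"
      using fe_space_Continuous_polynomial[OF u T(1)] by blast
    have "p x = 0"
    proof (rule unisolvence[OF p(1) k open_simplexD(3)[OF mesh_simplex[OF T(1)]]])
      fix a assume a: "a \<in> lattice_points k (vertices T)"
      then have "a \<in> nodes" using T(1) by (auto simp: nodes_def)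
      then show "p a = 0" using p(2)[of a] z[of a] nodes_closure[OF T(1)] a by auto
    qed (simp add: open_simplexD(8)[OF mesh_simplex[OF T(1)]])
    then show ?thesis using p T by simp
  next
    case False
    then show ?thesis using u by simp
  qed
qed

text \<open>Closures of elements meet only in hulls of shared vertices, so agreement there makes the
  pieces consistent; finitely many closed pieces then give continuity.\<close>

lemma glue:
  assumes p: "\<And>T. T \<in> \<T> \<Longrightarrow> polydeg k (p T)"
    and agree: "\<And>T T' x. T \<in> \<T> \<Longrightarrow> T' \<in> \<T> \<Longrightarrow> x \<in> convex hull (vertices T \<inter> vertices T') \<Longrightarrow> p T x = p T' x"
  obtains u where "u \<in> fe_space Continuous k \<Omega> \<T>" "\<And>T x. T \<in> \<T> \<Longrightarrow> x \<in> closure T \<Longrightarrow> u x = p T x"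
proof -
  \<comment> \<open>An arbitrary element containing \<open>x\<close> is chosen; the agreement of the
    pieces makes the value independent of it.\<close>
  define u where "u x = (if x \<in> closure \<Omega> then p (SOME T. T \<in> \<T> \<and> x \<in> closure T) x else 0)" for x
  have u: "u x = p T x" if T: "T \<in> \<T>" "x \<in> closure T" for T x
  proof -
    let ?T = "SOME T. T \<in> \<T> \<and> x \<in> closure T"
    have s: "?T \<in> \<T> \<and> x \<in> closure ?T" by (rule someI[of _ T]) (use T in simp)
    then have "x \<in> convex hull (vertices ?T \<inter> vertices T)"
      using mesh_face[of ?T T] T by blast
    then have "p ?T x = p T x" using agree s T by blast
    moreover have "x \<in> closure \<Omega>" using T closure_\<Omega> by blast
    ultimately show ?thesis by (simp add: u_def)
  qed
  have "continuous_on (closure \<Omega>) u"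
    unfolding closure_\<Omega>
  proof (rule continuous_on_closed_Union[OF finite_mesh])
    show "continuous_on (closure T) u" if "T \<in> \<T>" for T
      using polydeg_continuous[OF p[OF that], of "closure T"] u[OF that]
      by (subst continuous_on_cong[OF refl, of _ _ "p T"]) auto
  qed auto
  moreover have "\<exists>p. polynomial_of_degree_le k p \<and> (\<forall>x\<in>T. u x = p x)" if "T \<in> \<T>" for T
    using u[OF that] p[OF that] closure_subset[of T] by (auto simp: polydeg_iff intro!: exI[of _ "p T"])
  ultimately have "u \<in> fe_space Continuous k \<Omega> \<T>" by (simp add: u_def)
  then show thesis using u that by blast
qed

text \<open>On each element the piece is the nodal polynomial of \<open>a\<close>, or 0 if
  \<open>a\<close> is no node there. On a common face both pieces have the same values at the nodes
  of the face, and unisolvence on the face identifies the traces.\<close>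

lemma nodal_function_exists:
  assumes a: "a \<in> nodes"
  obtains \<phi> where "\<phi> \<in> fe_basis Continuous k \<Omega> \<T>" "\<phi> a = 1" "\<And>b. b \<in> nodes \<Longrightarrow> b \<noteq> a \<Longrightarrow> \<phi> b = 0"
proof -
  have "\<exists>p. polydeg k p \<and> (\<forall>b\<in>lattice_points k (vertices T). p b = (if b = a then 1 else 0))" if T: "T \<in> \<T>" for T
  proof (cases "a \<in> lattice_points k (vertices T)")
    case True
    obtain p where "polydeg k p" "p a = 1" "\<And>b. b \<in> lattice_points k (vertices T) \<Longrightarrow> b \<noteq> a \<Longrightarrow> p b = 0"
      using nodal_polynomial_exists[OF open_simplexD(1)[OF mesh_simplex[OF T]] k True] by blast
    then show ?thesis by (intro exI[of _ p]) auto
  next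
    case False
    then show ?thesis by (intro exI[of _ "\<lambda>x. 0"]) (auto intro: polydeg_const)
  qed
  then obtain p where p: "\<And>T. T \<in> \<T> \<Longrightarrow> polydeg k (p T)"
    "\<And>T b. T \<in> \<T> \<Longrightarrow> b \<in> lattice_points k (vertices T) \<Longrightarrow> p T b = (if b = a then 1 else 0)" by metis
  have agree: "p T x = p T' x"
    if T: "T \<in> \<T>" "T' \<in> \<T>" and x: "x \<in> convex hull (vertices T \<inter> vertices T')" for T T' x
  proof (rule unisolvence_eq[OF p(1)[OF T(1)] p(1)[OF T(2)] k, of "vertices T \<inter> vertices T'"])
    show "finite (vertices T \<inter> vertices T')" using open_simplexD(3)[OF mesh_simplex[OF T(1)]] by blast
    show "x \<in> affine hull (vertices T \<inter> vertices T')" using x convex_hull_subset_affine_hull by blast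
    fix b assume "b \<in> lattice_points k (vertices T \<inter> vertices T')"
    then have "b \<in> lattice_points k (vertices T)" "b \<in> lattice_points k (vertices T')"
      using lattice_points_mono[of "vertices T" "vertices T \<inter> vertices T'" k]
        lattice_points_mono[of "vertices T'" "vertices T \<inter> vertices T'" k]
        open_simplexD(3)[OF mesh_simplex[OF T(1)]] open_simplexD(3)[OF mesh_simplex[OF T(2)]] by auto
    then show "p T b = p T' b" using p(2) T by simp
  qed
  obtain \<phi> where \<phi>: "\<phi> \<in> fe_space Continuous k \<Omega> \<T>" "\<And>T x. T \<in> \<T> \<Longrightarrow> x \<in> closure T \<Longrightarrow> \<phi> x = p T x"
    using glue[of p, OF p(1) agree] by blast
  have val: "\<phi> b = (if b = a then 1 else 0)" if b: "b \<in> nodes" for b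
  proof -
    obtain T where T: "T \<in> \<T>" "b \<in> lattice_points k (vertices T)" using b by (auto simp: nodes_def)
    then have "\<phi> b = p T b" using \<phi>(2) nodes_closure[OF T(1)] by blast
    then show ?thesis using p(2)[OF T] by simp
  qed
  have "\<phi> \<in> fe_basis Continuous k \<Omega> \<T>"
    unfolding fe_basis_Continuous using \<phi>(1) val a by auto
  then show thesis using that val a by simp
qed

section \<open>Finiteness and independence of the basis\<close>

lemma fe_basis_Discontinuous_subset:
  "fe_basis Discontinuous k \<Omega> \<T> \<subseteq>
     (\<Union>T\<in>\<T>. (\<lambda>p x. if x \<in> T then p x else 0) ` nodal_basis k (vertices T))"
proof
  fix \<phi> assume "\<phi> \<in> fe_basis Discontinuous k \<Omega> \<T>"
  then obtain T \<psi> and G :: "'a \<Rightarrow> 'a" where G: "T \<in> \<T>" "\<psi> \<in> reference_basis k"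
    "\<phi> = (\<lambda>x. if x \<in> T then \<psi> (G x) else 0)" "\<exists>A c. linear A \<and> (\<forall>x. G x = A x + c)"
    "G ` T = reference_simplex"
    unfolding fe_basis.simps by blast
  then obtain A c where A: "linear A" "G = (\<lambda>x. A x + c)" by blast
  note T = G(1,2) A(1) G(3)[unfolded A(2)] G(5)[unfolded A(2)]
  note v = affine_image_vertices[OF mesh_simplex[OF T(1)] open_simplex_reference T(3,5)]
  have "(\<lambda>x. \<psi> (A x + c)) \<in> nodal_basis k (vertices T)"
    using T(2) unfolding reference_basis_eq
    by (rule nodal_basis_affine_comp[OF _ T(3) v(1) open_simplexD(3)[OF mesh_simplex[OF T(1)]] k v(2)])
  then show "\<phi> \<in> (\<Union>T\<in>\<T>. (\<lambda>p x. if x \<in> T then p x else 0) ` nodal_basis k (vertices T))"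
    unfolding T(4) by - (rule UN_I[OF T(1)], rule image_eqI[OF refl])
qed

lemma fe_basis_DiscontinuousE:
  assumes "\<phi> \<in> fe_basis Discontinuous k \<Omega> \<T>"
  obtains T p where "T \<in> \<T>" "p \<in> nodal_basis k (vertices T)" "\<phi> = (\<lambda>x. if x \<in> T then p x else 0)"
  using subsetD[OF fe_basis_Discontinuous_subset assms] by (elim UN_E imageE)

lemma fe_spaceD:
  "u \<in> fe_space K k \<Omega> \<T> \<Longrightarrow> T \<in> \<T> \<Longrightarrow> \<exists>p. polynomial_of_degree_le k p \<and> (\<forall>x\<in>T. u x = p x)"
  by (cases K) auto

lemma fe_space_add:
  assumes "u \<in> fe_space K k \<Omega> \<T>" "v \<in> fe_space K k \<Omega> \<T>"
  shows "(\<lambda>x. u x + v x) \<in> fe_space K k \<Omega> \<T>"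
proof -
  have "\<exists>p. polynomial_of_degree_le k p \<and> (\<forall>x\<in>T. u x + v x = p x)" if T: "T \<in> \<T>" for T
  proof -
    obtain p q where "polynomial_of_degree_le k p" "\<forall>x\<in>T. u x = p x" "polynomial_of_degree_le k q" "\<forall>x\<in>T. v x = q x"
      using fe_spaceD[OF assms(1) T] fe_spaceD[OF assms(2) T] by blast
    then show ?thesis by (intro exI[of _ "\<lambda>x. p x + q x"]) (simp add: polynomial_of_degree_le_add)
  qed
  then show ?thesis using assms by (cases K) (auto intro: continuous_on_add)
qed

lemma fe_space_cmult:
  assumes "u \<in> fe_space K k \<Omega> \<T>" shows "(\<lambda>x. c * u x) \<in> fe_space K k \<Omega> \<T>"
proof -
  have "\<exists>p. polynomial_of_degree_le k p \<and> (\<forall>x\<in>T. c * u x = p x)" if T: "T \<in> \<T>" for T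
  proof -
    obtain p where "polynomial_of_degree_le k p" "\<forall>x\<in>T. u x = p x"
      using assms T by (cases K) auto
    then show ?thesis by (intro exI[of _ "\<lambda>x. c * p x"]) (simp add: polynomial_of_degree_le_cmult)
  qed
  then show ?thesis using assms by (cases K) (auto intro: continuous_on_mult continuous_on_const)
qed

lemma fe_space_zero: "(\<lambda>x. 0) \<in> fe_space K k \<Omega> \<T>"
  by (cases K) (auto intro: exI[of _ "\<lambda>x. 0"] polynomial_of_degree_le_const)

lemma fe_space_sum:
  "(\<And>i. i \<in> I \<Longrightarrow> u i \<in> fe_space K k \<Omega> \<T>) \<Longrightarrow> (\<lambda>x. \<Sum>i\<in>I. u i x) \<in> fe_space K k \<Omega> \<T>"
  by (induction I rule: infinite_finite_induct) (auto intro: fe_space_zero fe_space_add simp del: fe_space.simps)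

lemma finite_fe_basis: "finite (fe_basis K k \<Omega> \<T>)"
proof (cases K)
  case Discontinuous
  have "finite (\<Union>T\<in>\<T>. (\<lambda>p x. if x \<in> T then p x else 0) ` nodal_basis k (vertices T))"
    using finite_mesh finite_nodal_basis[OF k open_simplexD(3,8)[OF mesh_simplex]] by blast
  then show ?thesis unfolding Discontinuous by (rule finite_subset[OF fe_basis_Discontinuous_subset])
next
  case Continuous
  have "\<forall>\<phi>\<in>fe_basis Continuous k \<Omega> \<T>. \<exists>a. a \<in> nodes \<and> \<phi> a = 1 \<and> (\<forall>b\<in>nodes - {a}. \<phi> b = 0)"
    unfolding fe_basis_Continuous by blast
  then obtain a where a: "\<And>\<phi>. \<phi> \<in> fe_basis Continuous k \<Omega> \<T> \<Longrightarrow> a \<phi> \<in> nodes \<and> \<phi> (a \<phi>) = 1 \<and> (\<forall>b\<in>nodes - {a \<phi>}. \<phi> b = 0)"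
    by metis
  have "inj_on a (fe_basis Continuous k \<Omega> \<T>)"
  proof (rule inj_onI)
    fix \<phi> \<psi> assume b: "\<phi> \<in> fe_basis Continuous k \<Omega> \<T>" "\<psi> \<in> fe_basis Continuous k \<Omega> \<T>" and e: "a \<phi> = a \<psi>"
    have "(\<lambda>x. \<phi> x + - 1 * \<psi> x) = (\<lambda>x. 0)"
    proof (rule fe_space_Continuous_zero)
      show "(\<lambda>x. \<phi> x + - 1 * \<psi> x) \<in> fe_space Continuous k \<Omega> \<T>"
        using b unfolding fe_basis_Continuous by (intro fe_space_add fe_space_cmult) blast+
      show "\<phi> n + - 1 * \<psi> n = 0" if "n \<in> nodes" for n
        using a[OF b(1)] a[OF b(2)] e that by (cases "n = a \<phi>") auto
    qed
    then show "\<phi> = \<psi>" by (auto simp: fun_eq_iff)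
  qed
  moreover have "finite (a ` fe_basis Continuous k \<Omega> \<T>)"
    using a finite_nodes by (meson finite_subset image_subsetI)
  ultimately show ?thesis using Continuous finite_imageD by blast
qed

lemma fe_basis_subset: "fe_basis K k \<Omega> \<T> \<subseteq> fe_space K k \<Omega> \<T>"
proof (cases K)
  case Discontinuous
  have *: "(\<lambda>x. if x \<in> T then p x else 0) \<in> fe_space Discontinuous k \<Omega> \<T>"
    if T: "T \<in> \<T>" "p \<in> nodal_basis k (vertices T)" for T p
  proof -
    have "\<exists>q. polynomial_of_degree_le k q \<and> (\<forall>x\<in>T'. (if x \<in> T then p x else 0) = q x)" if T': "T' \<in> \<T>" for T'
    proof (cases "T' = T")
      case True
      then show ?thesis using T by (intro exI[of _ p]) (auto simp: nodal_basis_def polydeg_iff)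
    next
      case False
      then have "\<forall>x\<in>T'. x \<notin> T" using mesh_disjoint T(1) T' by blast
      then show ?thesis by (intro exI[of _ "\<lambda>x. 0"]) (simp add: polynomial_of_degree_le_const)
    qed
    then show ?thesis using T(1) by auto
  qed
  show ?thesis
    unfolding Discontinuous
  proof
    fix \<phi> assume "\<phi> \<in> fe_basis Discontinuous k \<Omega> \<T>"
    then obtain T p where "T \<in> \<T>" "p \<in> nodal_basis k (vertices T)" "\<phi> = (\<lambda>x. if x \<in> T then p x else 0)"
      by (rule fe_basis_DiscontinuousE)
    then show "\<phi> \<in> fe_space Discontinuous k \<Omega> \<T>" using *[of T p] by (simp only:)
  qed
next
  case Continuous
  show ?thesis unfolding Continuous fe_basis_Continuous by blast
qed

text \<open>Evaluation at the node of \<open>\<phi>\<^sub>0\<close> isolates its coefficient. In the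
  discontinuous case that node may lie outside the open element, so the representing polynomials are
  evaluated there and the vanishing of the sum is extended by continuity.\<close>

lemma fe_basis_independent:
  assumes z: "\<And>x. (\<Sum>\<phi>\<in>fe_basis K k \<Omega> \<T>. l \<phi> * \<phi> x) = 0" and \<phi>: "\<phi>\<^sub>0 \<in> fe_basis K k \<Omega> \<T>"
  shows "l \<phi>\<^sub>0 = 0"
proof (cases K)
  case Discontinuous
  let ?B = "fe_basis Discontinuous k \<Omega> \<T>"
  obtain T p where T: "T \<in> \<T>" "p \<in> nodal_basis k (vertices T)" "\<phi>\<^sub>0 = (\<lambda>x. if x \<in> T then p x else 0)"
    by (rule fe_basis_DiscontinuousE[OF \<phi>[unfolded Discontinuous]])
  note s = open_simplexD[OF mesh_simplex[OF T(1)]]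
  obtain a where a: "a \<in> lattice_points k (vertices T)" "p a = 1" using T(2) by (auto simp: nodal_basis_def)
  have "\<exists>q. polydeg k q \<and> (\<forall>x\<in>T. \<phi> x = q x) \<and> q a = (if \<phi> = \<phi>\<^sub>0 then 1 else 0)" if b: "\<phi> \<in> ?B" for \<phi>
  proof -
    obtain T' q where T': "T' \<in> \<T>" "q \<in> nodal_basis k (vertices T')" "\<phi> = (\<lambda>x. if x \<in> T' then q x else 0)"
      by (rule fe_basis_DiscontinuousE[OF b])
    show ?thesis
    proof (cases "T' = T")
      case False
      then have "\<forall>x\<in>T. x \<notin> T'" using mesh_disjoint T T' by blast
      \<comment> \<open>The polynomial of \<open>\<phi>\<^sub>0\<close> cannot vanish on all of
        \<open>T\<close>, since its nodal value 1 is attained on the closure. So a function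
        supported on another element differs from \<open>\<phi>\<^sub>0\<close>.\<close>
      moreover obtain x where "x \<in> T" "p x \<noteq> 0"
      proof -
        have "\<exists>x\<in>T. p x \<noteq> 0"
        proof (rule ccontr)
          assume "\<not> ?thesis"
          then have "p a = 0"
            using nodes_closure[OF T(1)] a(1) T(2) polydeg_continuous[of k p "closure T"]
            by - (rule continuous_constant_on_closure[of T p], auto simp: nodal_basis_def)
          then show False using a by simp
        qed
        then show thesis using that by blast
      qed
      ultimately have "\<phi> \<noteq> \<phi>\<^sub>0" unfolding T(3) T'(3) by (auto simp: fun_eq_iff)
      then show ?thesis
        using T'(3) \<open>\<forall>x\<in>T. x \<notin> T'\<close> by (intro exI[of _ "\<lambda>x. 0"]) (auto intro: polydeg_const)
    next
      case True
      have "q a = (if \<phi> = \<phi>\<^sub>0 then 1 else 0)"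
      proof (cases "q a = 0")
        case True
        have "\<phi> \<noteq> \<phi>\<^sub>0"
        proof
          assume "\<phi> = \<phi>\<^sub>0"
          then have "\<forall>x\<in>T. q x - p x = 0" unfolding T(3) T'(3) \<open>T' = T\<close> by (auto simp: fun_eq_iff split: if_splits)
          then have "q a - p a = 0"
            using nodes_closure[OF T(1)] a(1) T(2) T'(2) polydeg_continuous[of k p "closure T"] polydeg_continuous[of k q "closure T"]
            by - (rule continuous_constant_on_closure[of T "\<lambda>x. q x - p x"], auto simp: nodal_basis_def intro!: continuous_intros)
          then show False using a True by simp
        qed
        then show ?thesis using True by simp
      next
        case False
        have "q = p"
          using nodal_basis_eqI[OF k s(3,8) T'(2)[unfolded \<open>T' = T\<close>] T(2) a(1) False] a(2) by simp
        then have "\<phi> = \<phi>\<^sub>0" unfolding T(3) T'(3) \<open>T' = T\<close> by (simp only:)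
        then show ?thesis using a(2) \<open>q = p\<close> by simp
      qed
      then show ?thesis using T'(2,3) True by (intro exI[of _ q]) (auto simp: nodal_basis_def)
    qed
  qed
  then obtain q where q: "\<And>\<phi>. \<phi> \<in> ?B \<Longrightarrow> polydeg k (q \<phi>) \<and> (\<forall>x\<in>T. \<phi> x = q \<phi> x) \<and> q \<phi> a = (if \<phi> = \<phi>\<^sub>0 then 1 else 0)"
    by metis
  have "(\<Sum>\<phi>\<in>?B. l \<phi> * q \<phi> a) = 0"
  proof (rule continuous_constant_on_closure[of T "\<lambda>x. \<Sum>\<phi>\<in>?B. l \<phi> * q \<phi> x"])
    show "continuous_on (closure T) (\<lambda>x. \<Sum>\<phi>\<in>?B. l \<phi> * q \<phi> x)"
      using q polydeg_continuous by (intro continuous_intros) blast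
    show "(\<Sum>\<phi>\<in>?B. l \<phi> * q \<phi> x) = 0" if "x \<in> T" for x
      using z[of x] q that unfolding Discontinuous by (simp cong: sum.cong del: fe_basis.simps)
    show "a \<in> closure T" using nodes_closure[OF T(1)] a(1) by blast
  qed
  moreover have "(\<Sum>\<phi>\<in>?B. l \<phi> * q \<phi> a) = (\<Sum>\<phi>\<in>?B. if \<phi> = \<phi>\<^sub>0 then l \<phi> else 0)"
    by (rule sum.cong[OF refl]) (use q in \<open>simp del: fe_basis.simps\<close>)
  ultimately show ?thesis
    using \<phi> finite_fe_basis[of Discontinuous] unfolding Discontinuous by (simp del: fe_basis.simps)
next
  case Continuous
  let ?B = "fe_basis Continuous k \<Omega> \<T>"
  obtain a where a: "a \<in> nodes" "\<phi>\<^sub>0 a = 1" "\<forall>b\<in>nodes - {a}. \<phi>\<^sub>0 b = 0"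
    using \<phi> unfolding Continuous fe_basis_Continuous by blast
  have *: "\<phi> a = (if \<phi> = \<phi>\<^sub>0 then 1 else 0)" if b: "\<phi> \<in> ?B" for \<phi>
  proof (cases "\<phi> a = 0")
    case False
    obtain c where c: "c \<in> nodes" "\<phi> c = 1" "\<forall>b\<in>nodes - {c}. \<phi> b = 0"
      using b unfolding fe_basis_Continuous by blast
    then have "c = a" using False a(1) by blast
    have "(\<lambda>x. \<phi> x + - 1 * \<phi>\<^sub>0 x) = (\<lambda>x. 0)"
    proof (rule fe_space_Continuous_zero)
      show "(\<lambda>x. \<phi> x + - 1 * \<phi>\<^sub>0 x) \<in> fe_space Continuous k \<Omega> \<T>"
        using b \<phi> fe_basis_subset[of Continuous] unfolding Continuous by (intro fe_space_add fe_space_cmult) blast+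
      show "\<phi> n + - 1 * \<phi>\<^sub>0 n = 0" if "n \<in> nodes" for n
        using a c \<open>c = a\<close> that by (cases "n = a") auto
    qed
    then have "\<phi> = \<phi>\<^sub>0" by (auto simp: fun_eq_iff)
    then show ?thesis using a by simp
  qed (use a in auto)
  have "(\<Sum>\<phi>\<in>?B. l \<phi> * \<phi> a) = (\<Sum>\<phi>\<in>?B. if \<phi> = \<phi>\<^sub>0 then l \<phi> else 0)"
  proof (rule sum.cong[OF refl])
    fix \<phi> assume "\<phi> \<in> ?B"
    from *[OF this] show "l \<phi> * \<phi> a = (if \<phi> = \<phi>\<^sub>0 then l \<phi> else 0)" by simp
  qed
  then show ?thesis
    using z[of a] \<phi> finite_fe_basis[of Continuous] unfolding Continuous by (simp del: fe_basis.simps)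
qed

text \<open>A nonzero value on an open element would spread to an open set. Off the elements the
  values are prescribed or follow by continuity. This turns uniqueness almost everywhere into
  equality of functions.\<close>

lemma fe_space_AE_zero:
  assumes u: "u \<in> fe_space K k \<Omega> \<T>" and ae: "AE x in lebesgue_on \<Omega>. u x = 0"
  shows "u = (\<lambda>x. 0)"
proof -
  have on_T: "u x = 0" if T: "T \<in> \<T>" and x: "x \<in> T" for T x
  proof (rule ccontr)
    assume "u x \<noteq> 0"
    obtain p where p: "polydeg k p" "\<And>x. x \<in> T \<Longrightarrow> u x = p x"
      using u T by (cases K) (auto simp: polydeg_iff)
    have "open (T \<inter> p -` (- {0}))"
      using open_simplexD(7)[OF mesh_simplex[OF T]] polydeg_continuous[OF p(1)]
      by (intro continuous_open_preimage) auto
    moreover have "x \<in> T \<inter> p -` (- {0})" using x p(2)[OF x] \<open>u x \<noteq> 0\<close> by simp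
    moreover have "negligible (T \<inter> p -` (- {0}))"
    proof -
      have "AE x in lebesgue. x \<in> \<Omega> \<longrightarrow> u x = 0"
        using ae open_\<Omega> by (simp add: AE_restrict_space_iff)
      then have "AE x in lebesgue. x \<notin> T \<inter> p -` (- {0})"
        by eventually_elim (use mesh_subset[OF T] p(2) in auto)
      then show ?thesis
        using \<open>open (T \<inter> p -` (- {0}))\<close>
        by (subst negligible_iff_null_sets, subst AE_iff_null_sets) auto
    qed
    ultimately show False using open_not_negligible by blast
  qed
  show ?thesis
  proof (cases K)
    case Discontinuous
    show ?thesis
    proof
      fix x show "u x = 0" using u on_T unfolding Discontinuous by (cases "x \<in> \<Union>\<T>") auto
    qed
  next
    case Continuous
    show ?thesis
    proof
      fix x
      show "u x = 0"
      proof (cases "x \<in> closure \<Omega>")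
        case True
        then obtain T where T: "T \<in> \<T>" "x \<in> closure T" using closure_\<Omega> by auto
        have "continuous_on (closure T) u"
          using u closure_mono[OF mesh_subset[OF T(1)]] unfolding Continuous by (auto intro: continuous_on_subset)
        then show ?thesis
          using T on_T[OF T(1)] by - (rule continuous_constant_on_closure[of T u], auto)
      qed (use u Continuous in simp)
    qed
  qed
qed

lemma fe_space_L2:
  assumes u: "u \<in> fe_space K k \<Omega> \<T>" shows "u \<in> L2 \<Omega>"
proof -
  have "\<forall>T\<in>\<T>. \<exists>p. polydeg k p \<and> (\<forall>x\<in>T. u x = p x)"
    using u by (cases K) (auto simp: polydeg_iff)
  then obtain p where p: "\<And>T. T \<in> \<T> \<Longrightarrow> polydeg k (p T) \<and> (\<forall>x\<in>T. u x = p T x)" by metis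
  \<comment> \<open>A Borel function that agrees with \<open>u\<close> off the skeleton;
    completeness of Lebesgue measure passes its measurability on to \<open>u\<close>.\<close>
  define v where "v x = (\<Sum>T\<in>\<T>. indicator T x * p T x)" for x
  have v: "v x = u x" if x: "x \<in> T" and T: "T \<in> \<T>" for x T
  proof -
    have "v x = (\<Sum>T'\<in>\<T>. if T' = T then p T x else 0)"
      unfolding v_def using x T mesh_disjoint by (intro sum.cong) (auto simp: indicator_def)
    then show ?thesis using p x T finite_mesh by simp
  qed
  have vL: "v \<in> L2 \<Omega>"
    unfolding v_def[abs_def]
  proof (rule L2_sum)
    fix T assume T: "T \<in> \<T>"
    note s = open_simplexD[OF mesh_simplex[OF T]]
    have c: "continuous_on UNIV (p T)" using p[OF T] polydeg_continuous by blast
    have "compact (p T ` closure T)"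
      using s(9) by (intro compact_continuous_image continuous_on_subset[OF c]) (auto simp: compact_closure)
    then obtain C where C: "\<And>x. x \<in> closure T \<Longrightarrow> \<bar>p T x\<bar> \<le> C"
      using compact_imp_bounded[of "p T ` closure T"] by (auto simp: bounded_iff)
    show "(\<lambda>x. indicator T x * p T x) \<in> L2 \<Omega>"
    proof (rule L2_bounded[OF lmeasurable_\<Omega>])
      show "(\<lambda>x. indicator T x * p T x) \<in> borel_measurable (lebesgue_on \<Omega>)"
        using s(7) c by (intro borel_measurable_lebesgue_onI borel_measurable_times)
          (auto intro: borel_measurable_continuous_onI)
      show "\<bar>indicator T x * p T x\<bar> \<le> \<bar>C\<bar>" for x
        using C[of x] closure_subset[of T] by (auto split: split_indicator)
    qed
  qed
  have vu: "AE x in lebesgue_on \<Omega>. v x = u x"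
  proof -
    have "AE x in lebesgue. x \<notin> \<Omega> - \<Union>\<T>"
      using negligible_skeleton by (intro AE_not_in) (simp add: negligible_iff_null_sets)
    then have "AE x in lebesgue. x \<in> \<Omega> \<longrightarrow> v x = u x"
      by eventually_elim (use v in blast)
    then show ?thesis using open_\<Omega> by (simp add: AE_restrict_space_iff)
  qed
  have um: "u \<in> borel_measurable (lebesgue_on \<Omega>)"
  proof -
    have "(\<lambda>x. indicator T x * p T x) \<in> borel_measurable borel" if T: "T \<in> \<T>" for T
      using open_simplexD(7)[OF mesh_simplex[OF T]] p[OF T] polydeg_continuous[of k "p T" UNIV]
      by (intro borel_measurable_times borel_measurable_continuous_onI borel_measurable_indicator) auto
    then have "v \<in> borel_measurable lborel"
      unfolding v_def[abs_def] by (intro borel_measurable_sum) simp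
    then have vm: "v \<in> borel_measurable lebesgue" by (rule measurable_completion)
    have v0: "v x = 0" if "x \<notin> \<Omega>" for x
      unfolding v_def using that mesh_subset by (intro sum.neutral) (auto simp: indicator_def)
    have "AE x in lebesgue. v x = indicator \<Omega> x * u x"
      using vu open_\<Omega> by (simp add: AE_restrict_space_iff) (auto elim!: eventually_mono simp: v0 indicator_def)
    from borel_measurable_AE[OF vm this]
    have "(\<lambda>x. indicator \<Omega> x * u x) \<in> borel_measurable (lebesgue_on \<Omega>)"
      by (rule measurable_restrict_space1)
    then show ?thesis by (subst measurable_cong[where g = "\<lambda>x. indicator \<Omega> x * u x"]) auto
  qed
  have 1: "AE x in lebesgue_on \<Omega>. (v x)\<^sup>2 = (u x)\<^sup>2" using vu by eventually_elim simp
  have 2: "integrable (lebesgue_on \<Omega>) (\<lambda>x. (v x)\<^sup>2)" using vL by (simp add: L2_def)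
  have 3: "(\<lambda>x. (u x)\<^sup>2) \<in> borel_measurable (lebesgue_on \<Omega>)" using um by (rule borel_measurable_power)
  have "integrable (lebesgue_on \<Omega>) (\<lambda>x. (u x)\<^sup>2)" by (rule integrable_cong_AE_imp[OF 2 3 1])
  then show ?thesis using um by (simp add: L2_def)
qed

end

section \<open>A control with negative integral\<close>

lemma nonneg_combinations_base: "finite B \<Longrightarrow> \<phi> \<in> B \<Longrightarrow> \<phi> \<in> nonneg_combinations B"
  unfolding nonneg_combinations_def
  by (intro CollectI exI[of _ "\<lambda>f. if f = \<phi> then 1 else 0"])
     (auto simp: if_distrib[of "\<lambda>c. c * _"] cong: if_cong)

lemma nonneg_combinations_zero: "(\<lambda>x. 0) \<in> nonneg_combinations B"
  unfolding nonneg_combinations_def by (intro CollectI exI[of _ "\<lambda>_. 0"]) auto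

lemma nonneg_combinations_add:
  assumes "u \<in> nonneg_combinations B" "v \<in> nonneg_combinations B"
  shows "(\<lambda>x. u x + v x) \<in> nonneg_combinations B"
proof -
  obtain l l' where "u = (\<lambda>x. \<Sum>\<phi>\<in>B. l \<phi> * \<phi> x)" "\<forall>\<phi>\<in>B. 0 \<le> l \<phi>"
    "v = (\<lambda>x. \<Sum>\<phi>\<in>B. l' \<phi> * \<phi> x)" "\<forall>\<phi>\<in>B. 0 \<le> l' \<phi>"
    using assms by (auto simp: nonneg_combinations_def)
  then show ?thesis
    unfolding nonneg_combinations_def
    by (intro CollectI exI[of _ "\<lambda>\<phi>. l \<phi> + l' \<phi>"]) (auto simp: sum.distrib distrib_right)
qed

lemma nonneg_combinations_cmult:
  assumes "u \<in> nonneg_combinations B" "c \<ge> 0"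
  shows "(\<lambda>x. c * u x) \<in> nonneg_combinations B"
proof -
  obtain l where "u = (\<lambda>x. \<Sum>\<phi>\<in>B. l \<phi> * \<phi> x)" "\<forall>\<phi>\<in>B. 0 \<le> l \<phi>"
    using assms by (auto simp: nonneg_combinations_def)
  then show ?thesis
    using assms(2) unfolding nonneg_combinations_def
    by (intro CollectI exI[of _ "\<lambda>\<phi>. c * l \<phi>"]) (auto simp: sum_distrib_left mult.assoc)
qed

lemma nonneg_combinations_sum:
  "(\<And>i. i \<in> I \<Longrightarrow> u i \<in> nonneg_combinations B) \<Longrightarrow> (\<lambda>x. \<Sum>i\<in>I. u i x) \<in> nonneg_combinations B"
  by (induction I rule: infinite_finite_induct) (auto intro: nonneg_combinations_zero nonneg_combinations_add)

section \<open>Symmetrisation over vertex bijections\<close>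

lemma integral_lebesgue_on_borel:
  fixes f :: "'a::euclidean_space \<Rightarrow> real"
  assumes "T \<in> sets borel" "f \<in> borel_measurable borel"
  shows "(\<integral>x. f x \<partial>lebesgue_on T) = (\<integral>x. indicator T x * f x \<partial>lborel)"
proof -
  have "(\<integral>x. f x \<partial>lebesgue_on T) = (\<integral>x. indicator T x * f x \<partial>lebesgue)"
    using assms(1) by (subst integral_restrict_space) auto
  also have "\<dots> = (\<integral>x. indicator T x * f x \<partial>lborel)"
    using assms by (intro integral_completion) (simp add: borel_measurable_times borel_measurable_indicator)
  finally show ?thesis .
qed

text \<open>Extensional maps, so that a bijection is counted once whatever its values off
  \<open>C\<close>.\<close>

definition simplex_bijections :: "'a set \<Rightarrow> 'a set \<Rightarrow> ('a \<Rightarrow> 'a) set" where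
  "simplex_bijections C D = {\<sigma> \<in> C \<rightarrow>\<^sub>E D. bij_betw \<sigma> C D}"

text \<open>The barycentric extension of the vertex map.\<close>

definition affine_map_of :: "'a::euclidean_space set \<Rightarrow> ('a \<Rightarrow> 'a) \<Rightarrow> 'a \<Rightarrow> 'a" where
  "affine_map_of C \<sigma> = (SOME G. (\<exists>A c. linear A \<and> inj A \<and> G = (\<lambda>x. A x + c)) \<and> (\<forall>v\<in>C. G v = \<sigma> v))"

lemma simplex_bijections_comp:
  assumes "\<sigma> \<in> simplex_bijections C D" "bij_betw \<gamma> C' C"
  shows "restrict (\<sigma> \<circ> \<gamma>) C' \<in> simplex_bijections C' D"
proof -
  have "bij_betw (\<sigma> \<circ> \<gamma>) C' D"
    using assms by (intro bij_betw_trans[of \<gamma> C' C]) (auto simp: simplex_bijections_def)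
  then have b: "bij_betw (restrict (\<sigma> \<circ> \<gamma>) C') C' D"
    by (subst bij_betw_cong[where g = "\<sigma> \<circ> \<gamma>"]) auto
  then have "restrict (\<sigma> \<circ> \<gamma>) C' \<in> C' \<rightarrow>\<^sub>E D"
    by (intro PiE_I) (auto dest: bij_betw_apply)
  then show ?thesis using b by (simp add: simplex_bijections_def)
qed

lemma finite_simplex_bijections: "finite C \<Longrightarrow> finite D \<Longrightarrow> finite (simplex_bijections C D)"
  unfolding simplex_bijections_def by (rule finite_subset[of _ "C \<rightarrow>\<^sub>E D"]) (auto intro: finite_PiE)

lemma affine_map_ofE:
  assumes C: "\<not> affine_dependent C" and D: "affine hull D = UNIV" and \<sigma>: "\<sigma> \<in> simplex_bijections C D"
  obtains A c where "linear A" "inj A" "affine_map_of C \<sigma> = (\<lambda>x. A x + c)" "\<And>v. v \<in> C \<Longrightarrow> A v + c = \<sigma> v"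
proof -
  have "\<sigma> ` C = D" using \<sigma> by (auto simp: simplex_bijections_def bij_betw_def)
  then obtain A c where A: "linear A" "inj A" "\<And>v. v \<in> C \<Longrightarrow> A v + c = \<sigma> v"
    using simplex_affine_bijection[OF C D] by metis
  have "(\<exists>A c. linear A \<and> inj A \<and> affine_map_of C \<sigma> = (\<lambda>x. A x + c)) \<and> (\<forall>v\<in>C. affine_map_of C \<sigma> v = \<sigma> v)"
    unfolding affine_map_of_def by (rule someI[of _ "\<lambda>x. A x + c"]) (use A in blast)
  then obtain A c where "linear A" "inj A" "affine_map_of C \<sigma> = (\<lambda>x. A x + c)" "\<forall>v\<in>C. affine_map_of C \<sigma> v = \<sigma> v"
    by blast
  then show thesis using that by metis
qed

lemma affine_map_of_combination:
  assumes C: "\<not> affine_dependent C" and D: "affine hull D = UNIV" and \<sigma>: "\<sigma> \<in> simplex_bijections C D"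
    and B: "B \<subseteq> C" "(\<Sum>v\<in>B. l v) = 1"
  shows "affine_map_of C \<sigma> (\<Sum>v\<in>B. l v *\<^sub>R v) = (\<Sum>v\<in>B. l v *\<^sub>R \<sigma> v)"
proof -
  obtain A c where A: "linear A" "affine_map_of C \<sigma> = (\<lambda>x. A x + c)" "\<And>v. v \<in> C \<Longrightarrow> A v + c = \<sigma> v"
    using affine_map_ofE[OF C D \<sigma>] by metis
  have "finite B" using C B(1) aff_independent_finite finite_subset by blast
  then have "A (\<Sum>v\<in>B. l v *\<^sub>R v) + c = (\<Sum>v\<in>B. l v *\<^sub>R (A v + c))"
    by (rule affine_map_combination[OF A(1) _ B(2)])
  also have "\<dots> = (\<Sum>v\<in>B. l v *\<^sub>R \<sigma> v)" using A(3) B(1) by (intro sum.cong) auto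
  finally show ?thesis unfolding A(2) .
qed

text \<open>
  Symmetrising over the vertex bijections makes the function on a common face independent of the
  element, so that the pieces glue to a continuous function.
\<close>

definition symmetrised :: "('a::euclidean_space \<Rightarrow> real) \<Rightarrow> 'a set \<Rightarrow> 'a set \<Rightarrow> 'a \<Rightarrow> real" where
  "symmetrised \<psi> D C x = (\<Sum>\<sigma>\<in>simplex_bijections C D. \<psi> (affine_map_of C \<sigma> x))"

text \<open>A bijection \<open>\<beta>\<close> from \<open>C\<close> to \<open>C'\<close> that fixes
  the shared vertices matches the summands of both sides by composition. At a point of the common
  face only shared vertices carry weight, so matched affine maps have the same value.\<close>

lemma symmetrised_agree:
  assumes C: "\<not> affine_dependent C" "\<not> affine_dependent C'" "card C = card C'" and D: "affine hull D = UNIV"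
    and x: "x \<in> convex hull (C \<inter> C')"
  shows "symmetrised \<psi> D C x = symmetrised \<psi> D C' x"
proof -
  have fin: "finite C" "finite C'" using C aff_independent_finite by blast+
  obtain l where l: "(\<Sum>v\<in>C \<inter> C'. l v) = 1" "x = (\<Sum>v\<in>C \<inter> C'. l v *\<^sub>R v)"
    using x fin unfolding convex_hull_finite[OF finite_Int[OF disjI1[OF fin(1)]]] by auto
  have "card (C - C') = card (C' - C)"
    using C(3) fin by (simp add: card_Diff_subset_Int Int_commute)
  then obtain g where g: "bij_betw g (C - C') (C' - C)"
    using finite_same_card_bij[of "C - C'" "C' - C"] fin by auto
  define \<beta> where "\<beta> v = (if v \<in> C \<inter> C' then v else g v)" for v
  have "bij_betw \<beta> (C \<inter> C' \<union> (C - C')) (C \<inter> C' \<union> (C' - C))"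
  proof (rule bij_betw_combine)
    show "bij_betw \<beta> (C \<inter> C') (C \<inter> C')" by (auto simp: \<beta>_def bij_betw_def inj_on_def)
    show "bij_betw \<beta> (C - C') (C' - C)"
      using g by (subst bij_betw_cong[of _ _ g]) (auto simp: \<beta>_def)
  qed auto
  moreover have "C \<inter> C' \<union> (C - C') = C" "C \<inter> C' \<union> (C' - C) = C'" by blast+
  ultimately have \<beta>: "bij_betw \<beta> C C'" by simp
  define \<gamma> where "\<gamma> = the_inv_into C \<beta>"
  have \<gamma>: "bij_betw \<gamma> C' C" "\<And>v. v \<in> C \<Longrightarrow> \<gamma> (\<beta> v) = v" "\<And>v. v \<in> C' \<Longrightarrow> \<beta> (\<gamma> v) = v"
    unfolding \<gamma>_def
    using bij_betw_the_inv_into[OF \<beta>] the_inv_into_f_f[OF bij_betw_imp_inj_on[OF \<beta>]] f_the_inv_into_f_bij_betw[OF \<beta>]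
    by blast+
  have \<beta>C: "\<And>v. v \<in> C \<Longrightarrow> \<beta> v \<in> C'" and \<gamma>C: "\<And>v. v \<in> C' \<Longrightarrow> \<gamma> v \<in> C"
    using \<beta> \<gamma>(1) by (auto simp: bij_betw_def)
  have r1: "restrict (\<sigma> \<circ> \<gamma>) C' \<in> simplex_bijections C' D" if "\<sigma> \<in> simplex_bijections C D" for \<sigma>
    by (rule simplex_bijections_comp[OF that \<gamma>(1)])
  have r2: "restrict (\<sigma> \<circ> \<beta>) C \<in> simplex_bijections C D" if "\<sigma> \<in> simplex_bijections C' D" for \<sigma>
    by (rule simplex_bijections_comp[OF that \<beta>])
  show ?thesis
    unfolding symmetrised_def
  proof (rule sum.reindex_bij_witness[where j = "\<lambda>\<sigma>. restrict (\<sigma> \<circ> \<gamma>) C'" and i = "\<lambda>\<sigma>. restrict (\<sigma> \<circ> \<beta>) C"])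
    fix \<sigma> assume s: "\<sigma> \<in> simplex_bijections C D"
    show "restrict (restrict (\<sigma> \<circ> \<gamma>) C' \<circ> \<beta>) C = \<sigma>"
      using s \<gamma>(2) \<beta>C by (auto simp: simplex_bijections_def PiE_iff extensional_def fun_eq_iff)
    show "restrict (\<sigma> \<circ> \<gamma>) C' \<in> simplex_bijections C' D" by (rule r1[OF s])
    have "\<gamma> v = v" if "v \<in> C \<inter> C'" for v using \<gamma>(2)[of v] that by (simp add: \<beta>_def)
    then have "affine_map_of C' (restrict (\<sigma> \<circ> \<gamma>) C') x = affine_map_of C \<sigma> x"
      unfolding l(2) affine_map_of_combination[OF C(2) D r1[OF s] Int_lower2 l(1)]
        affine_map_of_combination[OF C(1) D s Int_lower1 l(1)]
      by (intro sum.cong) auto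
    then show "\<psi> (affine_map_of C' (restrict (\<sigma> \<circ> \<gamma>) C') x) = \<psi> (affine_map_of C \<sigma> x)" by simp
  next
    fix \<sigma> assume s: "\<sigma> \<in> simplex_bijections C' D"
    show "restrict (restrict (\<sigma> \<circ> \<beta>) C \<circ> \<gamma>) C' = \<sigma>"
      using s \<gamma>(3) \<gamma>C by (auto simp: simplex_bijections_def PiE_iff extensional_def fun_eq_iff)
    show "restrict (\<sigma> \<circ> \<beta>) C \<in> simplex_bijections C D" by (rule r2[OF s])
  qed
qed

section \<open>Controls assembled from symmetrised pieces\<close>

locale negative_mesh = mesh \<Omega> h \<T> k for \<Omega> :: "'a::euclidean_space set" and h \<T> k +
  fixes \<psi> :: "'a \<Rightarrow> real" and m :: real
  assumes \<psi>: "\<psi> \<in> reference_basis k"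
    and negative: "(\<integral>x. \<psi> x \<partial>lebesgue_on reference_simplex) < 0"
    and m: "\<And>x. x \<in> closure reference_simplex \<Longrightarrow> \<bar>\<psi> x\<bar> \<le> m"
begin

abbreviation D :: "'a set" where "D \<equiv> vertices reference_simplex"

abbreviation piece :: "'a set \<Rightarrow> 'a \<Rightarrow> real" where "piece T \<equiv> symmetrised \<psi> D (vertices T)"

text \<open>Minus the mean value of \<open>\<psi>\<close> over the reference simplex, shared by all
  its affine pullbacks.\<close>

definition \<kappa> :: real where
  "\<kappa> = - (\<integral>x. \<psi> x \<partial>lebesgue_on reference_simplex) / measure lborel (reference_simplex :: 'a set)"

text \<open>The power counts all maps between two sets of \<open>d + 1\<close> vertices, a crude
  bound for the number of summands; each contributes at most \<open>m\<close>.\<close>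

definition M :: real where
  "M = real (Suc DIM('a) ^ Suc DIM('a)) * m"

lemmas ref = open_simplexD[OF open_simplex_reference[where 'a = 'a]]

lemma \<psi>_poly: "polydeg k \<psi>"
  using \<psi> by (simp add: reference_basis_eq nodal_basis_def)

lemma \<psi>_borel: "\<psi> \<in> borel_measurable borel"
  using polydeg_continuous[OF \<psi>_poly] by (rule borel_measurable_continuous_onI)

lemma \<psi>_lattice_nonneg: "b \<in> lattice_points k D \<Longrightarrow> \<psi> b \<ge> 0"
proof -
  assume b: "b \<in> lattice_points k D"
  obtain a where "\<psi> a = 1" "\<forall>b\<in>lattice_points k D - {a}. \<psi> b = 0"
    using \<psi> by (auto simp: reference_basis_eq nodal_basis_def)
  then show ?thesis using b by (cases "b = a") auto
qed

lemma map_of: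
  assumes T: "T \<in> \<T>" and \<sigma>: "\<sigma> \<in> simplex_bijections (vertices T) D"
  obtains A c where "linear A" "inj A" "affine_map_of (vertices T) \<sigma> = (\<lambda>x. A x + c)"
    "(\<lambda>x. A x + c) ` vertices T = D" "(\<lambda>x. A x + c) ` T = reference_simplex"
    "(\<lambda>x. A x + c) ` closure T = closure reference_simplex"
proof -
  note s = open_simplexD[OF mesh_simplex[OF T]]
  obtain A c where A: "linear A" "inj A" "affine_map_of (vertices T) \<sigma> = (\<lambda>x. A x + c)" "\<And>v. v \<in> vertices T \<Longrightarrow> A v + c = \<sigma> v"
    using affine_map_ofE[OF s(1) ref(8) \<sigma>] by metis
  have "(\<lambda>x. A x + c) ` vertices T = \<sigma> ` vertices T" using A(4) by auto
  also have "\<dots> = D" using \<sigma> by (auto simp: simplex_bijections_def bij_betw_def)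
  finally have v: "(\<lambda>x. A x + c) ` vertices T = D" .
  note i = affine_image_open_simplex[OF mesh_simplex[OF T] open_simplex_reference A(1,2) v]
  show thesis by (rule that[OF A(1-3) v i])
qed

lemma piece_polydeg: "T \<in> \<T> \<Longrightarrow> polydeg k (piece T)"
proof -
  assume T: "T \<in> \<T>"
  have "polydeg k (\<lambda>x. \<psi> (affine_map_of (vertices T) \<sigma> x))" if s: "\<sigma> \<in> simplex_bijections (vertices T) D" for \<sigma>
  proof -
    obtain A c where A: "linear A" "affine_map_of (vertices T) \<sigma> = (\<lambda>x. A x + c)" by (rule map_of[OF T s])
    show ?thesis unfolding A(2) by (rule polydeg_affine_comp[OF \<psi>_poly A(1)])
  qed
  then have "polydeg k (\<lambda>x. \<Sum>\<sigma>\<in>simplex_bijections (vertices T) D. \<psi> (affine_map_of (vertices T) \<sigma> x))"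
    by (rule polydeg_sum)
  then show ?thesis unfolding symmetrised_def[abs_def] .
qed

text \<open>Each pullback sends the nodes of \<open>T\<close> to reference nodes, where
  \<open>\<psi>\<close> is 0 or 1.\<close>

lemma piece_lattice_nonneg:
  assumes T: "T \<in> \<T>" and a: "a \<in> lattice_points k (vertices T)" shows "piece T a \<ge> 0"
  unfolding symmetrised_def
proof (rule sum_nonneg)
  fix \<sigma> assume s: "\<sigma> \<in> simplex_bijections (vertices T) D"
  obtain A c where A: "linear A" "inj A" "affine_map_of (vertices T) \<sigma> = (\<lambda>x. A x + c)"
    "(\<lambda>x. A x + c) ` vertices T = D" by (rule map_of[OF T s])
  have "inj_on (\<lambda>x. A x + c) (vertices T)" using A(2) by (auto simp: inj_on_def)
  then have "(\<lambda>x. A x + c) ` lattice_points k (vertices T) = lattice_points k D"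
    using affine_image_lattice_points[OF A(1) open_simplexD(3)[OF mesh_simplex[OF T]] k] A(4) by simp
  then have "A a + c \<in> lattice_points k D" using a by blast
  then show "0 \<le> \<psi> (affine_map_of (vertices T) \<sigma> a)" unfolding A(3) by (rule \<psi>_lattice_nonneg)
qed

lemma bijections_card:
  assumes T: "T \<in> \<T>"
  shows "1 \<le> card (simplex_bijections (vertices T) D)"
    "card (simplex_bijections (vertices T) D) \<le> Suc DIM('a) ^ Suc DIM('a)"
proof -
  note s = open_simplexD[OF mesh_simplex[OF T]]
  have fin: "finite (simplex_bijections (vertices T) D)" using s(3) ref(3) by (rule finite_simplex_bijections)
  obtain g where g: "bij_betw g (vertices T) D"
    using finite_same_card_bij[OF s(3) ref(3)] s(2) ref(2) by auto
  have "bij_betw (restrict g (vertices T)) (vertices T) D" using g by (subst bij_betw_cong[of _ _ g]) auto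
  moreover have "restrict g (vertices T) \<in> vertices T \<rightarrow>\<^sub>E D" using g by (auto simp: bij_betw_def)
  ultimately have "restrict g (vertices T) \<in> simplex_bijections (vertices T) D" by (simp add: simplex_bijections_def)
  then show "1 \<le> card (simplex_bijections (vertices T) D)" using fin by (metis One_nat_def Suc_leI card_gt_0_iff empty_iff)
  have "card (simplex_bijections (vertices T) D) \<le> card (vertices T \<rightarrow>\<^sub>E D)"
    using s(3) ref(3) by (intro card_mono) (auto simp: simplex_bijections_def intro: finite_PiE)
  then show "card (simplex_bijections (vertices T) D) \<le> Suc DIM('a) ^ Suc DIM('a)"
    using s(2,3) ref(2) by (simp add: card_PiE)
qed

lemma m_nonneg: "m \<ge> 0"
proof -
  obtain x :: 'a where "x \<in> reference_simplex" using ref(6) by blast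
  then show ?thesis using m[of x] closure_subset[of "reference_simplex :: 'a set"] by force
qed

lemma piece_bound:
  assumes T: "T \<in> \<T>" and x: "x \<in> closure T" shows "\<bar>piece T x\<bar> \<le> M"
proof -
  have "\<bar>\<psi> (affine_map_of (vertices T) \<sigma> x)\<bar> \<le> m" if s: "\<sigma> \<in> simplex_bijections (vertices T) D" for \<sigma>
  proof -
    obtain A c where A: "affine_map_of (vertices T) \<sigma> = (\<lambda>x. A x + c)"
      "(\<lambda>x. A x + c) ` closure T = closure reference_simplex" by (rule map_of[OF T s])
    show ?thesis unfolding A(1) by (rule m) (use A(2) x in blast)
  qed
  then have "\<bar>piece T x\<bar> \<le> (\<Sum>\<sigma>\<in>simplex_bijections (vertices T) D. m)"
    unfolding symmetrised_def by (intro order_trans[OF sum_abs] sum_mono)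
  also have "\<dots> \<le> M"
    unfolding M_def using bijections_card(2)[OF T] m_nonneg
    by (simp only: sum_constant) (intro mult_right_mono of_nat_mono, auto)
  finally show ?thesis .
qed

lemma measure_reference_pos: "measure lborel (reference_simplex :: 'a set) > 0"
proof -
  have "emeasure lborel (reference_simplex :: 'a set) = ennreal (measure lborel (reference_simplex :: 'a set))"
    using emeasure_bounded_finite[OF ref(9)] by (intro emeasure_eq_ennreal_measure) auto
  moreover have "emeasure lborel (reference_simplex :: 'a set) \<noteq> 0"
    using ref(7) open_not_negligible[OF ref(7,6)] by (auto simp: negligible_iff_emeasure0 null_sets_def)
  ultimately have "measure lborel (reference_simplex :: 'a set) \<noteq> 0" by auto
  then show ?thesis by (simp add: zero_less_measure_iff)
qed

lemma \<kappa>_pos: "\<kappa> > 0"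
  unfolding \<kappa>_def using negative measure_reference_pos by (simp add: divide_neg_pos)

text \<open>An affine change of variables scales integral and volume by the same factor, so every
  summand has mean value \<open>- \<kappa>\<close> over \<open>T\<close>. There is at least one
  summand and all are negative, which gives an inequality free of their number.\<close>

lemma piece_integral:
  assumes T: "T \<in> \<T>"
  shows "(\<integral>x. indicator T x * piece T x \<partial>lborel) \<le> - \<kappa> * measure lborel T"
proof -
  let ?I = "\<integral>x. \<psi> x \<partial>lebesgue_on (reference_simplex :: 'a set)"
  let ?r = "measure lborel (reference_simplex :: 'a set)"
  let ?S = "simplex_bijections (vertices T) D"
  note s = open_simplexD[OF mesh_simplex[OF T]]
  have Tb: "T \<in> sets borel" using s(7) by simp
  have Rb: "(reference_simplex :: 'a set) \<in> sets borel" using ref(7) by simp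
  have one: "(\<integral>x. indicator T x * \<psi> (affine_map_of (vertices T) \<sigma> x) \<partial>lborel) = - \<kappa> * measure lborel T"
    and int: "integrable lborel (\<lambda>x. indicator T x * \<psi> (affine_map_of (vertices T) \<sigma> x))" if sg: "\<sigma> \<in> ?S" for \<sigma>
  proof -
    obtain A c where A: "linear A" "inj A" "affine_map_of (vertices T) \<sigma> = (\<lambda>x. A x + c)"
      "(\<lambda>x. A x + c) ` vertices T = D" "(\<lambda>x. A x + c) ` T = reference_simplex"
      "(\<lambda>x. A x + c) ` closure T = closure reference_simplex" by (rule map_of[OF T sg])
    have mem: "A x + c \<in> reference_simplex \<longleftrightarrow> x \<in> T" for x
      unfolding A(5)[symmetric] by (auto dest: injD[OF A(2)])
    obtain d :: real where d: "d > 0" "\<And>f :: 'a \<Rightarrow> real. f \<in> borel_measurable borel \<Longrightarrow>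
      (\<integral>x. f (A x + c) \<partial>lborel) = d * (\<integral>x. f x \<partial>lborel)"
      using integral_affine_image[OF A(1,2)] by metis
    have "(\<integral>x. indicator T x * \<psi> (A x + c) \<partial>lborel)
        = (\<integral>x. (\<lambda>y. indicator reference_simplex y * \<psi> y) (A x + c) \<partial>lborel)"
      by (intro Bochner_Integration.integral_cong) (auto simp: mem split: split_indicator)
    also have "\<dots> = d * (\<integral>x. indicator reference_simplex x * \<psi> x \<partial>lborel)"
      using \<psi>_borel Rb by (intro d(2) borel_measurable_times borel_measurable_indicator)
    also have "(\<integral>x. indicator reference_simplex x * \<psi> x \<partial>lborel) = ?I"
      by (rule integral_lebesgue_on_borel[OF Rb \<psi>_borel, symmetric])
    finally have 1: "(\<integral>x. indicator T x * \<psi> (A x + c) \<partial>lborel) = d * ?I" .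
    have "measure lborel T = (\<integral>x. indicator T x \<partial>lborel)" using Tb by simp
    also have "\<dots> = (\<integral>x. indicator reference_simplex (A x + c) \<partial>lborel)"
      by (intro Bochner_Integration.integral_cong) (auto simp: mem split: split_indicator)
    also have "\<dots> = d * ?r" using d(2)[of "indicator reference_simplex"] Rb by simp
    finally have 2: "measure lborel T = d * ?r" .
    show "(\<integral>x. indicator T x * \<psi> (affine_map_of (vertices T) \<sigma> x) \<partial>lborel) = - \<kappa> * measure lborel T"
      unfolding A(3) 1 2 \<kappa>_def using measure_reference_pos by (simp add: field_simps)
    have pm: "(\<lambda>x. \<psi> (A x + c)) \<in> borel_measurable borel"
      using polydeg_continuous[OF polydeg_affine_comp[OF \<psi>_poly A(1)]] by (rule borel_measurable_continuous_onI)
    show "integrable lborel (\<lambda>x. indicator T x * \<psi> (affine_map_of (vertices T) \<sigma> x))"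
      unfolding A(3)
    proof (rule Bochner_Integration.integrable_bound[of _ "\<lambda>x. m * indicator T x"])
      show "integrable lborel (\<lambda>x. m * indicator T x)"
        using Tb emeasure_bounded_finite[OF s(9)] by (intro integrable_mult_right integrable_real_indicator) auto
      show "(\<lambda>x. indicator T x * \<psi> (A x + c)) \<in> borel_measurable lborel"
        using pm Tb by (simp add: borel_measurable_times borel_measurable_indicator)
      have "\<bar>\<psi> (A x + c)\<bar> \<le> m" if "x \<in> T" for x
        using mem[of x] that closure_subset[of "reference_simplex :: 'a set"] by (intro m) auto
      then show "AE x in lborel. norm (indicator T x * \<psi> (A x + c)) \<le> norm (m * indicator T x)"
        using m_nonneg by (auto split: split_indicator)
    qed
  qed
  have "(\<integral>x. indicator T x * piece T x \<partial>lborel) = (\<Sum>\<sigma>\<in>?S. \<integral>x. indicator T x * \<psi> (affine_map_of (vertices T) \<sigma> x) \<partial>lborel)"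
    unfolding symmetrised_def sum_distrib_left by (rule Bochner_Integration.integral_sum) (rule int)
  also have "\<dots> = real (card ?S) * (- \<kappa> * measure lborel T)" using one by simp
  also have "\<dots> \<le> 1 * (- \<kappa> * measure lborel T)"
    using bijections_card(1)[OF T] \<kappa>_pos by (intro mult_right_mono_neg) (auto simp: mult_nonneg_nonneg)
  finally show ?thesis by simp
qed

text \<open>A continuous finite element function equals its nodal interpolant, so the nodal values
  of the glued pieces serve as coefficients, and these are nonnegative.\<close>

lemma negative_control_Continuous:
  obtains w where "w \<in> fe_space Continuous k \<Omega> \<T>" "w \<in> nonneg_combinations (fe_basis Continuous k \<Omega> \<T>)"
    "\<And>T x. T \<in> \<T> \<Longrightarrow> x \<in> T \<Longrightarrow> w x = piece T x"
proof -
  let ?B = "fe_basis Continuous k \<Omega> \<T>"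
  obtain w where w: "w \<in> fe_space Continuous k \<Omega> \<T>" "\<And>T x. T \<in> \<T> \<Longrightarrow> x \<in> closure T \<Longrightarrow> w x = piece T x"
  proof (rule glue[of piece])
    fix T T' x assume T: "T \<in> \<T>" "T' \<in> \<T>" "x \<in> convex hull (vertices T \<inter> vertices T')"
    show "piece T x = piece T' x"
      using open_simplexD(1,2)[OF mesh_simplex[OF T(1)]] open_simplexD(1,2)[OF mesh_simplex[OF T(2)]]
      by (intro symmetrised_agree[OF _ _ _ ref(8) T(3)]) auto
  qed (auto intro: piece_polydeg)
  have pos: "w a \<ge> 0" if "a \<in> nodes" for a
  proof -
    obtain T where T: "T \<in> \<T>" "a \<in> lattice_points k (vertices T)" using \<open>a \<in> nodes\<close> by (auto simp: nodes_def)
    then have "w a = piece T a" using w(2) nodes_closure[OF T(1)] by blast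
    then show ?thesis using piece_lattice_nonneg[OF T] by simp
  qed
  have "\<exists>\<phi>. \<phi> \<in> ?B \<and> \<phi> a = 1 \<and> (\<forall>b\<in>nodes - {a}. \<phi> b = 0)" if "a \<in> nodes" for a
    using nodal_function_exists[OF that] by (metis DiffD1 DiffD2 insertI1)
  then obtain \<phi> where \<phi>: "\<And>a. a \<in> nodes \<Longrightarrow> \<phi> a \<in> ?B \<and> \<phi> a a = 1 \<and> (\<forall>b\<in>nodes - {a}. \<phi> a b = 0)"
    by metis
  let ?v = "\<lambda>x. \<Sum>a\<in>nodes. w a * \<phi> a x"
  have v: "?v \<in> nonneg_combinations ?B"
    by (intro nonneg_combinations_sum nonneg_combinations_cmult nonneg_combinations_base[OF finite_fe_basis] pos)
      (use \<phi> in \<open>blast+\<close>)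
  have v': "?v \<in> fe_space Continuous k \<Omega> \<T>"
    by (intro fe_space_sum fe_space_cmult subsetD[OF fe_basis_subset]) (use \<phi> in blast)
  have "(\<lambda>x. w x + - 1 * ?v x) = (\<lambda>x. 0)"
  proof (rule fe_space_Continuous_zero)
    show "(\<lambda>x. w x + - 1 * ?v x) \<in> fe_space Continuous k \<Omega> \<T>"
      by (intro fe_space_add fe_space_cmult w(1) v')
    show "w b + - 1 * ?v b = 0" if b: "b \<in> nodes" for b
    proof -
      have "?v b = (\<Sum>a\<in>nodes. if a = b then w b else 0)"
      proof (rule sum.cong[OF refl])
        fix a assume "a \<in> nodes"
        from \<phi>[OF this] b show "w a * \<phi> a b = (if a = b then w b else 0)" by auto
      qed
      then show ?thesis using b finite_nodes by simp
    qed
  qed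
  then have "w x + - 1 * ?v x = 0" for x by (rule fun_cong)
  then have "w x = ?v x" for x by (metis add.inverse_inverse add_eq_0_iff mult_minus1)
  then have "w = ?v" by (rule ext)
  then have "w \<in> nonneg_combinations ?B" using v by simp
  moreover have "w x = piece T x" if "T \<in> \<T>" "x \<in> T" for T x
    using w(2)[OF that(1)] that(2) closure_subset by blast
  ultimately show thesis using that w(1) by blast
qed

text \<open>Each single pullback is a basis function here. The symmetrised sum is used all the same,
  so that both kinds of elements share the estimates for \<open>piece\<close>.\<close>

lemma negative_control_Discontinuous:
  obtains w where "w \<in> fe_space Discontinuous k \<Omega> \<T>" "w \<in> nonneg_combinations (fe_basis Discontinuous k \<Omega> \<T>)"
    "\<And>T x. T \<in> \<T> \<Longrightarrow> x \<in> T \<Longrightarrow> w x = piece T x"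
proof -
  let ?B = "fe_basis Discontinuous k \<Omega> \<T>"
  let ?f = "\<lambda>T \<sigma> x. if x \<in> T then \<psi> (affine_map_of (vertices T) \<sigma> x) else 0"
  let ?w = "\<lambda>x. \<Sum>T\<in>\<T>. \<Sum>\<sigma>\<in>simplex_bijections (vertices T) D. ?f T \<sigma> x"
  have f: "?f T \<sigma> \<in> ?B" if T: "T \<in> \<T>" and s: "\<sigma> \<in> simplex_bijections (vertices T) D" for T \<sigma>
  proof -
    obtain A c where A: "linear A" "affine_map_of (vertices T) \<sigma> = (\<lambda>x. A x + c)"
      "(\<lambda>x. A x + c) ` T = reference_simplex" by (rule map_of[OF T s])
    then show ?thesis
      unfolding fe_basis.simps using T \<psi>
      by (intro CollectI exI[of _ T] exI[of _ \<psi>] exI[of _ "affine_map_of (vertices T) \<sigma>"]) auto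
  qed
  have w: "?w \<in> nonneg_combinations ?B"
    using f finite_fe_basis[of Discontinuous]
    by (intro nonneg_combinations_sum nonneg_combinations_base)
  have "?w \<in> fe_space Discontinuous k \<Omega> \<T>"
    using f fe_basis_subset[of Discontinuous] by (intro fe_space_sum) blast
  moreover have "?w x = piece T x" if T: "T \<in> \<T>" "x \<in> T" for T x
  proof -
    have "?w x = (\<Sum>T'\<in>\<T>. if T' = T then piece T x else 0)"
    proof (rule sum.cong[OF refl])
      fix T' assume "T' \<in> \<T>"
      then have "x \<in> T' \<longleftrightarrow> T' = T" using mesh_disjoint[of T' T x] T by blast
      then show "(\<Sum>\<sigma>\<in>simplex_bijections (vertices T') D. ?f T' \<sigma> x) = (if T' = T then piece T x else 0)"
        by (simp add: symmetrised_def)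
    qed
    then show ?thesis using T finite_mesh by simp
  qed
  ultimately show thesis by (intro that[OF _ w])
qed

lemma negative_control:
  obtains w where "w \<in> fe_space K k \<Omega> \<T>" "w \<in> nonneg_combinations (fe_basis K k \<Omega> \<T>)"
    "L2_inner \<Omega> w (\<lambda>x. 1) \<le> - \<kappa> * measure lebesgue \<Omega>" "L2_inner \<Omega> w w \<le> M\<^sup>2 * measure lebesgue \<Omega>"
proof -
  obtain w where w: "w \<in> fe_space K k \<Omega> \<T>" "w \<in> nonneg_combinations (fe_basis K k \<Omega> \<T>)"
    "\<And>T x. T \<in> \<T> \<Longrightarrow> x \<in> T \<Longrightarrow> w x = piece T x"
    by (cases K) (metis negative_control_Discontinuous, metis negative_control_Continuous)
  have wL: "w \<in> L2 \<Omega>" by (rule fe_space_L2[OF w(1)])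
  have one: "(\<lambda>x. 1) \<in> L2 \<Omega>" by (rule L2_const[OF lmeasurable_\<Omega>])
  have off: "AE x in lebesgue. x \<notin> \<Omega> - \<Union>\<T>"
    using negligible_skeleton by (intro AE_not_in) (simp add: negligible_iff_null_sets)
  have \<Omega>s: "\<Omega> \<in> sets lebesgue" using open_\<Omega> by simp
  have Tb: "T \<in> sets borel" if "T \<in> \<T>" for T using open_simplexD(7)[OF mesh_simplex[OF that]] by simp
  have pb: "piece T \<in> borel_measurable borel" if "T \<in> \<T>" for T
    using polydeg_continuous[OF piece_polydeg[OF that]] by (rule borel_measurable_continuous_onI)
  have ib: "(\<lambda>x. indicator T x * piece T x) \<in> borel_measurable borel" if "T \<in> \<T>" for T
    using Tb[OF that] pb[OF that] by (intro borel_measurable_times borel_measurable_indicator)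
  have int: "integrable lborel (\<lambda>x. indicator T x * piece T x)" if T: "T \<in> \<T>" for T
  proof (rule Bochner_Integration.integrable_bound[of _ "\<lambda>x. M * indicator T x"])
    show "integrable lborel (\<lambda>x. M * indicator T x)"
      using Tb[OF T] emeasure_bounded_finite[OF open_simplexD(9)[OF mesh_simplex[OF T]]]
      by (intro integrable_mult_right integrable_real_indicator) auto
    show "(\<lambda>x. indicator T x * piece T x) \<in> borel_measurable lborel" using ib[OF T] by simp
    have "\<bar>piece T x\<bar> \<le> \<bar>M\<bar>" if "x \<in> T" for x
      using piece_bound[OF T, of x] closure_subset[of T] that by auto
    then show "AE x in lborel. norm (indicator T x * piece T x) \<le> norm (M * indicator T x)"
      by (auto split: split_indicator)
  qed
  have sum_eq: "(\<Sum>T\<in>\<T>. indicator T x * g T) = g T" if "T \<in> \<T>" "x \<in> T" for x T and g :: "'a set \<Rightarrow> real"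
  proof -
    have "(\<Sum>T'\<in>\<T>. indicator T' x * g T') = (\<Sum>T'\<in>\<T>. if T' = T then g T else 0)"
      using that mesh_disjoint by (intro sum.cong) (auto simp: indicator_def)
    then show ?thesis using that finite_mesh by simp
  qed
  have sum_0: "(\<Sum>T\<in>\<T>. indicator T x * g T) = 0" if "x \<notin> \<Omega>" for x and g :: "'a set \<Rightarrow> real"
    using that mesh_subset by (intro sum.neutral) (auto simp: indicator_def)
  have ae: "AE x in lebesgue. indicator \<Omega> x * w x = (\<Sum>T\<in>\<T>. indicator T x * piece T x)"
    using off
  proof eventually_elim
    case (elim x)
    show ?case
    proof (cases "x \<in> \<Omega>")
      case True
      then obtain T where "T \<in> \<T>" "x \<in> T" using elim by auto
      then show ?thesis using sum_eq[of T x "\<lambda>T. piece T x"] w(3) True by simp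
    next
      case False
      then show ?thesis using sum_0[of x "\<lambda>T. piece T x"] by simp
    qed
  qed
  have sm: "(\<lambda>x. \<Sum>T\<in>\<T>. indicator T x * piece T x) \<in> borel_measurable lborel"
    using ib by (intro borel_measurable_sum) simp
  have wm: "(\<lambda>x. indicator \<Omega> x * w x) \<in> borel_measurable lebesgue"
    using borel_measurable_AE[OF measurable_completion[OF sm]] ae by (auto simp: eq_commute)
  have "L2_inner \<Omega> w (\<lambda>x. 1) = (\<integral>x. indicator \<Omega> x * w x \<partial>lebesgue)"
    unfolding L2_inner_def using \<Omega>s by (subst integral_restrict_space) auto
  also have "\<dots> = (\<integral>x. (\<Sum>T\<in>\<T>. indicator T x * piece T x) \<partial>lebesgue)"
    by (rule integral_cong_AE[OF wm measurable_completion[OF sm] ae])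
  also have "\<dots> = (\<integral>x. (\<Sum>T\<in>\<T>. indicator T x * piece T x) \<partial>lborel)"
    by (rule integral_completion[OF sm])
  also have "\<dots> = (\<Sum>T\<in>\<T>. \<integral>x. indicator T x * piece T x \<partial>lborel)"
    by (rule Bochner_Integration.integral_sum) (rule int)
  also have "\<dots> \<le> (\<Sum>T\<in>\<T>. - \<kappa> * measure lborel T)" by (rule sum_mono) (rule piece_integral)
  also have "\<dots> = - \<kappa> * (\<Sum>T\<in>\<T>. measure lebesgue T)"
    using Tb by (simp add: sum_distrib_left)
  also have "(\<Sum>T\<in>\<T>. measure lebesgue T) = measure lebesgue (\<Union>\<T>)"
  proof (rule measure_Union'[symmetric])
    show "\<And>S. S \<in> \<T> \<Longrightarrow> S \<in> lmeasurable"
      using open_simplexD(7,9)[OF mesh_simplex] lmeasurable_open by blast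
    show "pairwise disjnt \<T>" using decomposition by (simp add: simplicial_decomposition_def)
  qed (rule finite_mesh)
  also have "measure lebesgue (\<Union>\<T>) = measure lebesgue \<Omega>"
  proof (rule measure_negligible_symdiff)
    show "\<Omega> \<in> lmeasurable" by (rule lmeasurable_\<Omega>)
    have "\<Union>\<T> - \<Omega> = {}" using mesh_subset by blast
    then show "negligible (\<Omega> - \<Union>\<T> \<union> (\<Union>\<T> - \<Omega>))" using negligible_skeleton by simp
  qed
  finally have 1: "L2_inner \<Omega> w (\<lambda>x. 1) \<le> - \<kappa> * measure lebesgue \<Omega>" .
  have "AE x in lebesgue_on \<Omega>. w x * w x \<le> M\<^sup>2"
  proof -
    have "AE x in lebesgue. x \<in> \<Omega> \<longrightarrow> w x * w x \<le> M\<^sup>2"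
      using off
    proof eventually_elim
      case (elim x)
      show ?case
      proof
        assume "x \<in> \<Omega>"
        then obtain T where T: "T \<in> \<T>" "x \<in> T" using elim by auto
        then have "\<bar>w x\<bar> \<le> M" using piece_bound[OF T(1), of x] closure_subset[of T] w(3)[OF T] by auto
        then have "\<bar>w x\<bar> ^ 2 \<le> M\<^sup>2" by (intro power_mono) auto
        then show "w x * w x \<le> M\<^sup>2" by (simp add: power2_eq_square)
      qed
    qed
    then show ?thesis using \<Omega>s by (simp add: AE_restrict_space_iff)
  qed
  then have "L2_inner \<Omega> w w \<le> (\<integral>x. M\<^sup>2 \<partial>lebesgue_on \<Omega>)"
    unfolding L2_inner_def
    using L2_mult_integrable[OF wL wL] L2_integrable[OF lmeasurable_\<Omega> L2_const[OF lmeasurable_\<Omega>]]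
    by (intro integral_mono_AE) auto
  also have "\<dots> = M\<^sup>2 * measure lebesgue \<Omega>"
    using lmeasurable_\<Omega> by (simp add: measure_restrict_space fmeasurableD)
  finally show thesis using that w(1,2) 1 by blast
qed

end

section \<open>The discretized problem\<close>

lemma compact_coefficient_box:
  "compact {l :: 'i \<Rightarrow> real. \<forall>i. if i \<in> B then 0 \<le> l i \<and> l i \<le> R else l i = 0}"
proof -
  let ?S = "\<lambda>i. if i \<in> B then {0..R} else {0 :: real}"
  \<comment> \<open>Tychonoff's theorem in the full function space, which is why coordinates off
    \<open>B\<close> are pinned to 0.\<close>
  have "compactin (product_topology (\<lambda>i. euclidean) UNIV) (PiE UNIV ?S)"
    by (subst compactin_PiE) auto
  then have "compact (PiE UNIV ?S)"
    by (simp add: euclidean_product_topology)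
  moreover have "PiE UNIV ?S = {l. \<forall>i. if i \<in> B then 0 \<le> l i \<and> l i \<le> R else l i = 0}"
    by (auto simp: PiE_iff split: if_splits)
  ultimately show ?thesis by simp
qed

text \<open>On coefficients of sum 1 the form \<open>Q\<close> has a positive lower bound
  \<open>q\<close> by compactness, and homogeneity gives \<open>Q l \<ge> q * s\<^sup>2\<close> for
  coefficient sum \<open>s\<close>. So the cost exceeds its value at 0 when \<open>s\<close> is
  large, and minimising over a compact box suffices.\<close>

lemma coercive_attains_min_on_cone:
  fixes J Q :: "('i \<Rightarrow> real) \<Rightarrow> real"
  assumes B: "finite B" and cont: "continuous_on UNIV J" "continuous_on UNIV Q"
    and hom: "\<And>c l. Q (\<lambda>i. c * l i) = c\<^sup>2 * Q l"
    and pos: "\<And>l i. i \<in> B \<Longrightarrow> l i \<noteq> 0 \<Longrightarrow> Q l > 0"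
    and coercive: "\<And>l. \<alpha> * Q l \<le> J l" and \<alpha>: "\<alpha> > 0"
    and dep: "\<And>l l'. (\<And>i. i \<in> B \<Longrightarrow> l i = l' i) \<Longrightarrow> J l = J l'"
    and depQ: "\<And>l l'. (\<And>i. i \<in> B \<Longrightarrow> l i = l' i) \<Longrightarrow> Q l = Q l'"
  shows "\<exists>l. (\<forall>i\<in>B. 0 \<le> l i) \<and> (\<forall>l'. (\<forall>i\<in>B. 0 \<le> l' i) \<longrightarrow> J l \<le> J l')"
proof -
  let ?K = "\<lambda>R. {l :: 'i \<Rightarrow> real. \<forall>i. if i \<in> B then 0 \<le> l i \<and> l i \<le> R else l i = 0}"
  define S where "S = ?K 1 \<inter> {l. (\<Sum>i\<in>B. l i) = 1}"
  have "closed {l :: 'i \<Rightarrow> real. (\<Sum>i\<in>B. l i) = 1}"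
    by (intro closed_Collect_eq continuous_intros continuous_on_product_coordinates)
  then have S: "compact S" unfolding S_def by (intro compact_Int_closed compact_coefficient_box)
  \<comment> \<open>\<open>S\<close> is empty exactly when \<open>B\<close> is; the bound is then
    vacuous and any positive \<open>q\<close> serves.\<close>
  obtain q where q: "q > 0" "\<And>l. l \<in> S \<Longrightarrow> q \<le> Q l"
  proof (cases "S = {}")
    case True
    then show ?thesis using that[of 1] by auto
  next
    case False
    obtain l0 where l0: "l0 \<in> S" "\<And>l. l \<in> S \<Longrightarrow> Q l0 \<le> Q l"
      using continuous_attains_inf[OF S False continuous_on_subset[OF cont(2)]] by auto
    have "\<exists>i\<in>B. l0 i \<noteq> 0"
    proof (rule ccontr)
      assume "\<not> ?thesis"
      then have "(\<Sum>i\<in>B. l0 i) = 0" by simp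
      then show False using l0(1) by (simp add: S_def)
    qed
    then have "Q l0 > 0" using pos by blast
    then show ?thesis using that l0(2) by blast
  qed
  have Qlow: "q * (\<Sum>i\<in>B. l i)\<^sup>2 \<le> Q l" if l: "\<And>i. i \<in> B \<Longrightarrow> 0 \<le> l i" and s: "(\<Sum>i\<in>B. l i) > 0" for l
  proof -
    let ?s = "\<Sum>i\<in>B. l i"
    let ?l = "\<lambda>i. if i \<in> B then l i / ?s else 0"
    have "l i \<le> ?s" if "i \<in> B" for i using member_le_sum[OF that, of l] l B by auto
    then have "?l \<in> ?K 1" using l s by simp
    moreover have "(\<Sum>i\<in>B. ?l i) = 1" using s by (simp add: sum_divide_distrib[symmetric])
    ultimately have "?l \<in> S" unfolding S_def by blast
    then have "q * ?s\<^sup>2 \<le> Q ?l * ?s\<^sup>2" by (intro mult_right_mono q(2) zero_le_power2)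
    also have "\<dots> = Q (\<lambda>i. ?s * ?l i)" unfolding hom by (rule mult.commute)
    also have "\<dots> = Q l" by (rule depQ) (use s in simp)
    finally show ?thesis .
  qed
  \<comment> \<open>Large enough that \<open>\<alpha> * q * R\<close> exceeds the cost at 0. The
    final \<open>+ 1\<close> gives \<open>R \<ge> 1\<close>, so a coefficient sum
    \<open>s > R\<close> satisfies \<open>s\<^sup>2 \<ge> R\<close>.\<close>
  define R where "R = (J (\<lambda>_. 0) + 1) / (\<alpha> * q) + 1"
  have "Q (\<lambda>_. 0) = 0" using hom[of 0 "\<lambda>_. 0"] by simp
  then have J0: "J (\<lambda>_. 0) \<ge> 0" using coercive[of "\<lambda>_. 0"] by simp
  have p: "\<alpha> * q > 0" using \<alpha> q(1) by simp
  then have "\<alpha> * q * R = J (\<lambda>_. 0) + 1 + \<alpha> * q" unfolding R_def by (subst distrib_left) auto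
  then have R: "\<alpha> * q * R > J (\<lambda>_. 0)" "R \<ge> 1" using p J0 by (auto simp: R_def)
  have zero: "(\<lambda>_. 0) \<in> ?K R" using R by simp
  have "?K R \<noteq> {}"
  proof
    assume "?K R = {}"
    with zero show False by (simp only: empty_iff)
  qed
  then obtain l where l: "l \<in> ?K R" "\<And>l'. l' \<in> ?K R \<Longrightarrow> J l \<le> J l'"
    using continuous_attains_inf[OF compact_coefficient_box _ continuous_on_subset[OF cont(1)], of B R] by auto
  show ?thesis
  proof (intro exI[of _ l] conjI ballI allI impI)
    show "0 \<le> l i" if "i \<in> B" for i using spec[OF l(1)[unfolded mem_Collect_eq], of i] that by simp
    fix l' :: "'i \<Rightarrow> real" assume "\<forall>i\<in>B. 0 \<le> l' i"
    then have l': "\<And>i. i \<in> B \<Longrightarrow> 0 \<le> l' i" by blast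
    let ?l = "\<lambda>i. if i \<in> B then l' i else 0"
    have JJ: "J l' = J ?l" by (rule dep) simp
    show "J l \<le> J l'"
    proof (cases "(\<Sum>i\<in>B. l' i) \<le> R")
      case True
      have "l' i \<le> R" if "i \<in> B" for i
        using member_le_sum[OF that, of l'] l' B True by force
      then have "?l \<in> ?K R" using l' by simp
      then show ?thesis unfolding JJ by (rule l(2))
    next
      case False
      let ?s = "\<Sum>i\<in>B. l' i"
      have "J (\<lambda>_. 0) < \<alpha> * q * R" by (rule R(1))
      also have "\<dots> \<le> \<alpha> * q * ?s\<^sup>2"
      proof -
        have "R \<le> ?s * 1" using False by simp
        also have "\<dots> \<le> ?s * ?s" using False R(2) by (intro mult_left_mono) auto
        finally show ?thesis using \<alpha> q(1) by (simp add: power2_eq_square)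
      qed
      also have "\<dots> \<le> \<alpha> * Q l'"
        using Qlow[of l'] l' False R(2) \<alpha> by (simp add: mult.assoc)
      also have "\<dots> \<le> J l'" by (rule coercive)
      finally show ?thesis using l(2)[OF zero] by simp
    qed
  qed
qed

text \<open>The last term is the gap of strict convexity; it forces two minimisers to
  coincide.\<close>

lemma L2_inner_midpoint:
  assumes f: "f \<in> L2 \<Omega>" and g: "g \<in> L2 \<Omega>"
  shows "L2_inner \<Omega> (\<lambda>x. 1 / 2 * f x + 1 / 2 * g x) (\<lambda>x. 1 / 2 * f x + 1 / 2 * g x)
    = (L2_inner \<Omega> f f + L2_inner \<Omega> g g) / 2 - L2_inner \<Omega> (\<lambda>x. f x - g x) (\<lambda>x. f x - g x) / 4"
proof -
  have hf: "(\<lambda>x. 1 / 2 * f x) \<in> L2 \<Omega>" and hg: "(\<lambda>x. 1 / 2 * g x) \<in> L2 \<Omega>"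
    by (rule L2_cmult[OF f], rule L2_cmult[OF g])
  have 1: "L2_inner \<Omega> (\<lambda>x. 1 / 2 * f x + 1 / 2 * g x) (\<lambda>x. 1 / 2 * f x + 1 / 2 * g x)
      = 1 / 4 * L2_inner \<Omega> f f + 1 / 2 * L2_inner \<Omega> f g + 1 / 4 * L2_inner \<Omega> g g"
    by (simp only: L2_inner_add_left[OF hf hg L2_add[OF hf hg]] L2_inner_add_right[OF hf hg hf]
        L2_inner_add_right[OF hf hg hg] L2_inner_add_right[OF hf hg f] L2_inner_add_right[OF hf hg g]
        L2_inner_cmult_left L2_inner_cmult_right L2_inner_commute[of \<Omega> g f]) (simp add: field_simps)
  have 2: "L2_inner \<Omega> (\<lambda>x. f x - g x) (\<lambda>x. f x - g x)
      = L2_inner \<Omega> f f - 2 * L2_inner \<Omega> f g + L2_inner \<Omega> g g"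
    by (simp only: L2_inner_diff_left[OF f g L2_diff[OF f g]] L2_inner_diff_right[OF f g f]
        L2_inner_diff_right[OF f g g] L2_inner_commute[of \<Omega> g f])
  show ?thesis unfolding 1 2 by (simp add: field_simps)
qed

lemma L2_inner_combination:
  assumes "finite B" "\<And>b. b \<in> B \<Longrightarrow> f b \<in> L2 \<Omega>"
  shows "L2_inner \<Omega> (\<lambda>x. \<Sum>b\<in>B. l b * f b x) (\<lambda>x. \<Sum>b\<in>B. l b * f b x)
    = (\<Sum>b\<in>B. \<Sum>c\<in>B. l b * (l c * L2_inner \<Omega> (f b) (f c)))"
proof -
  have L: "(\<lambda>x. l b * f b x) \<in> L2 \<Omega>" if "b \<in> B" for b by (rule L2_cmult[OF assms(2)[OF that]])
  have S: "(\<lambda>x. \<Sum>b\<in>B. l b * f b x) \<in> L2 \<Omega>" by (rule L2_sum[OF L])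
  have "L2_inner \<Omega> (\<lambda>x. l b * f b x) (\<lambda>x. \<Sum>b\<in>B. l b * f b x)
      = (\<Sum>c\<in>B. l b * (l c * L2_inner \<Omega> (f b) (f c)))" if b: "b \<in> B" for b
  proof -
    have "L2_inner \<Omega> (f b) (\<lambda>x. \<Sum>b\<in>B. l b * f b x) = (\<Sum>c\<in>B. L2_inner \<Omega> (f b) (\<lambda>x. l c * f c x))"
      by (rule L2_inner_sum_right[OF _ assms(2)[OF b]]) (rule L)
    then show ?thesis by (simp only: L2_inner_cmult_left L2_inner_cmult_right sum_distrib_left)
  qed
  moreover have "L2_inner \<Omega> (\<lambda>x. \<Sum>b\<in>B. l b * f b x) (\<lambda>x. \<Sum>b\<in>B. l b * f b x)
      = (\<Sum>b\<in>B. L2_inner \<Omega> (\<lambda>x. l b * f b x) (\<lambda>x. \<Sum>b\<in>B. l b * f b x))"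
    by (rule L2_inner_sum_left[OF _ S]) (rule L)
  ultimately show ?thesis by simp
qed

section \<open>Existence and uniqueness of the minimiser\<close>

locale discretized_problem = mesh \<Omega> h \<T> k + galerkin_consts \<Omega> V
  for \<Omega> :: "'a::euclidean_space set" and h \<T> k V +
  fixes \<alpha> :: real and K :: element_kind
  assumes \<alpha>: "\<alpha> > 0"
begin

abbreviation cost :: "('a \<Rightarrow> real) \<Rightarrow> real" where
  "cost \<equiv> discrete_cost \<Omega> (\<lambda>_. -1) \<alpha> V"

abbreviation basis :: "('a \<Rightarrow> real) set" where
  "basis \<equiv> fe_basis K k \<Omega> \<T>"

abbreviation solution :: "('a \<Rightarrow> real) \<Rightarrow> bool" where
  "solution \<equiv> solves_discretized_problem K k \<Omega> (\<lambda>_. -1) \<alpha> \<T> V"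

lemma basis_L2: "\<phi> \<in> basis \<Longrightarrow> \<phi> \<in> L2 \<Omega>"
  using fe_basis_subset fe_space_L2 by blast

lemma combination_fe_space: "(\<lambda>x. \<Sum>\<phi>\<in>basis. l \<phi> * \<phi> x) \<in> fe_space K k \<Omega> \<T>"
  using fe_basis_subset[of K] by (intro fe_space_sum fe_space_cmult) blast

lemma solution_iff:
  "solution u \<longleftrightarrow> u \<in> nonneg_combinations basis \<and> (\<forall>v\<in>nonneg_combinations basis. cost u \<le> cost v)"
proof -
  have "v \<in> fe_space K k \<Omega> \<T>" if "v \<in> nonneg_combinations basis" for v
    using that combination_fe_space unfolding nonneg_combinations_def by blast
  then show ?thesis
    unfolding solves_discretized_problem_def is_arg_min_def by (auto simp del: fe_space.simps fe_basis.simps simp: not_less)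
qed

lemma feasible_fe_space: "u \<in> nonneg_combinations basis \<Longrightarrow> u \<in> fe_space K k \<Omega> \<T>"
  using combination_fe_space unfolding nonneg_combinations_def by blast

lemma feasible_L2: "u \<in> nonneg_combinations basis \<Longrightarrow> u \<in> L2 \<Omega>"
  using feasible_fe_space fe_space_L2 by blast

lemma cost_ge: "\<alpha> * L2_inner \<Omega> u u \<le> cost u"
  unfolding discrete_cost_def L2_norm_eq[of \<Omega> u] by simp

lemma state_combination:
  assumes "finite B" "\<And>b. b \<in> B \<Longrightarrow> f b \<in> L2 \<Omega>"
  shows "L2_inner \<Omega> (state (\<lambda>x. \<Sum>b\<in>B. l b * f b x)) (state (\<lambda>x. \<Sum>b\<in>B. l b * f b x))
    = L2_inner \<Omega> (\<lambda>x. \<Sum>b\<in>B. l b * state (f b) x) (\<lambda>x. \<Sum>b\<in>B. l b * state (f b) x)"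
proof (intro L2_inner_cong_AE)
  show "state (\<lambda>x. \<Sum>b\<in>B. l b * f b x) \<in> L2 \<Omega>" by (intro state_L2 L2_sum L2_cmult assms(2))
  then show "state (\<lambda>x. \<Sum>b\<in>B. l b * f b x) \<in> L2 \<Omega>" .
  show "(\<lambda>x. \<Sum>b\<in>B. l b * state (f b) x) \<in> L2 \<Omega>" by (intro L2_sum L2_cmult state_L2 assms(2))
  then show "(\<lambda>x. \<Sum>b\<in>B. l b * state (f b) x) \<in> L2 \<Omega>" .
  show "AE x in lebesgue_on \<Omega>. state (\<lambda>x. \<Sum>b\<in>B. l b * f b x) x = (\<Sum>b\<in>B. l b * state (f b) x)"
    by (rule state_sum[OF assms])
  then show "AE x in lebesgue_on \<Omega>. state (\<lambda>x. \<Sum>b\<in>B. l b * f b x) x = (\<Sum>b\<in>B. l b * state (f b) x)" .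
qed

lemma solution_exists: "\<exists>u. solution u"
proof -
  let ?c = "\<lambda>l x. \<Sum>\<phi>\<in>basis. l \<phi> * \<phi> x"
  let ?J = "\<lambda>l. cost (?c l)" and ?Q = "\<lambda>l. L2_inner \<Omega> (?c l) (?c l)"
  note fin = finite_fe_basis[of K]
  have one: "(\<lambda>x. 1) \<in> L2 \<Omega>" by (rule L2_const[OF lmeasurable_\<Omega>])
  have cL: "?c l \<in> L2 \<Omega>" for l by (rule fe_space_L2[OF combination_fe_space])
  have Q: "?Q l = (\<Sum>b\<in>basis. \<Sum>c\<in>basis. l b * (l c * L2_inner \<Omega> b c))" for l
    using L2_inner_combination[OF fin, of "\<lambda>b. b" \<Omega> l] basis_L2 by simp
  \<comment> \<open>The cost is a polynomial of degree at most 2 in the coefficients, from which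
    continuity in the product topology is read off.\<close>
  have J: "?J l = (\<Sum>b\<in>basis. \<Sum>c\<in>basis. l b * (l c * L2_inner \<Omega> (state b) (state c)))
      + 2 * (\<Sum>b\<in>basis. l b * L2_inner \<Omega> b (\<lambda>x. 1)) + measure lebesgue \<Omega> + \<alpha> * ?Q l" for l
    unfolding discrete_cost_eq[OF cL]
    using state_combination[OF fin, of "\<lambda>b. b" l] L2_inner_combination[OF fin, of state \<Omega> l]
      L2_inner_sum_left[of basis "\<lambda>b x. l b * b x" \<Omega> "\<lambda>x. 1"] one basis_L2 state_L2
    by (simp add: L2_cmult L2_inner_cmult_left)
  have cQ: "continuous_on UNIV ?Q"
    unfolding Q by (intro continuous_intros continuous_on_product_coordinates)
  have cJ: "continuous_on UNIV ?J"
    unfolding J by (intro continuous_intros continuous_on_product_coordinates cQ)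
  have hom: "?Q (\<lambda>\<phi>. c * l \<phi>) = c\<^sup>2 * ?Q l" for c l
    unfolding Q by (simp add: sum_distrib_left power2_eq_square ac_simps)
  \<comment> \<open>Norm 0 makes the combination vanish everywhere, not just almost everywhere, and
    then independence of the basis makes the coefficient 0.\<close>
  have pos: "0 < ?Q l" if "\<phi> \<in> basis" "l \<phi> \<noteq> 0" for l \<phi>
  proof (rule ccontr)
    assume "\<not> 0 < ?Q l"
    then have "?Q l = 0" using L2_inner_nonneg[of \<Omega> "?c l"] by simp
    then have e: "?c l = (\<lambda>x. 0)"
      using L2_inner_eq_0_iff[OF cL] by (intro fe_space_AE_zero[OF combination_fe_space]) blast
    have "l \<phi> = 0"
    proof (rule fe_basis_independent[OF _ that(1)])
      show "?c l x = 0" for x using fun_cong[OF e, of x] by (simp only:)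
    qed
    then show False using that(2) by simp
  qed
  have coer: "\<alpha> * ?Q l \<le> ?J l" for l by (rule cost_ge)
  have dep: "?J l = ?J l'" and depQ: "?Q l = ?Q l'" if e: "\<And>\<phi>. \<phi> \<in> basis \<Longrightarrow> l \<phi> = l' \<phi>" for l l'
  proof -
    have "?c l = ?c l'" using e by (intro ext sum.cong) auto
    then show "?J l = ?J l'" "?Q l = ?Q l'" by simp_all
  qed
  obtain l where l: "\<And>\<phi>. \<phi> \<in> basis \<Longrightarrow> 0 \<le> l \<phi>" "\<And>l'. (\<And>\<phi>. \<phi> \<in> basis \<Longrightarrow> 0 \<le> l' \<phi>) \<Longrightarrow> ?J l \<le> ?J l'"
  proof -
    define J Q where "J = ?J" and "Q = ?Q"
    have J: "J l = ?J l" and Q: "Q l = ?Q l" for l by (simp_all only: J_def Q_def)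
    have h1: "Q (\<lambda>\<phi>. c * l \<phi>) = c\<^sup>2 * Q l" for c l unfolding Q by (rule hom)
    have h2: "0 < Q l" if "\<phi> \<in> basis" "l \<phi> \<noteq> 0" for l \<phi>
      unfolding Q by (rule pos[where l = l and \<phi> = \<phi>, OF that])
    have h3: "\<alpha> * Q l \<le> J l" for l unfolding Q J by (rule coer)
    have h4: "J l = J l'" if "\<And>\<phi>. \<phi> \<in> basis \<Longrightarrow> l \<phi> = l' \<phi>" for l l'
      unfolding J by (rule dep[where l = l and l' = l', OF that])
    have h5: "Q l = Q l'" if "\<And>\<phi>. \<phi> \<in> basis \<Longrightarrow> l \<phi> = l' \<phi>" for l l'
      unfolding Q by (rule depQ[where l = l and l' = l', OF that])
    have h6: "continuous_on UNIV J" "continuous_on UNIV Q" unfolding J_def Q_def by (rule cJ, rule cQ)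
    have "\<exists>l. (\<forall>\<phi>\<in>basis. 0 \<le> l \<phi>) \<and> (\<forall>l'. (\<forall>\<phi>\<in>basis. 0 \<le> l' \<phi>) \<longrightarrow> J l \<le> J l')"
    proof (rule coercive_attains_min_on_cone[of basis J Q \<alpha>])
      show "0 < Q l" if "\<phi> \<in> basis" "l \<phi> \<noteq> 0" for l \<phi> by (rule h2[where l = l and \<phi> = \<phi>, OF that])
      show "J l = J l'" if "\<And>\<phi>. \<phi> \<in> basis \<Longrightarrow> l \<phi> = l' \<phi>" for l l' by (rule h4[where l = l and l' = l', OF that])
      show "Q l = Q l'" if "\<And>\<phi>. \<phi> \<in> basis \<Longrightarrow> l \<phi> = l' \<phi>" for l l' by (rule h5[where l = l and l' = l', OF that])
    qed (rule fin h6 h1 h3 \<alpha>)+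
    then obtain l where "\<forall>\<phi>\<in>basis. 0 \<le> l \<phi>" "\<forall>l'. (\<forall>\<phi>\<in>basis. 0 \<le> l' \<phi>) \<longrightarrow> J l \<le> J l'" by (elim exE conjE)
    then show thesis using that[of l] unfolding J by simp
  qed
  have "solution (?c l)"
    unfolding solution_iff nonneg_combinations_def using l by auto
  then show ?thesis by blast
qed

text \<open>The midpoint of two minimisers is feasible and would be cheaper by \<alpha> times a
  quarter of their squared distance. Distance 0 in L2 is equality for finite element
  functions.\<close>

lemma solution_unique:
  assumes u: "solution u" and v: "solution v" shows "u = v"
proof -
  have uf: "u \<in> nonneg_combinations basis" and vf: "v \<in> nonneg_combinations basis"
    using u v by (simp_all only: solution_iff)
  have uL: "u \<in> L2 \<Omega>" and vL: "v \<in> L2 \<Omega>" using uf vf feasible_L2 by blast+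
  note one = L2_const[OF lmeasurable_\<Omega>, of 1]
  let ?w = "\<lambda>x. 1 / 2 * u x + 1 / 2 * v x"
  have wf: "?w \<in> nonneg_combinations basis"
    by (intro nonneg_combinations_add nonneg_combinations_cmult uf vf) auto
  have wL: "?w \<in> L2 \<Omega>" by (rule feasible_L2[OF wf])
  have "L2_inner \<Omega> (state ?w) (state ?w)
      = L2_inner \<Omega> (\<lambda>x. 1 / 2 * state u x + 1 / 2 * state v x) (\<lambda>x. 1 / 2 * state u x + 1 / 2 * state v x)"
    \<comment> \<open>Indexing by booleans and not by the functions themselves keeps two summands
      even if \<open>u\<close> and \<open>v\<close> coincide.\<close>
    using state_combination[of "{True, False}" "\<lambda>b. if b then u else v" "\<lambda>_. 1 / 2"] uL vL by simp
  also have "\<dots> \<le> (L2_inner \<Omega> (state u) (state u) + L2_inner \<Omega> (state v) (state v)) / 2"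
    unfolding L2_inner_midpoint[OF state_L2[OF uL] state_L2[OF vL]]
    using L2_inner_nonneg[of \<Omega> "\<lambda>x. state u x - state v x"] by linarith
  finally have y: "L2_inner \<Omega> (state ?w) (state ?w) \<le> (L2_inner \<Omega> (state u) (state u) + L2_inner \<Omega> (state v) (state v)) / 2" .
  have lin: "L2_inner \<Omega> ?w (\<lambda>x. 1) = (L2_inner \<Omega> u (\<lambda>x. 1) + L2_inner \<Omega> v (\<lambda>x. 1)) / 2"
    unfolding L2_inner_add_left[OF L2_cmult[OF uL] L2_cmult[OF vL] one] L2_inner_cmult_left by simp
  let ?d = "L2_inner \<Omega> (\<lambda>x. u x - v x) (\<lambda>x. u x - v x)"
  have "\<alpha> * L2_inner \<Omega> ?w ?w = (\<alpha> * L2_inner \<Omega> u u + \<alpha> * L2_inner \<Omega> v v) / 2 - \<alpha> * ?d / 4"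
    unfolding L2_inner_midpoint[OF uL vL] by (simp add: algebra_simps)
  then have "cost ?w \<le> (cost u + cost v) / 2 - \<alpha> * ?d / 4"
    unfolding discrete_cost_eq[OF wL] discrete_cost_eq[OF uL] discrete_cost_eq[OF vL] lin using y by argo
  moreover have "cost u \<le> cost ?w" "cost v \<le> cost ?w"
    using u v wf by (auto simp only: solution_iff)
  ultimately have "\<alpha> * ?d \<le> 0" by argo
  then have "?d = 0" using \<alpha> L2_inner_nonneg[of \<Omega> "\<lambda>x. u x - v x"] by (simp add: mult_le_0_iff)
  then have "AE x in lebesgue_on \<Omega>. u x - v x = 0"
    using L2_inner_eq_0_iff[OF L2_diff[OF uL vL]] by blast
  moreover have "(\<lambda>x. u x + - 1 * v x) \<in> fe_space K k \<Omega> \<T>"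
    by (intro fe_space_add fe_space_cmult feasible_fe_space uf vf)
  ultimately have "(\<lambda>x. u x + - 1 * v x) = (\<lambda>x. 0)" by (intro fe_space_AE_zero) auto
  then have "u x + - 1 * v x = 0" for x by (rule fun_cong)
  then show "u = v" by (intro ext) (simp add: eq_neg_iff_add_eq_0[symmetric])
qed


end

section \<open>Uniform bounds for the minimisers\<close>

locale negative_problem = discretized_problem \<Omega> h \<T> k V \<alpha> K + negative_mesh \<Omega> h \<T> k \<psi> m
  for \<Omega> :: "'a::euclidean_space set" and h \<T> k V \<alpha> K \<psi> m
begin

text \<open>Chosen so that the quadratic term
  \<open>step\<^sup>2 * (1 + \<alpha>) * M\<^sup>2\<close> is at most
  \<open>step * \<kappa>\<close>, half of the linear gain \<open>2 * step * \<kappa>\<close>. The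
  added 1 keeps the denominator positive.\<close>

definition step :: real where
  "step = \<kappa> / ((1 + \<alpha>) * M\<^sup>2 + 1)"

lemma step_pos: "step > 0"
  unfolding step_def using \<kappa>_pos \<alpha> by (intro divide_pos_pos add_nonneg_pos mult_nonneg_nonneg) auto

lemma solution_cost:
  assumes u: "solution u"
  shows "cost u \<le> measure lebesgue \<Omega> - step * \<kappa> * measure lebesgue \<Omega>"
proof -
  obtain w where w: "w \<in> nonneg_combinations basis" "L2_inner \<Omega> w (\<lambda>x. 1) \<le> - \<kappa> * measure lebesgue \<Omega>"
    "L2_inner \<Omega> w w \<le> M\<^sup>2 * measure lebesgue \<Omega>" by (rule negative_control)
  let ?v = "\<lambda>x. step * w x" and ?m = "measure lebesgue \<Omega>"
  have vf: "?v \<in> nonneg_combinations basis"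
    using step_pos by (intro nonneg_combinations_cmult w(1)) simp
  have vL: "?v \<in> L2 \<Omega>" by (rule feasible_L2[OF vf])
  have vv: "L2_inner \<Omega> ?v ?v = step * (step * L2_inner \<Omega> w w)"
    by (simp only: L2_inner_cmult_left L2_inner_cmult_right)
  have sM: "step * ((1 + \<alpha>) * M\<^sup>2) \<le> \<kappa>"
  proof -
    have p: "(1 + \<alpha>) * M\<^sup>2 \<ge> 0" using \<alpha> by simp
    have "step * ((1 + \<alpha>) * M\<^sup>2) \<le> step * ((1 + \<alpha>) * M\<^sup>2 + 1)" using step_pos by simp
    also have "\<dots> = \<kappa>" unfolding step_def using p by simp
    finally show ?thesis .
  qed
  have "cost u \<le> cost ?v" using u vf by (simp only: solution_iff)
  \<comment> \<open>The squared norm of the state is at most that of the control, which merges the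
    two quadratic terms into the factor \<open>1 + \<alpha>\<close>.\<close>
  also have "\<dots> \<le> (1 + \<alpha>) * L2_inner \<Omega> ?v ?v + 2 * (step * L2_inner \<Omega> w (\<lambda>x. 1)) + ?m"
    unfolding discrete_cost_eq[OF vL] L2_inner_cmult_left[of \<Omega> step w "\<lambda>x. 1"]
    using state_norm_le[OF vL] by (simp only: distrib_right)
  also have "(1 + \<alpha>) * L2_inner \<Omega> ?v ?v = step * (step * (1 + \<alpha>)) * L2_inner \<Omega> w w"
    unfolding vv by simp
  also have "step * (step * (1 + \<alpha>)) * L2_inner \<Omega> w w \<le> step * (step * (1 + \<alpha>)) * (M\<^sup>2 * ?m)"
    using step_pos \<alpha> by (intro mult_left_mono w(3)) simp
  also have "\<dots> = step * (step * ((1 + \<alpha>) * M\<^sup>2)) * ?m" by simp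
  also have "\<dots> \<le> step * \<kappa> * ?m"
    using step_pos by (intro mult_right_mono mult_left_mono sM) auto
  also have "step * L2_inner \<Omega> w (\<lambda>x. 1) \<le> step * (- \<kappa> * ?m)"
    using step_pos by (intro mult_left_mono w(2)) simp
  finally show ?thesis by (simp add: ac_simps)
qed

text \<open>The cost dominates \<open>\<alpha> * L2_inner \<Omega> u u\<close> and, its other terms
  being nonnegative, also the measure of \<Omega> plus twice the integral of \<open>u\<close>.
  Compared with \<open>solution_cost\<close>, the latter leaves half the gain.\<close>

lemma solution_bounds:
  assumes u: "solution u"
  shows "u \<in> L2 \<Omega>" "L2_inner \<Omega> u u \<le> measure lebesgue \<Omega> / \<alpha>"
    "L2_inner \<Omega> u (\<lambda>x. 1) \<le> - (step * \<kappa> * measure lebesgue \<Omega>) / 2"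
proof -
  show uL: "u \<in> L2 \<Omega>" using u feasible_L2 by (simp only: solution_iff)
  have "0 \<le> step * \<kappa> * measure lebesgue \<Omega>" using step_pos \<kappa>_pos by simp
  then have "\<alpha> * L2_inner \<Omega> u u \<le> measure lebesgue \<Omega>"
    using solution_cost[OF u] cost_ge[of u] by linarith
  then show "L2_inner \<Omega> u u \<le> measure lebesgue \<Omega> / \<alpha>" using \<alpha> by (simp add: field_simps)
  have "0 \<le> \<alpha> * L2_inner \<Omega> u u" using \<alpha> L2_inner_nonneg[of \<Omega> u] by simp
  then show "L2_inner \<Omega> u (\<lambda>x. 1) \<le> - (step * \<kappa> * measure lebesgue \<Omega>) / 2"
    using solution_cost[OF u] L2_inner_nonneg[of \<Omega> "state u"]
    unfolding discrete_cost_eq[OF uL] by linarith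
qed

end

section \<open>Passage to the weak limit\<close>

theorem theorem4p1:
  fixes \<Omega> :: "(real ^ 'd) set"
    and \<alpha> :: real
    and k :: nat
    and K :: element_kind
    and h :: "nat \<Rightarrow> real"
    and \<T> :: "nat \<Rightarrow> (real ^ 'd) set set"
    and V :: "nat \<Rightarrow> ((real ^ 'd) \<Rightarrow> real) set"
  assumes "polyhedral_domain \<Omega>"
    and "\<alpha> > 0"
    and "k \<ge> 1"
    and "decseq h" and "h \<longlonglongrightarrow> 0"
    and "\<And>n. simplicial_decomposition \<Omega> (h n) (\<T> n)"
    and "galerkin_spaces \<Omega> V"
    and "\<exists>\<psi>\<in>reference_basis k. (\<integral>x. \<psi> x \<partial>lebesgue_on (reference_simplex :: (real ^ 'd) set)) < 0"
  shows "(\<forall>n. \<exists>!u. solves_discretized_problem K k \<Omega> (\<lambda>_. -1) \<alpha> (\<T> n) (V n) u) \<and>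
    (\<forall>ubar. (\<forall>n. solves_discretized_problem K k \<Omega> (\<lambda>_. -1) \<alpha> (\<T> n) (V n) (ubar n)) \<longrightarrow>
       (\<exists>r u. strict_mono r \<and> u \<in> L2 \<Omega> \<and>
          weakly_converges_L2 \<Omega> (\<lambda>i. ubar (r i)) u \<and>
          \<not> (AE x in lebesgue_on \<Omega>. 0 \<le> u x)))"
proof -
  obtain \<psi> :: "real ^ 'd \<Rightarrow> real" where \<psi>: "\<psi> \<in> reference_basis k" "(\<integral>x. \<psi> x \<partial>lebesgue_on reference_simplex) < 0"
    using assms(8) by blast
  have dom: "open \<Omega>" "bounded \<Omega>" "\<Omega> \<noteq> {}" using assms(1) by (auto simp: polyhedral_domain_def)
  have meas: "\<Omega> \<in> lmeasurable" using dom(1,2) by (rule lmeasurable_open[rotated])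
  have "compact (\<psi> ` closure reference_simplex)"
    using \<psi>(1) open_simplexD(9)[OF open_simplex_reference[where 'a = "real ^ 'd"]]
    by (intro compact_continuous_image) (auto simp: reference_basis_eq nodal_basis_def compact_closure intro: polydeg_continuous)
  then obtain m where m: "\<And>x. x \<in> closure reference_simplex \<Longrightarrow> \<bar>\<psi> x\<bar> \<le> m"
    using compact_imp_bounded[of "\<psi> ` closure reference_simplex"] by (auto simp: bounded_iff)
  have V: "V n \<subseteq> H1 \<Omega>" "finite_dimensional_subspace (V n)" "\<And>c. \<exists>v\<in>V n. \<forall>x\<in>\<Omega>. v x = c" for n
    using assms(7) by (auto simp: galerkin_spaces_def)
  interpret P: negative_problem \<Omega> "h n" "\<T> n" k "V n" \<alpha> K \<psi> m for n
    by unfold_locales (use dom meas assms(2,3,6) V \<psi> m in auto)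
  have unique: "\<exists>!u. solves_discretized_problem K k \<Omega> (\<lambda>_. -1) \<alpha> (\<T> n) (V n) u" for n
    using P.solution_exists[of n] P.solution_unique[of n] by blast
  have "\<exists>r u. strict_mono r \<and> u \<in> L2 \<Omega> \<and> weakly_converges_L2 \<Omega> (\<lambda>i. ubar (r i)) u \<and>
      \<not> (AE x in lebesgue_on \<Omega>. 0 \<le> u x)"
    if sol: "\<And>n. solves_discretized_problem K k \<Omega> (\<lambda>_. -1) \<alpha> (\<T> n) (V n) (ubar n)" for ubar
  proof -
    \<comment> \<open>\<open>P.step\<close> and \<open>P.\<kappa>\<close> carry no index
      \<open>n\<close>: they depend on \<alpha>, \<open>\<psi>\<close> and \<open>m\<close> only, so
      one bound serves all meshes.\<close>
    have b: "ubar n \<in> L2 \<Omega>" "L2_inner \<Omega> (ubar n) (ubar n) \<le> measure lebesgue \<Omega> / \<alpha>"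
      "L2_inner \<Omega> (ubar n) (\<lambda>x. 1) \<le> - (P.step * P.\<kappa> * measure lebesgue \<Omega>) / 2" for n
      by (rule P.solution_bounds[OF sol[of n]])+
    obtain r u where r: "strict_mono r" and w: "weakly_converges_L2 \<Omega> (\<lambda>i. ubar (r i)) u"
      by (rule L2_weakly_sequentially_compact[of \<Omega> ubar "measure lebesgue \<Omega> / \<alpha>", OF meas b(1) b(2)])
    have uL: "u \<in> L2 \<Omega>" using w by (simp add: weakly_converges_L2_def)
    have "\<forall>g\<in>L2 \<Omega>. (\<lambda>i. L2_inner \<Omega> (ubar (r i)) g) \<longlonglongrightarrow> L2_inner \<Omega> u g"
      using w by (simp add: weakly_converges_L2_def L2_inner_def)
    \<comment> \<open>As \<Omega> has finite measure, the constant 1 is in L2 and may be used to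
      test weak convergence, so the integrals converge and keep their upper bound.\<close>
    from bspec[OF this L2_const[OF meas, of 1]] have le: "L2_inner \<Omega> u (\<lambda>x. 1) \<le> - (P.step * P.\<kappa> * measure lebesgue \<Omega>) / 2"
      by (rule LIMSEQ_le_const2) (use b(3) in blast)
    have "measure lebesgue \<Omega> \<noteq> 0"
      using open_not_negligible[OF dom(1,3)] negligible_iff_measure0[OF meas] by simp
    then have "measure lebesgue \<Omega> > 0" by (simp add: zero_less_measure_iff)
    then have "P.step * P.\<kappa> * measure lebesgue \<Omega> > 0" using P.step_pos P.\<kappa>_pos by simp
    then have neg: "L2_inner \<Omega> u (\<lambda>x. 1) < 0" using le by linarith
    have "\<not> (AE x in lebesgue_on \<Omega>. 0 \<le> u x)"
    proof
      assume "AE x in lebesgue_on \<Omega>. 0 \<le> u x"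
      then have "0 \<le> L2_inner \<Omega> u (\<lambda>x. 1)"
        unfolding L2_inner_def by (intro integral_nonneg_AE) simp
      then show False using neg by simp
    qed
    then show ?thesis using r uL w by blast
  qed
  then show ?thesis using unique by blast
qed

end
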